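(* Let $p\in K$ be a minimizer of $I$ over $K$ and $\mathbf u\in K^\star$ the maximizer of $D$ over $K^\star$. For $q\in K$, $\mathbf v\in K^\star$ define the total error $\rho_{\rm tot}^2(q,\mathbf v):=\rho_I^2(q)+\rho_{-D}^2(\mathbf v)$, where $\rho_I^2(q):=I(q)-I(p)$ and $\rho_{-D}^2(\mathbf v):=-D(\mathbf v)+D(\mathbf u)$, and the primal-dual gap estimator $\eta_{\rm gap}^2(q,\mathbf v):=I(q)-D(\mathbf v)$. Then for every $q\in K$ and every $\mathbf v\in K^\star$, $$\rho_{\rm tot}^2(q,\mathbf v)=\eta_{\rm gap}^2(q,\mathbf v).$$
   Context: Domain and spaces. $\Omega\subset\mathbb R^d$, $d\in\{2,3\}$, is an open, bounded, polyhedral Lipschitz domain with outward unit normal $\mathbf n$, and $\partial\Omega=\overline{\Gamma_D}\cup\overline{\Gamma_C}$ with $\Gamma_D,\Gamma_C$ relatively open and disjoint. $(\cdot,\cdot)_\Omega$ is the $L^2(\Omega)$ inner product; $\langle\cdot,\cdot\rangle_\omega$ is the duality pairing on $\omega$, which is the $L^2(\omega)$ inner product when both arguments are in $L^2(\omega)$. $\gamma:H^1(\Omega)\to H^{1/2}(\partial\Omega)$ is the trace operator (omitted when unambiguous), and $H^{1/2}(\Gamma_X)=\{\gamma(w)|_{\Gamma_X}:w\in H^1(\Omega)\}$ for $X\in\{D,C\}$. $H^{1/2}_{00}(\Gamma_C)$ is the set of $\eta\in H^{1/2}(\Gamma_C)$ whose extension by zero $E_0\eta$ to $\partial\Omega$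 lies in $H^{1/2}(\partial\Omega)$. For $\mathbf v\in H(\mathrm{div};\Omega)$ the normal trace $\mathbf v\cdot\mathbf n\in H^{-1/2}(\partial\Omega)$ is defined by $\langle\mathbf v\cdot\mathbf n,\gamma(w)\rangle_{\partial\Omega}=(\mathbf v,\nabla w)_\Omega+(\mathrm{div}\,\mathbf v,w)_\Omega$ for all $w\in H^1(\Omega)$, and its restriction to $\Gamma_C$ is the functional $\eta\mapsto\langle\mathbf v\cdot\mathbf n,E_0\eta\rangle_{\partial\Omega}$ on $H^{1/2}_{00}(\Gamma_C)$. Let $V=\{\mathbf v\in H(\mathrm{div};\Omega):\mathbf v\cdot\mathbf n|_{\Gamma_C}\in L^2(\Gamma_C)\}$, where membership means that the restriction is represented by an $L^2(\Gamma_C)$ function, identified with $\mathbf v\cdot\mathbf n|_{\Gamma_C}$. Data. $f\in L^2(\Omega)$, $p_D\in H^{1/2}(\Gamma_D)$; $\mathbf K:\Omega\to\mathbb R^{d\times d}$ is measurable, symmetric, with constants $0<k_0<k_1$ such that $k_0|\xi|^2\le\xi^T\mathbf K(x)\xi\le k_1|\xi|^2$ for all $x\in\Omega$, $\xi\in\mathbb R^d$; $\alpha,\beta\in L^2(\Gamma_C)$ with $\alpha\le\beta$ a.e. on $\Gamma_C$; if $\Gamma_D=\emptyset$, then $\int_{\Gamma_C}\alpha\,ds\le\int_\Omega f\,dx\le\int_{\Gamma_C}\beta\,ds$. Notation: $q^+=\max(0,q)$, $q^-=\max(0,-q)$. Dirichlet pairing. For $\mathbf v\in V$ with $\mathrm{div}\,\mathbf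 v=f$, set $\langle p_D,\mathbf v\cdot\mathbf n\rangle_{\Gamma_D}:=(\mathbf v,\nabla\widehat p_D)_\Omega+(f,\widehat p_D)_\Omega-\langle\mathbf v\cdot\mathbf n,\widehat p_D\rangle_{\Gamma_C}$, where $\widehat p_D\in H^1(\Omega)$ is any function with $\gamma(\widehat p_D)|_{\Gamma_D}=p_D$ (the value does not depend on the choice; it is $0$ if $\Gamma_D=\emptyset$). Admissible sets and energies. $$K^\star=\{\mathbf v\in V:\mathrm{div}\,\mathbf v=f\text{ in }\Omega,\ \alpha\le\mathbf v\cdot\mathbf n\le\beta\text{ a.e. on }\Gamma_C\},\qquad K=\{q\in H^1(\Omega):\gamma(q)|_{\Gamma_D}=p_D\},$$ $$D(\mathbf v)=-\tfrac12\|\mathbf K^{-1/2}\mathbf v\|_{L^2(\Omega)}^2-\langle p_D,\mathbf v\cdot\mathbf n\rangle_{\Gamma_D}\quad(\mathbf v\in K^\star),$$ $$I(q)=\tfrac12\|\mathbf K^{1/2}\nabla q\|_{L^2(\Omega)}^2-(f,q)_\Omega+\langle\beta,q^+\rangle_{\Gamma_C}-\langle\alpha,q^-\rangle_{\Gamma_C}\quad(q\in K).$$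
   Formalization: It is additionally assumed that the part of ∂Ω outside Γ_D ∪ Γ_C has zero surface measure; without this the Dirichlet pairing can depend on the choice of the lifting of p_D and need not be 0 when Γ_D is empty. *)

theory Defs
  imports "HOL-Analysis.Analysis"
begin

section \<open>Polyhedral Lipschitz domains\<close>

text \<open>
  The local coordinate system at a boundary point is given by a unit vector \<open>\<nu>\<close>: a point \<open>y\<close> has
  horizontal part \<open>y - (y \<bullet> \<nu>) *\<^sub>R \<nu>\<close> in the hyperplane orthogonal to \<open>\<nu>\<close> and height \<open>y \<bullet> \<nu>\<close>.
  Near the boundary point, \<open>\<Omega>\<close> is the strict subgraph of a Lipschitz function on that hyperplane.
\<close>

definition lipschitz_boundary :: "(real^'n) set \<Rightarrow> bool" where
  "lipschitz_boundary \<Omega> \<longleftrightarrow>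
     (\<forall>x\<in>frontier \<Omega>. \<exists>U \<nu> L (a :: real^'n \<Rightarrow> real).
        open U \<and> x \<in> U \<and> norm \<nu> = 1 \<and> L-lipschitz_on {y. y \<bullet> \<nu> = 0} a \<and>
        \<Omega> \<inter> U = {y \<in> U. y \<bullet> \<nu> < a (y - (y \<bullet> \<nu>) *\<^sub>R \<nu>)})"

definition polyhedral_lipschitz_domain :: "(real^'n) set \<Rightarrow> bool" where
  "polyhedral_lipschitz_domain \<Omega> \<longleftrightarrow>
     open \<Omega> \<and> bounded \<Omega> \<and> connected \<Omega> \<and> \<Omega> \<noteq> {} \<and> lipschitz_boundary \<Omega> \<and>
     (\<exists>P. finite P \<and> (\<forall>T\<in>P. polytope T) \<and> closure \<Omega> = \<Union>P)"


section \<open>Surface measure and square integrable functions\<close>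

text \<open>
  The \<open>m\<close>-dimensional Hausdorff measure for \<open>m \<ge> 1\<close>, normalised to agree with Lebesgue measure on
  \<open>m\<close>-dimensional planes. (For \<open>m = 0\<close> the convention \<open>0 ^ 0 = 1\<close> would count empty covering sets.)
\<close>

definition hausdorff_content :: "nat \<Rightarrow> real \<Rightarrow> 'a::metric_space set \<Rightarrow> ennreal" where
  "hausdorff_content m \<delta> A =
     (INF U\<in>{U :: nat \<Rightarrow> 'a set. A \<subseteq> (\<Union>i. U i) \<and> (\<forall>i. bounded (U i) \<and> diameter (U i) \<le> \<delta>)}.
        \<Sum>i. ennreal (unit_ball_vol (real m) * (diameter (U i) / 2) ^ m))"

definition hausdorff_outer :: "nat \<Rightarrow> 'a::metric_space set \<Rightarrow> ennreal" where
  "hausdorff_outer m A = (SUP \<delta>\<in>{0<..}. hausdorff_content m \<delta> A)"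

definition hausdorff_measure :: "nat \<Rightarrow> 'a::metric_space measure" where
  "hausdorff_measure m = measure_of UNIV (sets borel) (hausdorff_outer m)"

definition surface_on :: "(real^'n) set \<Rightarrow> (real^'n) measure" where
  "surface_on \<Gamma> = restrict_space (hausdorff_measure (CARD('n) - 1)) \<Gamma>"

text \<open>
  Elements of Lebesgue and Sobolev spaces are represented by functions on the whole space; values
  outside the domain of integration are irrelevant, and functions that agree almost everywhere
  represent the same element. On the boundary, representatives are Borel measurable.
\<close>

definition L2 :: "'a measure \<Rightarrow> ('a \<Rightarrow> 'b::euclidean_space) set" where
  "L2 M = {g \<in> borel_measurable M. integrable M (\<lambda>x. (norm (g x))\<^sup>2)}"

definition L2_inner :: "'a measure \<Rightarrow> ('a \<Rightarrow> 'b::euclidean_space) \<Rightarrow> ('a \<Rightarrow> 'b) \<Rightarrow> real" where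
  "L2_inner M g h = (\<integral>x. g x \<bullet> h x \<partial>M)"

definition L2_norm_sq :: "'a measure \<Rightarrow> ('a \<Rightarrow> 'b::euclidean_space) \<Rightarrow> real" where
  "L2_norm_sq M g = (\<integral>x. (norm (g x))\<^sup>2 \<partial>M)"


section \<open>Smooth functions and weak derivatives\<close>

definition grad :: "(real^'n \<Rightarrow> real) \<Rightarrow> real^'n \<Rightarrow> real^'n" where
  "grad \<phi> x = (\<chi> i. frechet_derivative \<phi> (at x) (axis i 1))"

primrec C_k :: "nat \<Rightarrow> (real^'n \<Rightarrow> real) \<Rightarrow> bool" where
  "C_k 0 \<phi> \<longleftrightarrow> continuous_on UNIV \<phi>"
| "C_k (Suc k) \<phi> \<longleftrightarrow> (\<forall>x. \<phi> differentiable (at x)) \<and> (\<forall>i. C_k k (\<lambda>x. grad \<phi> x $ i))"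

definition smooth :: "(real^'n \<Rightarrow> real) \<Rightarrow> bool" where
  "smooth \<phi> \<longleftrightarrow> (\<forall>k. C_k k \<phi>)"

definition test_function :: "(real^'n) set \<Rightarrow> (real^'n \<Rightarrow> real) \<Rightarrow> bool" where
  "test_function \<Omega> \<phi> \<longleftrightarrow>
     smooth \<phi> \<and> compact (closure {x. \<phi> x \<noteq> 0}) \<and> closure {x. \<phi> x \<noteq> 0} \<subseteq> \<Omega>"

definition has_weak_grad :: "(real^'n) set \<Rightarrow> (real^'n \<Rightarrow> real) \<Rightarrow> (real^'n \<Rightarrow> real^'n) \<Rightarrow> bool" where
  "has_weak_grad \<Omega> w G \<longleftrightarrow>
     (\<forall>\<phi>. test_function \<Omega> \<phi> \<longrightarrow>
        (\<forall>i. (\<integral>x. w x * grad \<phi> x $ i \<partial>lebesgue_on \<Omega>) = - (\<integral>x. G x $ i * \<phi> x \<partial>lebesgue_on \<Omega>)))"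

definition H1 :: "(real^'n) set \<Rightarrow> (real^'n \<Rightarrow> real) set" where
  "H1 \<Omega> = {w \<in> L2 (lebesgue_on \<Omega>). \<exists>G\<in>L2 (lebesgue_on \<Omega>). has_weak_grad \<Omega> w G}"

definition weak_grad :: "(real^'n) set \<Rightarrow> (real^'n \<Rightarrow> real) \<Rightarrow> real^'n \<Rightarrow> real^'n" where
  "weak_grad \<Omega> w = (SOME G. G \<in> L2 (lebesgue_on \<Omega>) \<and> has_weak_grad \<Omega> w G)"

definition has_weak_div :: "(real^'n) set \<Rightarrow> (real^'n \<Rightarrow> real^'n) \<Rightarrow> (real^'n \<Rightarrow> real) \<Rightarrow> bool" where
  "has_weak_div \<Omega> v h \<longleftrightarrow>
     (\<forall>\<phi>. test_function \<Omega> \<phi> \<longrightarrow>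
        (\<integral>x. v x \<bullet> grad \<phi> x \<partial>lebesgue_on \<Omega>) = - (\<integral>x. h x * \<phi> x \<partial>lebesgue_on \<Omega>))"

definition Hdiv :: "(real^'n) set \<Rightarrow> (real^'n \<Rightarrow> real^'n) set" where
  "Hdiv \<Omega> = {v \<in> L2 (lebesgue_on \<Omega>). \<exists>h\<in>L2 (lebesgue_on \<Omega>). has_weak_div \<Omega> v h}"

definition weak_div :: "(real^'n) set \<Rightarrow> (real^'n \<Rightarrow> real^'n) \<Rightarrow> real^'n \<Rightarrow> real" where
  "weak_div \<Omega> v = (SOME h. h \<in> L2 (lebesgue_on \<Omega>) \<and> has_weak_div \<Omega> v h)"


section \<open>Traces\<close>

text \<open>
  The trace operator is the continuous extension to \<open>H1 \<Omega>\<close> of the restriction of smooth functions to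
  the boundary; \<open>has_trace \<Omega> w g\<close> is its graph, i.e. \<open>g\<close> is (a representative of) the trace of \<open>w\<close>.
\<close>

definition has_trace :: "(real^'n) set \<Rightarrow> (real^'n \<Rightarrow> real) \<Rightarrow> (real^'n \<Rightarrow> real) \<Rightarrow> bool" where
  "has_trace \<Omega> w g \<longleftrightarrow>
     w \<in> H1 \<Omega> \<and> g \<in> L2 (surface_on (frontier \<Omega>)) \<and>
     (\<exists>\<phi> :: nat \<Rightarrow> real^'n \<Rightarrow> real.
        (\<forall>k. smooth (\<phi> k)) \<and>
        (\<lambda>k. L2_norm_sq (lebesgue_on \<Omega>) (\<lambda>x. \<phi> k x - w x)
             + L2_norm_sq (lebesgue_on \<Omega>) (\<lambda>x. grad (\<phi> k) x - weak_grad \<Omega> w x)) \<longlonglongrightarrow> 0 \<and>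
        (\<lambda>k. L2_norm_sq (surface_on (frontier \<Omega>)) (\<lambda>x. \<phi> k x - g x)) \<longlonglongrightarrow> 0)"

definition trace_op :: "(real^'n) set \<Rightarrow> (real^'n \<Rightarrow> real) \<Rightarrow> real^'n \<Rightarrow> real" where
  "trace_op \<Omega> w = (SOME g. has_trace \<Omega> w g)"

definition trace_equals_on :: "(real^'n) set \<Rightarrow> (real^'n) set \<Rightarrow> (real^'n \<Rightarrow> real) \<Rightarrow> (real^'n \<Rightarrow> real) \<Rightarrow> bool" where
  "trace_equals_on \<Omega> \<Gamma> w \<eta> \<longleftrightarrow> (\<exists>g. has_trace \<Omega> w g \<and> (AE x in surface_on \<Gamma>. g x = \<eta> x))"

text \<open>\<open>H_half \<Omega> \<Gamma>\<close> is the space of traces on the part \<open>\<Gamma>\<close> of the boundary of \<open>\<Omega>\<close>.\<close>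

definition H_half :: "(real^'n) set \<Rightarrow> (real^'n) set \<Rightarrow> (real^'n \<Rightarrow> real) set" where
  "H_half \<Omega> \<Gamma> = {\<eta> \<in> borel_measurable (surface_on \<Gamma>). \<exists>w\<in>H1 \<Omega>. trace_equals_on \<Omega> \<Gamma> w \<eta>}"

definition zero_ext :: "(real^'n) set \<Rightarrow> (real^'n \<Rightarrow> real) \<Rightarrow> real^'n \<Rightarrow> real" where
  "zero_ext \<Gamma> \<eta> x = (if x \<in> \<Gamma> then \<eta> x else 0)"

definition H_half_00 :: "(real^'n) set \<Rightarrow> (real^'n) set \<Rightarrow> (real^'n \<Rightarrow> real) set" where
  "H_half_00 \<Omega> \<Gamma> = {\<eta> \<in> H_half \<Omega> \<Gamma>. zero_ext \<Gamma> \<eta> \<in> H_half \<Omega> (frontier \<Omega>)}"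

text \<open>
  \<open>has_normal_trace \<Omega> v T\<close>: the functional \<open>T\<close> on \<open>H_half \<Omega> (frontier \<Omega>)\<close> is the normal trace of \<open>v\<close>.
  Its values there are determined by the condition, and continuity is automatic.
\<close>

definition has_normal_trace ::
    "(real^'n) set \<Rightarrow> (real^'n \<Rightarrow> real^'n) \<Rightarrow> ((real^'n \<Rightarrow> real) \<Rightarrow> real) \<Rightarrow> bool" where
  "has_normal_trace \<Omega> v T \<longleftrightarrow>
     (\<forall>w\<in>H1 \<Omega>. \<forall>g. has_trace \<Omega> w g \<longrightarrow>
        T g = L2_inner (lebesgue_on \<Omega>) v (weak_grad \<Omega> w) + L2_inner (lebesgue_on \<Omega>) (weak_div \<Omega> v) w)"

definition has_flux :: "(real^'n) set \<Rightarrow> (real^'n) set \<Rightarrow> (real^'n \<Rightarrow> real^'n) \<Rightarrow> (real^'n \<Rightarrow> real) \<Rightarrow> bool" where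
  "has_flux \<Omega> \<Gamma> v h \<longleftrightarrow>
     h \<in> L2 (surface_on \<Gamma>) \<and>
     (\<exists>T. has_normal_trace \<Omega> v T \<and>
          (\<forall>\<eta>\<in>H_half_00 \<Omega> \<Gamma>. T (zero_ext \<Gamma> \<eta>) = L2_inner (surface_on \<Gamma>) h \<eta>))"

definition flux :: "(real^'n) set \<Rightarrow> (real^'n) set \<Rightarrow> (real^'n \<Rightarrow> real^'n) \<Rightarrow> real^'n \<Rightarrow> real" where
  "flux \<Omega> \<Gamma> v = (SOME h. has_flux \<Omega> \<Gamma> v h)"

definition V_space :: "(real^'n) set \<Rightarrow> (real^'n) set \<Rightarrow> (real^'n \<Rightarrow> real^'n) set" where
  "V_space \<Omega> \<Gamma>\<^sub>C = {v \<in> Hdiv \<Omega>. \<exists>h. has_flux \<Omega> \<Gamma>\<^sub>C v h}"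


section \<open>Admissible sets and energies\<close>

text \<open>
  Here \<open>P\<close> is an arbitrary lifting of \<open>p\<^sub>D\<close>. For \<open>v\<close> with divergence \<open>f\<close> the value does not depend on it
  (and is \<open>0\<close> if \<open>\<Gamma>\<^sub>D\<close> is empty), provided that \<open>\<Gamma>\<^sub>D\<close> and \<open>\<Gamma>\<^sub>C\<close> cover the boundary up to a surface null set.
\<close>

definition dirichlet_pairing ::
    "(real^'n) set \<Rightarrow> (real^'n) set \<Rightarrow> (real^'n) set \<Rightarrow> (real^'n \<Rightarrow> real) \<Rightarrow> (real^'n \<Rightarrow> real)
     \<Rightarrow> (real^'n \<Rightarrow> real^'n) \<Rightarrow> real" where
  "dirichlet_pairing \<Omega> \<Gamma>\<^sub>D \<Gamma>\<^sub>C f p\<^sub>D v =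
     (let P = (SOME P. P \<in> H1 \<Omega> \<and> trace_equals_on \<Omega> \<Gamma>\<^sub>D P p\<^sub>D)
      in L2_inner (lebesgue_on \<Omega>) v (weak_grad \<Omega> P) + L2_inner (lebesgue_on \<Omega>) f P
         - L2_inner (surface_on \<Gamma>\<^sub>C) (flux \<Omega> \<Gamma>\<^sub>C v) (trace_op \<Omega> P))"

definition primal_set :: "(real^'n) set \<Rightarrow> (real^'n) set \<Rightarrow> (real^'n \<Rightarrow> real) \<Rightarrow> (real^'n \<Rightarrow> real) set" where
  "primal_set \<Omega> \<Gamma>\<^sub>D p\<^sub>D = {q \<in> H1 \<Omega>. trace_equals_on \<Omega> \<Gamma>\<^sub>D q p\<^sub>D}"

definition dual_set ::
    "(real^'n) set \<Rightarrow> (real^'n) set \<Rightarrow> (real^'n \<Rightarrow> real) \<Rightarrow> (real^'n \<Rightarrow> real) \<Rightarrow> (real^'n \<Rightarrow> real)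
     \<Rightarrow> (real^'n \<Rightarrow> real^'n) set" where
  "dual_set \<Omega> \<Gamma>\<^sub>C f \<alpha> \<beta> =
     {v \<in> V_space \<Omega> \<Gamma>\<^sub>C.
        (AE x in lebesgue_on \<Omega>. weak_div \<Omega> v x = f x) \<and>
        (AE x in surface_on \<Gamma>\<^sub>C. \<alpha> x \<le> flux \<Omega> \<Gamma>\<^sub>C v x \<and> flux \<Omega> \<Gamma>\<^sub>C v x \<le> \<beta> x)}"

definition matrix_sqrt :: "real^'n^'n \<Rightarrow> real^'n^'n" where
  "matrix_sqrt A = (SOME B. transpose B = B \<and> (\<forall>\<xi>. 0 \<le> \<xi> \<bullet> (B *v \<xi>)) \<and> B ** B = A)"

definition dual_energy ::
    "(real^'n) set \<Rightarrow> (real^'n) set \<Rightarrow> (real^'n) set \<Rightarrow> (real^'n \<Rightarrow> real^'n^'n) \<Rightarrow> (real^'n \<Rightarrow> real)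
     \<Rightarrow> (real^'n \<Rightarrow> real) \<Rightarrow> (real^'n \<Rightarrow> real^'n) \<Rightarrow> real" where
  "dual_energy \<Omega> \<Gamma>\<^sub>D \<Gamma>\<^sub>C K f p\<^sub>D v =
     - (1/2) * L2_norm_sq (lebesgue_on \<Omega>) (\<lambda>x. matrix_inv (matrix_sqrt (K x)) *v v x)
     - dirichlet_pairing \<Omega> \<Gamma>\<^sub>D \<Gamma>\<^sub>C f p\<^sub>D v"

definition pos_part :: "real \<Rightarrow> real" where "pos_part t = max 0 t"
definition neg_part :: "real \<Rightarrow> real" where "neg_part t = max 0 (- t)"

definition primal_energy ::
    "(real^'n) set \<Rightarrow> (real^'n) set \<Rightarrow> (real^'n \<Rightarrow> real^'n^'n) \<Rightarrow> (real^'n \<Rightarrow> real)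
     \<Rightarrow> (real^'n \<Rightarrow> real) \<Rightarrow> (real^'n \<Rightarrow> real) \<Rightarrow> (real^'n \<Rightarrow> real) \<Rightarrow> real" where
  "primal_energy \<Omega> \<Gamma>\<^sub>C K f \<alpha> \<beta> q =
     (1/2) * L2_norm_sq (lebesgue_on \<Omega>) (\<lambda>x. matrix_sqrt (K x) *v weak_grad \<Omega> q x)
     - L2_inner (lebesgue_on \<Omega>) f q
     + L2_inner (surface_on \<Gamma>\<^sub>C) \<beta> (\<lambda>x. pos_part (trace_op \<Omega> q x))
     - L2_inner (surface_on \<Gamma>\<^sub>C) \<alpha> (\<lambda>x. neg_part (trace_op \<Omega> q x))"

definition total_error_sq ::
    "('q \<Rightarrow> real) \<Rightarrow> ('v \<Rightarrow> real) \<Rightarrow> 'q \<Rightarrow> 'v \<Rightarrow> 'q \<Rightarrow> 'v \<Rightarrow> real" where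
  "total_error_sq I D p u q v = (I q - I p) + (- D v + D u)"

definition gap_estimator_sq :: "('q \<Rightarrow> real) \<Rightarrow> ('v \<Rightarrow> real) \<Rightarrow> 'q \<Rightarrow> 'v \<Rightarrow> real" where
  "gap_estimator_sq I D q v = I q - D v"

end

theory Submission
  imports Defs
begin

text \<open>
  The claim \<open>\<rho>\<^sub>t\<^sub>o\<^sub>t\<^sup>2 = \<eta>\<^sub>g\<^sub>a\<^sub>p\<^sup>2\<close> is \<open>(I q - I p) + (D u - D v) = I q - D v\<close>, that is, strong duality \<open>I p = D u\<close>.

  Weak duality comes from an identity for the gap (\<open>gap_identity\<close>): for \<open>q\<close> and \<open>v\<close> admissible, with
  traces and normal fluxes written without operators,
  \<open>I q - D v = 1/2 \<parallel>K\<^sup>1\<^sup>/\<^sup>2 \<nabla>q + K\<^sup>-\<^sup>1\<^sup>/\<^sup>2 v\<parallel>\<^sup>2 + \<integral> (\<beta> q\<^sup>+ - \<alpha> q\<^sup>- - (v \<cdot> n) q)\<close>,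
  where the last integral runs over the contact boundary and its integrand is nonnegative because
  \<open>\<alpha> \<le> v \<cdot> n \<le> \<beta>\<close>. The gap vanishes for \<open>q = p\<close> and \<open>v = - K \<nabla>p\<close> provided that this \<open>v\<close> is admissible and that
  its flux is complementary to the trace of \<open>p\<close>. So it is enough to find that flux.

  Minimality of \<open>p\<close> bounds the residual \<open>(f, w) - (K \<nabla>p, \<nabla>w)\<close>, for every \<open>w\<close> with zero trace on the Dirichlet
  boundary, by the one-sided derivative of the contact energy at \<open>p\<close> in the direction of the trace of \<open>w\<close>
  (\<open>residual_le_slope\<close>). This derivative is sublinear and depends on the trace only. Hence the residual is a linear
  functional of the trace, and by Hahn-Banach it extends to all of \<open>L\<^sup>2\<close> of the contact boundary without exceeding
  the derivative (\<open>hahn_banach\<close>). The extension lies between integration against \<open>\<alpha>\<close> and against \<open>\<beta>\<close> on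
  nonnegative functions, so it has a density \<open>h\<close> with \<open>\<alpha> \<le> h \<le> \<beta>\<close> (\<open>L2_bounded_functional_density\<close>). Comparison
  with the derivative in the directions of plus and minus the trace of \<open>p\<close> gives complementarity (\<open>ex_contact_flux\<close>).
  By construction \<open>h\<close> is the normal flux of \<open>- K \<nabla>p\<close>, and \<open>strong_duality_witness\<close> concludes.

  Weak gradients, weak divergences, traces and fluxes are chosen representatives, so all of the above rests on their
  uniqueness almost everywhere. For weak derivatives (\<open>weak_grad_unique\<close>, \<open>weak_div_unique\<close>) and fluxes
  (\<open>flux_unique\<close>) this is the fundamental lemma of the calculus of variations, stated for arbitrary Borel measures.
  For traces (\<open>has_trace_unique\<close>) it says that restriction of smooth functions to the boundary is closable from
  \<open>H\<^sup>1\<close> to \<open>L\<^sup>2\<close>: along almost every line transversal to the boundary, a sequence that tends to zero in \<open>H\<^sup>1\<close> has a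
  subsequence whose boundary values tend to zero. The link with the surface measure is
  \<open>hausdorff_outer_le_layer_volume\<close>, which bounds the Hausdorff measure of a piece of a Lipschitz graph by the volume of
  the layer below it; it also shows that the boundary has finite measure.
\<close>

section \<open>Smooth functions and bumps\<close>

lemma grad_eqI:
  assumes "(\<phi> has_derivative D) (at x)"
  shows "grad \<phi> x $ i = D (axis i 1)"
  using frechet_derivative_at[OF assms] by (simp add: grad_def)

lemma has_derivative_grad:
  fixes \<phi> :: "real^'n \<Rightarrow> real"
  assumes "\<phi> differentiable (at x)"
  shows "(\<phi> has_derivative (\<lambda>h. grad \<phi> x \<bullet> h)) (at x)"
proof -
  have D: "(\<phi> has_derivative frechet_derivative \<phi> (at x)) (at x)"
    using assms by (simp add: frechet_derivative_works)
  then have lin: "linear (frechet_derivative \<phi> (at x))" by (rule has_derivative_linear)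
  have "frechet_derivative \<phi> (at x) h = grad \<phi> x \<bullet> h" for h
  proof -
    have "frechet_derivative \<phi> (at x) h = frechet_derivative \<phi> (at x) (\<Sum>i\<in>UNIV. h $ i *\<^sub>R axis i 1)"
      using basis_expansion[of h] by (simp add: scalar_mult_eq_scaleR)
    also have "\<dots> = (\<Sum>i\<in>UNIV. h $ i * grad \<phi> x $ i)"
      by (simp add: linear_sum[OF lin] linear_scale[OF lin] grad_def)
    finally show ?thesis by (simp add: inner_vec_def mult.commute)
  qed
  then have "frechet_derivative \<phi> (at x) = (\<lambda>h. grad \<phi> x \<bullet> h)" by (rule ext)
  then show ?thesis using D by simp
qed

lemma grad_add: "\<phi> differentiable (at x) \<Longrightarrow> \<psi> differentiable (at x) \<Longrightarrow>
    grad (\<lambda>x. \<phi> x + \<psi> x) x $ i = grad \<phi> x $ i + grad \<psi> x $ i"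
  by (rule trans[OF grad_eqI[OF has_derivative_add[OF has_derivative_grad has_derivative_grad]]])
    (simp_all add: inner_axis)

lemma grad_mult: "\<phi> differentiable (at x) \<Longrightarrow> \<psi> differentiable (at x) \<Longrightarrow>
    grad (\<lambda>x. \<phi> x * \<psi> x) x $ i = \<phi> x * grad \<psi> x $ i + grad \<phi> x $ i * \<psi> x"
  by (rule trans[OF grad_eqI[OF has_derivative_mult[OF has_derivative_grad has_derivative_grad]]])
    (simp_all add: inner_axis)

lemma grad_const: "grad (\<lambda>x. c) x = 0"
  by (simp add: vec_eq_iff grad_eqI[OF has_derivative_const])

text \<open>
  Continuity is demanded only of the derivatives of top order; the lower ones inherit it from differentiability.
\<close>

lemma C_k_SucD: "C_k (Suc k) \<phi> \<Longrightarrow> C_k k \<phi>"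
proof (induction k arbitrary: \<phi>)
  case 0
  then show ?case
    by (auto simp: continuous_on_eq_continuous_at differentiable_imp_continuous_within)
next
  case (Suc k)
  then show ?case by (metis C_k.simps(2))
qed

lemma C_k_const: "C_k k (\<lambda>x. c)"
  by (induction k arbitrary: c) (simp_all add: grad_const)

lemma C_k_add: "C_k k \<phi> \<Longrightarrow> C_k k \<psi> \<Longrightarrow> C_k k (\<lambda>x. \<phi> x + \<psi> x)"
  by (induction k arbitrary: \<phi> \<psi>) (simp_all add: continuous_on_add grad_add)

lemma C_k_mult: "C_k k \<phi> \<Longrightarrow> C_k k \<psi> \<Longrightarrow> C_k k (\<lambda>x. \<phi> x * \<psi> x)"
proof (induction k arbitrary: \<phi> \<psi>)
  case 0
  then show ?case by (simp add: continuous_on_mult)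
next
  case (Suc k)
  have "C_k k (\<lambda>x. \<phi> x * grad \<psi> x $ i + grad \<phi> x $ i * \<psi> x)" for i
    using Suc.prems by (intro C_k_add Suc.IH C_k_SucD[of k \<phi>] C_k_SucD[of k \<psi>]) simp_all
  then show ?case using Suc.prems by (simp add: grad_mult)
qed

lemma smooth_const: "smooth (\<lambda>x. c)"
  and smooth_add: "smooth \<phi> \<Longrightarrow> smooth \<psi> \<Longrightarrow> smooth (\<lambda>x. \<phi> x + \<psi> x)"
  and smooth_mult: "smooth \<phi> \<Longrightarrow> smooth \<psi> \<Longrightarrow> smooth (\<lambda>x. \<phi> x * \<psi> x)"
  by (simp_all add: smooth_def C_k_const C_k_add C_k_mult)

lemma smooth_prod: "finite A \<Longrightarrow> (\<And>i. i \<in> A \<Longrightarrow> smooth (\<phi> i)) \<Longrightarrow> smooth (\<lambda>x. \<Prod>i\<in>A. \<phi> i x)"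
  by (induction A rule: finite_induct) (simp_all add: smooth_const smooth_mult)

lemma smooth_differentiable: "smooth \<phi> \<Longrightarrow> \<phi> differentiable (at x)"
  and smooth_grad: "smooth \<phi> \<Longrightarrow> smooth (\<lambda>x. grad \<phi> x $ i)"
  using C_k.simps(2) unfolding smooth_def by blast+

lemma smooth_continuous: "smooth \<phi> \<Longrightarrow> continuous_on S \<phi>"
  unfolding smooth_def by (metis C_k.simps(1) continuous_on_subset subset_UNIV)

lemma smooth_continuous_grad:
  fixes \<phi> :: "real^'n \<Rightarrow> real"
  assumes "smooth \<phi>" shows "continuous_on S (grad \<phi>)"
proof -
  have "continuous_on S (\<lambda>x. \<chi> i. grad \<phi> x $ i)"
    by (intro continuous_on_vec_lambda smooth_continuous smooth_grad assms)
  then show ?thesis by simp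
qed

lemma smooth_lincomb: "smooth \<phi> \<Longrightarrow> smooth \<psi> \<Longrightarrow> smooth (\<lambda>x. \<phi> x + c * \<psi> x)"
  by (intro smooth_add smooth_mult smooth_const)

lemma grad_lincomb:
  "smooth \<phi> \<Longrightarrow> smooth \<psi> \<Longrightarrow> grad (\<lambda>x. \<phi> x + c * \<psi> x) x = grad \<phi> x + c *\<^sub>R grad \<psi> x"
  by (simp add: vec_eq_iff grad_add grad_mult grad_const smooth_differentiable smooth_mult smooth_const)

text \<open>
  The flat functions \<open>p (1/t) exp (-1/t)\<close>, extended by zero to \<open>t \<le> 0\<close>: as \<open>p\<close> ranges over all
  polynomials they are closed under differentiation, which makes each of them smooth.
\<close>

definition flat_exp :: "real poly \<Rightarrow> real \<Rightarrow> real" where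
  "flat_exp p t = (if 0 < t then poly p (1/t) * exp (- (1/t)) else 0)"

lemma poly_mult_exp_minus_tendsto_0: "((\<lambda>y. poly p y * exp (- y)) \<longlongrightarrow> (0::real)) at_top"
proof -
  have "((\<lambda>y. \<Sum>i\<le>degree p. coeff p i * (y ^ i / exp y)) \<longlongrightarrow> (\<Sum>i\<le>degree p. coeff p i * 0)) at_top"
    by (intro tendsto_sum tendsto_mult tendsto_const tendsto_power_div_exp_0)
  then show ?thesis
    by (simp add: poly_altdef sum_distrib_right exp_minus divide_inverse mult.assoc)
qed

lemma flat_exp_tendsto_0: "(flat_exp p \<longlongrightarrow> 0) (at 0)"
proof -
  have "((\<lambda>t. poly p (inverse t) * exp (- inverse t)) \<longlongrightarrow> 0) (at_right 0)"
    by (rule filterlim_compose[OF poly_mult_exp_minus_tendsto_0 filterlim_inverse_at_top_right])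
  then have "(flat_exp p \<longlongrightarrow> 0) (at_right 0)"
    by (rule Lim_transform_eventually)
      (auto simp: flat_exp_def inverse_eq_divide eventually_at_filter)
  moreover have "(flat_exp p \<longlongrightarrow> 0) (at_left 0)"
    by (rule Lim_transform_eventually[OF tendsto_const])
      (auto simp: flat_exp_def eventually_at_filter)
  ultimately show ?thesis by (rule filterlim_split_at[rotated])
qed

lemma flat_exp_deriv:
  "(flat_exp p has_real_derivative flat_exp ([:0, 0, 1:] * (p - pderiv p)) t) (at t)"
proof -
  consider "t > 0" | "t < 0" | "t = 0" by linarith
  then show ?thesis
  proof cases
    case 1
    have "((\<lambda>t. poly p (1/t) * exp (- (1/t))) has_real_derivative
        flat_exp ([:0, 0, 1:] * (p - pderiv p)) t) (at t)"
      using 1 by (auto intro!: derivative_eq_intros DERIV_chain2[OF poly_DERIV]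
          simp: flat_exp_def field_simps power2_eq_square)
    then show ?thesis
      by (rule has_field_derivative_transform_within_open[of _ _ _ "{0<..}"])
        (use 1 in \<open>auto simp: flat_exp_def\<close>)
  next
    case 2
    have "((\<lambda>t. 0) has_real_derivative flat_exp ([:0, 0, 1:] * (p - pderiv p)) t) (at t)"
      using 2 by (simp add: flat_exp_def)
    then show ?thesis
      by (rule has_field_derivative_transform_within_open[of _ _ _ "{..<0}"])
        (use 2 in \<open>auto simp: flat_exp_def\<close>)
  next
    case 3
    have "((\<lambda>h. (flat_exp p (0 + h) - flat_exp p 0) / h) \<longlongrightarrow> 0) (at 0)"
      by (rule Lim_transform_eventually[OF flat_exp_tendsto_0[of "pCons 0 p"]])
        (auto simp: flat_exp_def eventually_at_filter)
    then show ?thesis using 3 by (simp add: DERIV_def flat_exp_def)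
  qed
qed

lemma smooth_flat_exp:
  fixes i :: "'n::finite"
  shows "smooth (\<lambda>x :: real^'n. flat_exp p (c * x $ i + a))"
proof -
  have D: "((\<lambda>x :: real^'n. flat_exp p (c * x $ i + a)) has_derivative
      (\<lambda>h. flat_exp ([:0, 0, 1:] * (p - pderiv p)) (c * x $ i + a) * (c * h $ i))) (at x)" for p x
  proof -
    have "((\<lambda>x :: real^'n. c * x $ i + a) has_derivative (\<lambda>h. c * h $ i)) (at x)"
      by (auto intro!: derivative_eq_intros bounded_linear_imp_has_derivative bounded_linear_vec_nth)
    then show ?thesis
      using has_derivative_compose[OF _ flat_exp_deriv[unfolded has_field_derivative_def]] by fastforce
  qed
  have "C_k k (\<lambda>x :: real^'n. flat_exp p (c * x $ i + a))" for k
  proof (induction k arbitrary: p)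
    case 0
    then show ?case
      by (auto simp: continuous_on_eq_continuous_at intro!: has_derivative_continuous[OF D])
  next
    case (Suc k)
    have "grad (\<lambda>x :: real^'n. flat_exp p (c * x $ i + a)) x $ j =
        flat_exp ([:0, 0, 1:] * (p - pderiv p)) (c * x $ i + a) * (c * axis j 1 $ i)" for x j
      by (rule grad_eqI[OF D])
    then show ?case
      using Suc.IH differentiableI[OF D] by (auto intro!: C_k_mult C_k_const)
  qed
  then show ?thesis by (simp add: smooth_def)
qed

text \<open>
  Since \<open>exp (-1/t)\<close> raised to the power \<open>1/m\<close> is \<open>exp (-1/(m t))\<close>, rescaling the arguments produces
  the \<open>m\<close>-th roots of a fixed positive function on the box; hence the limit is the indicator.
\<close>

definition box_bump :: "real^'n \<Rightarrow> real^'n \<Rightarrow> nat \<Rightarrow> real^'n \<Rightarrow> real" where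
  "box_bump a b m x =
     (\<Prod>i\<in>UNIV. flat_exp 1 (real m * x $ i - real m * a $ i) * flat_exp 1 (real m * b $ i - real m * x $ i))"

lemma flat_exp_1_bounds: "0 \<le> flat_exp 1 t" "flat_exp 1 t \<le> 1" "flat_exp 1 t = 0 \<longleftrightarrow> t \<le> 0"
  by (auto simp: flat_exp_def)

lemma box_bump_bounds: "0 \<le> box_bump a b m x" "box_bump a b m x \<le> 1"
  unfolding box_bump_def
  by (auto intro!: prod_nonneg prod_le_1 mult_nonneg_nonneg mult_le_one flat_exp_1_bounds)

lemma box_bump_eq_0: "0 < m \<Longrightarrow> box_bump a b m x = 0 \<longleftrightarrow> x \<notin> box a b"
  unfolding box_bump_def
  by (auto simp: flat_exp_1_bounds mem_box_cart right_diff_distrib[symmetric] zero_less_mult_iff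
      not_less mult_le_0_iff)

lemma smooth_box_bump: "smooth (box_bump a b m)"
proof -
  have "smooth (\<lambda>x. \<Prod>i\<in>UNIV. flat_exp 1 (real m * x $ i + (- real m * a $ i))
      * flat_exp 1 ((- real m) * x $ i + real m * b $ i))"
    by (intro smooth_prod smooth_mult smooth_flat_exp) auto
  moreover have "(\<lambda>x. \<Prod>i\<in>UNIV. flat_exp 1 (real m * x $ i + (- real m * a $ i))
      * flat_exp 1 ((- real m) * x $ i + real m * b $ i)) = box_bump a b m"
    by (auto simp: box_bump_def fun_eq_iff algebra_simps intro!: prod.cong)
  ultimately show ?thesis by simp
qed

lemma box_bump_tendsto: "(\<lambda>m. box_bump a b (Suc m) x) \<longlonglongrightarrow> indicator (box a b) x"
proof (cases "x \<in> box a b")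
  case True
  have flat: "(\<lambda>m. flat_exp 1 (real (Suc m) * t)) \<longlonglongrightarrow> 1" if "0 < t" for t
  proof -
    have "(\<lambda>m. exp (- (inverse (real (Suc m)) * inverse t))) \<longlonglongrightarrow> exp (- (0 * inverse t))"
      by (intro tendsto_intros LIMSEQ_inverse_real_of_nat)
    then show ?thesis using that by (simp add: flat_exp_def divide_inverse zero_less_mult_iff)
  qed
  have "(\<lambda>m. box_bump a b (Suc m) x) \<longlonglongrightarrow> (\<Prod>i\<in>(UNIV :: 'a set). 1 * 1)"
    unfolding box_bump_def right_diff_distrib[symmetric]
    using True by (intro tendsto_prod tendsto_mult flat) (auto simp: mem_box_cart)
  then show ?thesis using True by simp
next
  case False
  then show ?thesis using box_bump_eq_0[of "Suc _" a b x] by simp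
qed

lemma test_function_box_bump:
  assumes "cbox a b \<subseteq> S"
  shows "test_function S (box_bump a b (Suc m))"
proof -
  have "{x. box_bump a b (Suc m) x \<noteq> 0} = box a b" using box_bump_eq_0 by auto
  moreover have "closure (box a b) \<subseteq> cbox a b"
    by (meson box_subset_cbox closed_cbox closure_minimal)
  ultimately show ?thesis
    using assms smooth_box_bump
    by (auto simp: test_function_def intro: compact_closure[THEN iffD2] bounded_box)
qed

section \<open>Square integrable functions\<close>

lemma borel_measurable_lebesgue_on:
  "f \<in> borel_measurable borel \<Longrightarrow> f \<in> borel_measurable (lebesgue_on S)"
  by (intro measurable_restrict_space1 measurable_completion) simp

lemma L2_D:
  assumes "g \<in> L2 M"
  shows "g \<in> borel_measurable M" "integrable M (\<lambda>x. (norm (g x))\<^sup>2)"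
  using assms by (auto simp: L2_def)

lemma norm_add_sq_le: "(norm (a + b))\<^sup>2 \<le> 2 * (norm a)\<^sup>2 + 2 * (norm (b :: 'a::real_inner))\<^sup>2"
proof -
  have "(norm (a + b))\<^sup>2 + (norm (a - b))\<^sup>2 = 2 * (norm a)\<^sup>2 + 2 * (norm b)\<^sup>2"
    by (simp add: power2_norm_eq_inner inner_simps)
  then show ?thesis using zero_le_power2[of "norm (a - b)"] by linarith
qed

lemma abs_inner_le_sq: "\<bar>a \<bullet> b\<bar> \<le> (norm a)\<^sup>2 + (norm (b :: 'a::real_inner))\<^sup>2"
proof -
  have "\<bar>a \<bullet> b\<bar> \<le> norm a * norm b" by (rule Cauchy_Schwarz_ineq2)
  moreover have "2 * (norm a * norm b) \<le> (norm a)\<^sup>2 + (norm b)\<^sup>2"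
    using sum_squares_bound[of "norm a" "norm b"] by simp
  moreover have "0 \<le> norm a * norm b" by simp
  ultimately show ?thesis by linarith
qed

lemma L2_lincomb:
  assumes "g \<in> L2 M" "h \<in> L2 M"
  shows "(\<lambda>x. g x + c *\<^sub>R h x) \<in> L2 M"
proof -
  note [measurable] = L2_D(1)[OF assms(1)] L2_D(1)[OF assms(2)]
  have "integrable M (\<lambda>x. 2 * (norm (g x))\<^sup>2 + 2 * (c\<^sup>2 * (norm (h x))\<^sup>2))"
    using assms by (auto simp: L2_def)
  then have "integrable M (\<lambda>x. (norm (g x + c *\<^sub>R h x))\<^sup>2)"
  proof (rule Bochner_Integration.integrable_bound)
    show "AE x in M. norm ((norm (g x + c *\<^sub>R h x))\<^sup>2) \<le> norm (2 * (norm (g x))\<^sup>2 + 2 * (c\<^sup>2 * (norm (h x))\<^sup>2))"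
      using norm_add_sq_le[of "g _" "c *\<^sub>R h _"] by (intro AE_I2) (simp add: power_mult_distrib)
  qed measurable
  then show ?thesis by (simp add: L2_def)
qed

lemma L2_lincomb_real: "g \<in> L2 M \<Longrightarrow> h \<in> L2 M \<Longrightarrow> (\<lambda>x. g x + c * h x) \<in> L2 M" for g h :: "'a \<Rightarrow> real"
  using L2_lincomb[of g M h c] by simp

lemma L2_zero: "(\<lambda>x. 0) \<in> L2 M"
  by (simp add: L2_def)

lemma L2_scale: "g \<in> L2 M \<Longrightarrow> (\<lambda>x. c *\<^sub>R g x) \<in> L2 M"
  using L2_lincomb[OF L2_zero, of g M c] by simp

lemma L2_diff: "g \<in> L2 M \<Longrightarrow> h \<in> L2 M \<Longrightarrow> (\<lambda>x. g x - h x) \<in> L2 M"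
  using L2_lincomb[of g M h "-1"] by simp

lemma L2_bound:
  assumes "g \<in> L2 M" "h \<in> borel_measurable M" "AE x in M. norm (h x) \<le> c * norm (g x)"
  shows "h \<in> L2 M"
proof -
  note [measurable] = assms(2) L2_D(1)[OF assms(1)]
  have "integrable M (\<lambda>x. c\<^sup>2 * (norm (g x))\<^sup>2)" using assms by (simp add: L2_def)
  then have "integrable M (\<lambda>x. (norm (h x))\<^sup>2)"
  proof (rule Bochner_Integration.integrable_bound)
    show "AE x in M. norm ((norm (h x))\<^sup>2) \<le> norm (c\<^sup>2 * (norm (g x))\<^sup>2)"
      using assms(3) by eventually_elim (simp add: power_mult_distrib[symmetric] power_mono)
  qed measurable
  then show ?thesis using assms(2) by (simp add: L2_def)
qed

lemma L2_inner_integrable: "g \<in> L2 M \<Longrightarrow> h \<in> L2 M \<Longrightarrow> integrable M (\<lambda>x. g x \<bullet> h x)"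
proof -
  assume g: "g \<in> L2 M" and h: "h \<in> L2 M"
  note [measurable] = L2_D(1)[OF g] L2_D(1)[OF h]
  have "integrable M (\<lambda>x. (norm (g x))\<^sup>2 + (norm (h x))\<^sup>2)" using g h by (simp add: L2_def)
  then show ?thesis
    by (rule Bochner_Integration.integrable_bound)
      (auto intro!: AE_I2 order_trans[OF abs_inner_le_sq])
qed

lemma L2_mult_integrable: "g \<in> L2 M \<Longrightarrow> h \<in> L2 M \<Longrightarrow> integrable M (\<lambda>x. g x * h x :: real)"
  using L2_inner_integrable[of g M h] by simp

lemma L2_integrable:
  assumes "finite_measure M" "g \<in> L2 M" shows "integrable M g"
proof -
  interpret finite_measure M by fact
  have "integrable M (\<lambda>x. 1 + (norm (g x))\<^sup>2)" using assms by (simp add: L2_def)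
  then show ?thesis
  proof (rule Bochner_Integration.integrable_bound)
    show "AE x in M. norm (g x) \<le> norm (1 + (norm (g x))\<^sup>2)"
      using sum_squares_bound[of "norm (g _)" 1] by (intro AE_I2) (simp add: algebra_simps, smt (verit) norm_ge_zero)
  qed (use assms in \<open>simp add: L2_def\<close>)
qed

lemma bounded_imp_L2:
  assumes "finite_measure M" "g \<in> borel_measurable M" "AE x in M. norm (g x) \<le> B"
  shows "g \<in> L2 M"
proof -
  interpret finite_measure M by fact
  have "integrable M (\<lambda>x. (norm (g x))\<^sup>2)"
  proof (rule integrable_const_bound[where B="B\<^sup>2"])
    show "AE x in M. norm ((norm (g x))\<^sup>2) \<le> B\<^sup>2"
      using assms(3) by eventually_elim (simp add: power_mono)
  qed (use assms(2) in measurable)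
  then show ?thesis using assms by (simp add: L2_def)
qed

lemma L2_comp: "G \<in> L2 M \<Longrightarrow> (\<lambda>x. G x $ i) \<in> L2 M" for G :: "'a \<Rightarrow> real^'n"
proof (rule L2_bound[where c=1])
  assume G: "G \<in> L2 M"
  have "(\<lambda>x. G x \<bullet> axis i 1) \<in> borel_measurable M" using L2_D(1)[OF G] by simp
  then show "(\<lambda>x. G x $ i) \<in> borel_measurable M" by (simp add: inner_axis)
  show "AE x in M. norm (G x $ i) \<le> 1 * norm (G x)"
    using component_le_norm_cart by (intro AE_I2) simp
qed

lemma L2_inner_lincomb_right:
  "g \<in> L2 M \<Longrightarrow> h \<in> L2 M \<Longrightarrow> k \<in> L2 M \<Longrightarrow>
    L2_inner M g (\<lambda>x. h x + c *\<^sub>R k x) = L2_inner M g h + c * L2_inner M g k"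
  by (simp add: L2_inner_def inner_simps L2_inner_integrable)

lemma L2_inner_lincomb_right_real:
  "g \<in> L2 M \<Longrightarrow> h \<in> L2 M \<Longrightarrow> k \<in> L2 M \<Longrightarrow>
    L2_inner M g (\<lambda>x. h x + c * k x) = L2_inner M g h + c * L2_inner M g k" for g h k :: "'a \<Rightarrow> real"
  using L2_inner_lincomb_right[of g M h k c] by simp

lemma L2_norm_sq_lincomb_le:
  assumes "g \<in> L2 M" "h \<in> L2 M"
  shows "L2_norm_sq M (\<lambda>x. g x + c *\<^sub>R h x) \<le> 2 * L2_norm_sq M g + 2 * c\<^sup>2 * L2_norm_sq M h"
proof -
  have "L2_norm_sq M (\<lambda>x. g x + c *\<^sub>R h x) \<le> (\<integral>x. 2 * (norm (g x))\<^sup>2 + 2 * c\<^sup>2 * (norm (h x))\<^sup>2 \<partial>M)"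
    unfolding L2_norm_sq_def using L2_lincomb[OF assms, of c] assms
    by (intro integral_mono order_trans[OF norm_add_sq_le]) (auto simp: L2_def power_mult_distrib)
  also have "\<dots> = 2 * L2_norm_sq M g + 2 * c\<^sup>2 * L2_norm_sq M h"
    using assms by (simp add: L2_norm_sq_def L2_def)
  finally show ?thesis .
qed

lemma L2_norm_sq_nonneg: "0 \<le> L2_norm_sq M g"
  by (simp add: L2_norm_sq_def)

lemma L2_inner_AE_cong:
  assumes "AE x in M. g x = g' x" "AE x in M. h x = h' x"
    "g \<in> borel_measurable M" "g' \<in> borel_measurable M" "h \<in> borel_measurable M" "h' \<in> borel_measurable M"
  shows "L2_inner M g h = L2_inner M g' h'"
  unfolding L2_inner_def by (rule integral_cong_AE) (use assms in auto)

section \<open>The fundamental lemma of the calculus of variations\<close>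

lemma AE_zero_if_set_integrals_zero:
  fixes k :: "'a \<Rightarrow> real"
  assumes k: "integrable M k" and 0: "\<And>A. A \<in> sets M \<Longrightarrow> (LINT x:A|M. k x) = 0"
  shows "AE x in M. k x = 0"
proof -
  have meas [measurable]: "k \<in> borel_measurable M" using k by simp
  have int: "integrable M (\<lambda>x. indicator A x * k x)" if "A \<in> sets M" for A
    using integrable_mult_indicator[OF that k] by simp
  have "(\<integral>x. \<bar>k x\<bar> \<partial>M) = (\<integral>x. indicator {x\<in>space M. 0 \<le> k x} x * k x - indicator {x\<in>space M. k x < 0} x * k x \<partial>M)"
    by (intro Bochner_Integration.integral_cong) (auto split: split_indicator)
  also have "\<dots> = (LINT x:{x\<in>space M. 0 \<le> k x}|M. k x) - (LINT x:{x\<in>space M. k x < 0}|M. k x)"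
    unfolding set_lebesgue_integral_def real_scaleR_def
    by (intro Bochner_Integration.integral_diff int) measurable
  also have "\<dots> = 0" by (simp add: 0)
  finally show ?thesis
    using integral_nonneg_eq_0_iff_AE[of M "\<lambda>x. \<bar>k x\<bar>"] k by auto
qed

text \<open>
  The fundamental lemma of the calculus of variations for an arbitrary Borel measure. Testing with
  \<open>box_bump\<close> shows that the integral over every small box vanishes, and boxes generate the Borel sets.
\<close>

lemma fundamental_lemma_borel:
  fixes k :: "real^'n \<Rightarrow> real"
  assumes M: "sets M = sets borel" and k: "integrable M k" and S: "open S"
    and 0: "\<And>\<phi>. test_function S \<phi> \<Longrightarrow> (\<integral>x. k x * \<phi> x \<partial>M) = 0"
  shows "AE x in M. x \<in> S \<longrightarrow> k x = 0"
proof -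
  have meas [measurable]: "k \<in> borel_measurable M" using k by simp
  have spM: "space M = UNIV" using sets_eq_imp_space_eq[OF M] by simp
  have box0: "(LINT x:box a b|M. k x) = 0" if ab: "cbox a b \<subseteq> S" for a b
  proof -
    have bm: "box_bump a b m \<in> borel_measurable M" for m
      unfolding measurable_cong_sets[OF M refl]
      by (intro borel_measurable_continuous_onI smooth_continuous smooth_box_bump)
    have "(\<lambda>m. \<integral>x. k x * box_bump a b (Suc m) x \<partial>M) \<longlonglongrightarrow> (\<integral>x. k x * indicator (box a b) x \<partial>M)"
    proof (rule integral_dominated_convergence[where w="\<lambda>x. \<bar>k x\<bar>"])
      show "(\<lambda>x. k x * indicator (box a b) x) \<in> borel_measurable M"
        using M by measurable
      show "(\<lambda>x. k x * box_bump a b (Suc m) x) \<in> borel_measurable M" for m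
        using bm by measurable
      show "AE x in M. (\<lambda>m. k x * box_bump a b (Suc m) x) \<longlonglongrightarrow> k x * indicator (box a b) x"
        by (intro AE_I2 tendsto_intros box_bump_tendsto)
      show "AE x in M. norm (k x * box_bump a b (Suc m) x) \<le> \<bar>k x\<bar>" for m
        using box_bump_bounds[of a b "Suc m"] by (auto simp: abs_mult intro!: mult_left_le)
    qed (use k in auto)
    moreover have "(\<integral>x. k x * box_bump a b (Suc m) x \<partial>M) = 0" for m
      by (intro 0 test_function_box_bump ab)
    ultimately have "(\<integral>x. k x * indicator (box a b) x \<partial>M) = 0"
      by (simp add: LIMSEQ_const_iff)
    then show ?thesis by (simp add: set_lebesgue_integral_def mult.commute)
  qed
  have local: "AE x in M. x \<in> box c d \<longrightarrow> k x = 0" if cd: "cbox c d \<subseteq> S" for c d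
  proof -
    define kB where "kB = (\<lambda>x. indicator (box c d) x * k x)"
    have B: "box c d \<in> sets M" by (simp add: M)
    have kB: "integrable M kB"
      unfolding kB_def using integrable_mult_indicator[OF B k] by simp
    have "AE x in M. kB x = 0"
    proof (rule AE_zero_if_set_integrals_zero[OF kB])
      have sigma: "sets M = sigma_sets UNIV (range (\<lambda>(a, b). box a b))"
        by (subst M, subst borel_eq_box) simp
      fix A assume "A \<in> sets M"
      then have gen: "A \<in> sigma_sets UNIV (range (\<lambda>(a, b). box a b :: (real^'n) set))" by (simp add: sigma)
      have stable: "Int_stable (range (\<lambda>(a, b). box a b :: (real^'n) set))"
      proof (rule Int_stableI)
        fix A B assume "A \<in> range (\<lambda>(a, b). box a b :: (real^'n) set)" "B \<in> range (\<lambda>(a, b). box a b :: (real^'n) set)"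
        then obtain a b a' b' where "A = box a b" "B = box a' b'" by auto
        then have "A \<inter> B = (\<lambda>(a, b). box a b) (\<Sum>i\<in>Basis. max (a \<bullet> i) (a' \<bullet> i) *\<^sub>R i, \<Sum>i\<in>Basis. min (b \<bullet> i) (b' \<bullet> i) *\<^sub>R i)"
          by (simp add: box_Int_box)
        then show "A \<inter> B \<in> range (\<lambda>(a, b). box a b :: (real^'n) set)" by (rule range_eqI)
      qed
      have closed: "range (\<lambda>(a, b). box a b :: (real^'n) set) \<subseteq> Pow UNIV" by simp
      from stable closed gen show "(LINT x:A|M. kB x) = 0"
      proof (induction rule: sigma_sets_induct_disjoint)
        case empty
        show ?case by (simp add: set_lebesgue_integral_def)
      next
        case (basic A)
        then obtain a b where A: "A = box a b" by auto
        obtain a' b' where ab': "A \<inter> box c d = box a' b'" "cbox a' b' \<subseteq> cbox c d"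
        proof -
          have *: "A \<inter> box c d = box (\<Sum>i\<in>Basis. max (a \<bullet> i) (c \<bullet> i) *\<^sub>R i) (\<Sum>i\<in>Basis. min (b \<bullet> i) (d \<bullet> i) *\<^sub>R i)"
            unfolding A by (rule box_Int_box)
          moreover have "cbox (\<Sum>i\<in>Basis. max (a \<bullet> i) (c \<bullet> i) *\<^sub>R i) (\<Sum>i\<in>Basis. min (b \<bullet> i) (d \<bullet> i) *\<^sub>R i) \<subseteq> cbox c d"
            by (auto simp: mem_box)
          ultimately show ?thesis using that by blast
        qed
        have "(LINT x:A|M. kB x) = (LINT x:box a' b'|M. k x)"
          unfolding ab'(1)[symmetric] set_lebesgue_integral_def kB_def
          by (auto intro!: Bochner_Integration.integral_cong simp: indicator_def)
        also have "\<dots> = 0" by (rule box0[OF order_trans[OF ab'(2) cd]])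
        finally show ?case .
      next
        case (compl A)
        then have [simp]: "A \<in> sets M" using sigma by simp
        have "(LINT x:UNIV - A|M. kB x) = (LINT x:box c d|M. k x) - (LINT x:A|M. kB x)"
        proof -
          have "(LINT x:UNIV - A|M. kB x) = (\<integral>x. indicator (box c d) x *\<^sub>R k x - indicator A x *\<^sub>R kB x \<partial>M)"
            unfolding set_lebesgue_integral_def kB_def
            by (intro Bochner_Integration.integral_cong) (auto split: split_indicator)
          also have "\<dots> = (LINT x:box c d|M. k x) - (LINT x:A|M. kB x)"
            unfolding set_lebesgue_integral_def
            by (intro Bochner_Integration.integral_diff integrable_mult_indicator B k kB) simp
          finally show ?thesis .
        qed
        then show ?case using compl.IH box0[OF cd] by simp
      next
        case (union A)
        have m: "A i \<in> sets M" for i using union(2) sigma by auto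
        have dj: "A i \<inter> A j = {}" if "i \<noteq> j" for i j
          using union(1) that by (simp add: disjoint_family_on_def)
        have "(\<Union>i. A i) \<in> sets M" using m by blast
        then have int: "set_integrable M (\<Union>i. A i) kB"
          unfolding set_integrable_def by (rule integrable_mult_indicator[OF _ kB])
        have "(LINT x:(\<Union>i. A i)|M. kB x) = (\<Sum>i. (LINT x:A i|M. kB x))"
          by (rule lebesgue_integral_countable_add[of A M kB]) (fact m, fact dj, fact int)
        then show ?case using union.IH by simp
      qed
    qed
    then show ?thesis by eventually_elim (auto simp: kB_def)
  qed
  define F where "F = {box c d | c d. cbox c d \<subseteq> S}"
  obtain F' where F': "F' \<subseteq> F" "countable F'" "\<Union>F' = \<Union>F"
    using Lindelof[of F] by (auto simp: F_def open_box)
  have "S \<subseteq> \<Union>F"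
  proof
    fix x assume "x \<in> S"
    then obtain c d where "cbox c d \<subseteq> S" "x \<in> box c d"
      using open_contains_cbox[OF S] by metis
    then show "x \<in> \<Union>F" by (auto simp: F_def)
  qed
  have "AE x in M. \<forall>B\<in>F'. x \<in> B \<longrightarrow> k x = 0"
    using F'(1,2) local by (subst AE_ball_countable) (auto simp: F_def)
  then show ?thesis
  proof eventually_elim
    case (elim x)
    have "S \<subseteq> \<Union>F'" using F'(3) \<open>S \<subseteq> \<Union>F\<close> by simp
    then show ?case using elim by (meson UnionE subsetD)
  qed
qed

text \<open>
  A Lebesgue measurable function agrees almost everywhere with a Borel function, which reduces this case to
  Borel measures.
\<close>

lemma fundamental_lemma_lebesgue:
  fixes k :: "real^'n \<Rightarrow> real"
  assumes S: "open S" and k: "integrable (lebesgue_on S) k"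
    and 0: "\<And>\<phi>. test_function S \<phi> \<Longrightarrow> (\<integral>x. k x * \<phi> x \<partial>lebesgue_on S) = 0"
  shows "AE x in lebesgue_on S. k x = 0"
proof -
  have SL: "S \<in> sets lebesgue" using S by simp
  define k1 where "k1 = (\<lambda>x. indicator S x *\<^sub>R k x)"
  have k1: "integrable lebesgue k1"
    using k SL by (simp add: k1_def integrable_restrict_space)
  then obtain k2 where k2: "k2 \<in> borel_measurable lborel" "AE x in lborel. k1 x = k2 x"
    using completion_ex_borel_measurable_real[of k1 lborel] by auto
  have "AE x in lebesgue. k1 x = k2 x" using k2(2) by (rule AE_completion)
  moreover have m2: "k2 \<in> borel_measurable lebesgue" using k2(1) by (rule measurable_completion)
  ultimately have "integrable lebesgue k2"
    using integrable_cong_AE_imp[OF k1 m2] by (simp add: eq_commute)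
  then have k2i: "integrable lborel k2" using k2(1) by (simp add: integrable_completion)
  have "AE x in lborel. x \<in> S \<longrightarrow> k2 x = 0"
  proof (rule fundamental_lemma_borel[OF _ k2i S])
    fix \<phi> assume \<phi>: "test_function S \<phi>"
    then have bm: "\<phi> \<in> borel_measurable borel"
      by (auto simp: test_function_def intro!: borel_measurable_continuous_onI smooth_continuous)
    then have bm': "\<phi> \<in> borel_measurable lebesgue" by (intro measurable_completion) simp
    have "(\<integral>x. k2 x * \<phi> x \<partial>lborel) = (\<integral>x. k2 x * \<phi> x \<partial>lebesgue)"
      using bm k2(1) by (intro integral_completion[symmetric]) simp
    also have "\<dots> = (\<integral>x. indicator S x *\<^sub>R (k x * \<phi> x) \<partial>lebesgue)"
    proof (rule integral_cong_AE)
      show "(\<lambda>x. k2 x * \<phi> x) \<in> borel_measurable lebesgue" using m2 bm' by measurable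
      have "(\<lambda>x. k1 x * \<phi> x) \<in> borel_measurable lebesgue" using k1 bm' by measurable
      then show "(\<lambda>x. indicator S x *\<^sub>R (k x * \<phi> x)) \<in> borel_measurable lebesgue" by (simp add: k1_def mult.assoc)
      show "AE x in lebesgue. k2 x * \<phi> x = indicator S x *\<^sub>R (k x * \<phi> x)"
        using \<open>AE x in lebesgue. k1 x = k2 x\<close> by eventually_elim (auto simp: k1_def)
    qed
    also have "\<dots> = (\<integral>x. k x * \<phi> x \<partial>lebesgue_on S)"
      using SL by (simp add: integral_restrict_space)
    finally show "(\<integral>x. k2 x * \<phi> x \<partial>lborel) = 0" using 0[OF \<phi>] by simp
  qed simp
  then have "AE x in lebesgue. x \<in> S \<longrightarrow> k2 x = 0" by (rule AE_completion)
  with \<open>AE x in lebesgue. k1 x = k2 x\<close> have "AE x in lebesgue. x \<in> S \<longrightarrow> k x = 0"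
    by eventually_elim (auto simp: k1_def)
  then show ?thesis using SL by (simp add: AE_restrict_space_iff)
qed

section \<open>Weak derivatives\<close>

lemma grad_zero_outside:
  assumes "x \<notin> closure {x. \<phi> x \<noteq> 0}"
  shows "grad \<phi> x = 0"
proof -
  have zero: "\<phi> y = 0" if "y \<in> - closure {x. \<phi> x \<noteq> 0}" for y
    using that subsetD[OF closure_subset, of y "{x. \<phi> x \<noteq> 0}"] by fastforce
  have "(\<phi> has_derivative (\<lambda>h. 0)) (at x)"
  proof (rule has_derivative_transform_within_open[OF has_derivative_const])
    show "open (- closure {x. \<phi> x \<noteq> 0})" by (rule open_Compl[OF closed_closure])
    show "x \<in> - closure {x. \<phi> x \<noteq> 0}" using assms unfolding Compl_iff .
    show "0 = \<phi> y" if "y \<in> - closure {x. \<phi> x \<noteq> 0}" for y using zero[OF that] by (rule sym)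
  qed
  then show ?thesis by (simp add: vec_eq_iff grad_eqI)
qed

lemma integrable_continuous_compact_support:
  fixes f :: "real^'n \<Rightarrow> real"
  assumes "continuous_on UNIV f" "bounded {x. f x \<noteq> 0}"
  shows "integrable lborel f"
proof -
  obtain R where R: "{x. f x \<noteq> 0} \<subseteq> cball 0 R"
    using assms(2) unfolding bounded_iff by (auto simp: subset_iff)
  have "integrable lborel (\<lambda>x. indicator (cball 0 R) x *\<^sub>R f x)"
    by (rule borel_integrable_compact) (auto intro: continuous_on_subset[OF assms(1)])
  moreover have "(\<lambda>x. indicator (cball 0 R) x *\<^sub>R f x) = f"
    using R by (auto simp: fun_eq_iff indicator_def)
  ultimately show ?thesis by simp
qed

lemma lborel_integral_translation:
  fixes f :: "'a::euclidean_space \<Rightarrow> real"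
  assumes "f \<in> borel_measurable borel"
  shows "(\<integral>x. f (x + c) \<partial>lborel) = (\<integral>x. f x \<partial>lborel)"
proof -
  have "(\<integral>x. f x \<partial>lborel) = (\<integral>x. f x \<partial>distr lborel borel ((+) c))"
    by (simp add: lborel_distr_plus)
  also have "\<dots> = (\<integral>x. f (c + x) \<partial>lborel)" using assms by (simp add: integral_distr)
  finally show ?thesis by (simp add: add.commute)
qed

lemma has_real_derivative_along:
  fixes f :: "real^'n \<Rightarrow> real"
  assumes "f differentiable (at (x + s *\<^sub>R e))"
  shows "((\<lambda>s. f (x + s *\<^sub>R e)) has_real_derivative grad f (x + s *\<^sub>R e) \<bullet> e) (at s within T)"
proof -
  have "((\<lambda>s. x + s *\<^sub>R e) has_derivative (\<lambda>h. h *\<^sub>R e)) (at s within T)"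
    by (auto intro!: derivative_eq_intros)
  from has_derivative_compose[OF this has_derivative_grad[OF assms]]
  show ?thesis by (simp add: has_field_derivative_def mult_commute_abs)
qed

text \<open>
  The integral of a difference quotient of a compactly supported function vanishes by translation
  invariance, and so does its limit, the integral of a partial derivative.
\<close>

lemma integral_grad_eq_0:
  fixes f :: "real^'n \<Rightarrow> real"
  assumes f: "smooth f" and supp: "bounded {x. f x \<noteq> 0}"
  shows "(\<integral>x. grad f x $ i \<partial>lborel) = 0"
proof -
  define e :: "real^'n" where "e = axis i 1"
  define g where "g = (\<lambda>x. grad f x $ i)"
  have ge: "grad f x \<bullet> e = g x" for x by (simp add: e_def g_def inner_axis)
  have ne: "norm e = 1" by (simp add: e_def norm_axis_1)
  have cont: "continuous_on UNIV f" "continuous_on UNIV g"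
    unfolding g_def by (intro smooth_continuous smooth_grad f)+
  have [measurable]: "f \<in> borel_measurable borel" "g \<in> borel_measurable borel"
    using cont by (simp_all add: borel_measurable_continuous_onI)
  obtain R where R: "{x. f x \<noteq> 0} \<subseteq> cball 0 R"
    using supp unfolding bounded_iff by (auto simp: subset_iff)
  have fz: "f y = 0" if "R < norm y" for y using subsetD[OF R, of y] that by fastforce
  have supp_cl: "closure {x. f x \<noteq> 0} \<subseteq> cball 0 R" by (rule closure_minimal[OF R closed_cball])
  have "bounded (g ` cball 0 R)"
    by (intro compact_imp_bounded compact_continuous_image continuous_on_subset[OF cont(2)]) auto
  then obtain B where B: "0 < B" "\<And>x. x \<in> cball 0 R \<Longrightarrow> norm (g x) \<le> B"
    unfolding bounded_pos by auto
  have gB: "\<bar>g x\<bar> \<le> B" for x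
  proof (cases "x \<in> cball 0 R")
    case False
    then have "grad f x = 0" using supp_cl by (intro grad_zero_outside) auto
    then show ?thesis using B(1) by (simp add: g_def)
  qed (use B in auto)
  define t where "t n = inverse (real (Suc n))" for n
  have t: "0 < t n" "t n \<le> 1" for n by (simp_all add: t_def inverse_le_1_iff)
  define d where "d = (\<lambda>n x. (f (x + t n *\<^sub>R e) - f x) / t n)"
  have fi: "integrable lborel f" by (rule integrable_continuous_compact_support[OF cont(1) supp])
  have "(\<lambda>n. \<integral>x. d n x \<partial>lborel) \<longlonglongrightarrow> (\<integral>x. g x \<partial>lborel)"
  proof (rule integral_dominated_convergence[where w="\<lambda>x. indicator (cball 0 (R + 1)) x *\<^sub>R B"])
    show "d n \<in> borel_measurable lborel" for n unfolding d_def by measurable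
    show "integrable lborel (\<lambda>x :: real^'n. indicator (cball 0 (R + 1)) x *\<^sub>R B)"
      by (rule borel_integrable_compact) auto
    show "AE x in lborel. (\<lambda>n. d n x) \<longlonglongrightarrow> g x"
    proof (rule AE_I2)
      fix x
      have "((\<lambda>s. f (x + s *\<^sub>R e)) has_real_derivative g x) (at 0)"
        using has_real_derivative_along[of f x 0 e UNIV] smooth_differentiable[OF f] by (simp add: ge)
      then have "((\<lambda>h. (f (x + h *\<^sub>R e) - f x) / h) \<longlongrightarrow> g x) (at 0)" by (simp add: DERIV_def)
      moreover have "filterlim t (at 0) sequentially"
        unfolding t_def using LIMSEQ_inverse_real_of_nat by (auto simp: filterlim_at)
      ultimately show "(\<lambda>n. d n x) \<longlonglongrightarrow> g x" unfolding d_def by (rule filterlim_compose)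
    qed
    show "AE x in lborel. norm (d n x) \<le> indicator (cball 0 (R + 1)) x *\<^sub>R B" for n
    proof (rule AE_I2)
      fix x
      show "norm (d n x) \<le> indicator (cball 0 (R + 1)) x *\<^sub>R B"
      proof (cases "x \<in> cball 0 (R + 1)")
        case True
        obtain z where "f (x + t n *\<^sub>R e) - f (x + 0 *\<^sub>R e) = (t n - 0) * g (x + z *\<^sub>R e)"
          using MVT2[OF t(1)[of n], of "\<lambda>s. f (x + s *\<^sub>R e)" "\<lambda>s. g (x + s *\<^sub>R e)"]
            has_real_derivative_along[of f x _ e UNIV] smooth_differentiable[OF f] by (auto simp: ge)
        then have "d n x = g (x + z *\<^sub>R e)" using t(1)[of n] by (simp add: d_def)
        then show ?thesis using gB True by simp
      next
        case False
        have "norm (x + t n *\<^sub>R e) > R"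
          using False t[of n] ne norm_diff_ineq[of x "t n *\<^sub>R e"] by (auto simp: dist_norm)
        then have "f (x + t n *\<^sub>R e) = 0" by (rule fz)
        moreover have "f x = 0" using False by (intro fz) (simp add: dist_norm)
        ultimately show ?thesis using False by (simp add: d_def)
      qed
    qed
  qed simp
  moreover have "(\<integral>x. d n x \<partial>lborel) = 0" for n
  proof -
    have "integrable lborel (\<lambda>x. f (x + t n *\<^sub>R e))"
      using integrable_distr_eq[of "(+) (t n *\<^sub>R e)" lborel borel f] fi
      by (simp add: lborel_distr_plus add.commute)
    then show ?thesis
      using fi lborel_integral_translation[of f "t n *\<^sub>R e"] by (simp add: d_def)
  qed
  ultimately show ?thesis by (simp add: LIMSEQ_const_iff g_def)
qed

lemma integral_lebesgue_on_eq_lborel: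
  fixes f :: "real^'n \<Rightarrow> real"
  assumes "f \<in> borel_measurable borel" "open S" "\<And>x. x \<notin> S \<Longrightarrow> f x = 0"
  shows "(\<integral>x. f x \<partial>lebesgue_on S) = (\<integral>x. f x \<partial>lborel)"
proof -
  have "(\<integral>x. f x \<partial>lebesgue_on S) = (\<integral>x. indicator S x *\<^sub>R f x \<partial>lebesgue)"
    using assms(2) by (intro integral_restrict_space) simp
  also have "(\<lambda>x. indicator S x *\<^sub>R f x) = f" using assms(3) by (auto simp: fun_eq_iff indicator_def)
  finally show ?thesis using assms(1) by (simp add: integral_completion)
qed

lemma test_function_support:
  assumes "test_function S \<psi>"
  shows "smooth \<psi>" "bounded {x. \<psi> x \<noteq> 0}" "\<And>x. x \<notin> S \<Longrightarrow> \<psi> x = 0" "\<And>x. x \<notin> S \<Longrightarrow> grad \<psi> x = 0"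
proof -
  have cl: "closure {x. \<psi> x \<noteq> 0} \<subseteq> S" using assms by (simp add: test_function_def)
  show "smooth \<psi>" using assms by (simp add: test_function_def)
  show "bounded {x. \<psi> x \<noteq> 0}"
    using assms compact_imp_bounded bounded_subset[OF _ closure_subset] by (auto simp: test_function_def)
  show "\<psi> x = 0" if "x \<notin> S" for x
    using that cl subsetD[OF closure_subset, of x "{x. \<psi> x \<noteq> 0}"] by fastforce
  show "grad \<psi> x = 0" if "x \<notin> S" for x
    using that cl by (intro grad_zero_outside) blast
qed

lemma integration_by_parts:
  fixes \<phi> \<psi> :: "real^'n \<Rightarrow> real"
  assumes S: "open S" and \<phi>: "smooth \<phi>" and \<psi>: "test_function S \<psi>"
  shows "(\<integral>x. \<phi> x * grad \<psi> x $ i \<partial>lebesgue_on S) = - (\<integral>x. grad \<phi> x $ i * \<psi> x \<partial>lebesgue_on S)"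
proof -
  note sup = test_function_support[OF \<psi>]
  have c: "continuous_on UNIV (\<lambda>x. \<phi> x * grad \<psi> x $ i)" "continuous_on UNIV (\<lambda>x. grad \<phi> x $ i * \<psi> x)"
    by (intro smooth_continuous smooth_mult smooth_grad \<phi> sup)+
  have b: "bounded {x. \<phi> x * grad \<psi> x $ i \<noteq> 0}"
  proof (rule bounded_subset)
    show "bounded (closure {x. \<psi> x \<noteq> 0})" by (rule bounded_closure[OF sup(2)])
    show "{x. \<phi> x * grad \<psi> x $ i \<noteq> 0} \<subseteq> closure {x. \<psi> x \<noteq> 0}"
      using grad_zero_outside[of _ \<psi>] by (metis (mono_tags, lifting) mem_Collect_eq mult_zero_right subsetI zero_index)
  qed
  have b2: "bounded {x. grad \<phi> x $ i * \<psi> x \<noteq> 0}"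
    by (rule bounded_subset[OF sup(2)]) auto
  have "bounded {x. \<phi> x * \<psi> x \<noteq> 0}" by (rule bounded_subset[OF sup(2)]) auto
  then have "0 = (\<integral>x. \<phi> x * grad \<psi> x $ i + grad \<phi> x $ i * \<psi> x \<partial>lborel)"
    using integral_grad_eq_0[of "\<lambda>x. \<phi> x * \<psi> x" i] \<phi> sup(1)
    by (simp add: smooth_mult grad_mult smooth_differentiable)
  also have "\<dots> = (\<integral>x. \<phi> x * grad \<psi> x $ i \<partial>lborel) + (\<integral>x. grad \<phi> x $ i * \<psi> x \<partial>lborel)"
    by (intro Bochner_Integration.integral_add integrable_continuous_compact_support c b b2)
  also have "(\<integral>x. \<phi> x * grad \<psi> x $ i \<partial>lborel) = (\<integral>x. \<phi> x * grad \<psi> x $ i \<partial>lebesgue_on S)"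
    by (rule integral_lebesgue_on_eq_lborel[symmetric, OF borel_measurable_continuous_onI[OF c(1)] S])
      (simp add: sup)
  also have "(\<integral>x. grad \<phi> x $ i * \<psi> x \<partial>lborel) = (\<integral>x. grad \<phi> x $ i * \<psi> x \<partial>lebesgue_on S)"
    by (rule integral_lebesgue_on_eq_lborel[symmetric, OF borel_measurable_continuous_onI[OF c(2)] S])
      (simp add: sup)
  finally show ?thesis by linarith
qed

locale bounded_open =
  fixes \<Omega> :: "(real^'n) set"
  assumes open_\<Omega>: "open \<Omega>" and bounded_\<Omega>: "bounded \<Omega>"
begin

lemma finite_\<Omega>: "finite_measure (lebesgue_on \<Omega>)"
  using open_\<Omega> bounded_\<Omega> by (simp add: finite_measure_lebesgue_on lmeasurable_open)

lemma continuous_imp_bounded_on_closure: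
  fixes f :: "real^'n \<Rightarrow> 'b::real_normed_vector"
  assumes "continuous_on UNIV f"
  obtains B where "\<And>x. x \<in> closure \<Omega> \<Longrightarrow> norm (f x) \<le> B"
proof -
  have "bounded (f ` closure \<Omega>)"
    using bounded_\<Omega> by (intro compact_imp_bounded compact_continuous_image continuous_on_subset[OF assms]) auto
  then show ?thesis using that unfolding bounded_iff by blast
qed

lemma continuous_L2:
  fixes f :: "real^'n \<Rightarrow> 'b::euclidean_space"
  assumes "continuous_on UNIV f"
  shows "f \<in> L2 (lebesgue_on \<Omega>)"
proof -
  obtain B where B: "\<And>x. x \<in> closure \<Omega> \<Longrightarrow> norm (f x) \<le> B"
    using continuous_imp_bounded_on_closure[OF assms] by blast
  have "AE x in lebesgue_on \<Omega>. norm (f x) \<le> B"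
    using closure_subset[of \<Omega>] by (intro AE_I2) (auto intro: B)
  then show ?thesis
    using assms by (intro bounded_imp_L2[OF finite_\<Omega>]) (auto intro: borel_measurable_lebesgue_on borel_measurable_continuous_onI)
qed

lemma test_function_L2:
  assumes "test_function \<Omega> \<psi>"
  shows "\<psi> \<in> L2 (lebesgue_on \<Omega>)" "grad \<psi> \<in> L2 (lebesgue_on \<Omega>)"
  using test_function_support(1)[OF assms]
  by (auto intro!: continuous_L2 smooth_continuous smooth_continuous_grad)

lemma weak_grad_L2: "w \<in> H1 \<Omega> \<Longrightarrow> weak_grad \<Omega> w \<in> L2 (lebesgue_on \<Omega>)"
  and has_weak_grad_weak_grad: "w \<in> H1 \<Omega> \<Longrightarrow> has_weak_grad \<Omega> w (weak_grad \<Omega> w)"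
  using someI_ex[of "\<lambda>G. G \<in> L2 (lebesgue_on \<Omega>) \<and> has_weak_grad \<Omega> w G"]
  by (auto simp: H1_def weak_grad_def)

lemma H1_L2: "w \<in> H1 \<Omega> \<Longrightarrow> w \<in> L2 (lebesgue_on \<Omega>)"
  by (simp add: H1_def)

text \<open>
  The difference of two weak gradients is orthogonal to all test functions, component by component.
\<close>

lemma weak_grad_unique:
  assumes w: "w \<in> H1 \<Omega>" and G: "G \<in> L2 (lebesgue_on \<Omega>)" "has_weak_grad \<Omega> w G"
  shows "AE x in lebesgue_on \<Omega>. weak_grad \<Omega> w x = G x"
proof -
  have "AE x in lebesgue_on \<Omega>. weak_grad \<Omega> w x $ i - G x $ i = 0" for i
  proof (rule fundamental_lemma_lebesgue[OF open_\<Omega>])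
    show "integrable (lebesgue_on \<Omega>) (\<lambda>x. weak_grad \<Omega> w x $ i - G x $ i)"
      using G(1) weak_grad_L2[OF w] by (intro Bochner_Integration.integrable_diff L2_integrable[OF finite_\<Omega>] L2_comp)
    fix \<psi> assume \<psi>: "test_function \<Omega> \<psi>"
    have "(\<integral>x. weak_grad \<Omega> w x $ i * \<psi> x \<partial>lebesgue_on \<Omega>) = (\<integral>x. G x $ i * \<psi> x \<partial>lebesgue_on \<Omega>)"
      using G(2) has_weak_grad_weak_grad[OF w] \<psi> by (simp add: has_weak_grad_def)
    then show "(\<integral>x. (weak_grad \<Omega> w x $ i - G x $ i) * \<psi> x \<partial>lebesgue_on \<Omega>) = 0"
      using L2_mult_integrable[OF L2_comp[OF G(1)] test_function_L2(1)[OF \<psi>], of i]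
        L2_mult_integrable[OF L2_comp[OF weak_grad_L2[OF w]] test_function_L2(1)[OF \<psi>], of i]
      by (simp add: left_diff_distrib)
  qed
  then have "AE x in lebesgue_on \<Omega>. \<forall>i\<in>UNIV. weak_grad \<Omega> w x $ i - G x $ i = 0"
    by (intro AE_finite_allI) auto
  then show ?thesis by eventually_elim (simp add: vec_eq_iff)
qed

lemma weak_div_unique:
  assumes v: "h \<in> L2 (lebesgue_on \<Omega>)" "has_weak_div \<Omega> v h"
  shows "weak_div \<Omega> v \<in> L2 (lebesgue_on \<Omega>)" "AE x in lebesgue_on \<Omega>. weak_div \<Omega> v x = h x"
proof -
  have W: "weak_div \<Omega> v \<in> L2 (lebesgue_on \<Omega>) \<and> has_weak_div \<Omega> v (weak_div \<Omega> v)"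
    unfolding weak_div_def by (rule someI[of _ h]) (use v in blast)
  then show "weak_div \<Omega> v \<in> L2 (lebesgue_on \<Omega>)" by simp
  have "AE x in lebesgue_on \<Omega>. weak_div \<Omega> v x - h x = 0"
  proof (rule fundamental_lemma_lebesgue[OF open_\<Omega>])
    show "integrable (lebesgue_on \<Omega>) (\<lambda>x. weak_div \<Omega> v x - h x)"
      using W v by (intro Bochner_Integration.integrable_diff L2_integrable[OF finite_\<Omega>]) auto
    fix \<psi> assume \<psi>: "test_function \<Omega> \<psi>"
    have "(\<integral>x. weak_div \<Omega> v x * \<psi> x \<partial>lebesgue_on \<Omega>) = (\<integral>x. h x * \<psi> x \<partial>lebesgue_on \<Omega>)"
      using v(2) W \<psi> by (simp add: has_weak_div_def)
    then show "(\<integral>x. (weak_div \<Omega> v x - h x) * \<psi> x \<partial>lebesgue_on \<Omega>) = 0"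
      using L2_mult_integrable[OF v(1) test_function_L2(1)[OF \<psi>]]
        L2_mult_integrable[OF conjunct1[OF W] test_function_L2(1)[OF \<psi>]]
      by (simp add: left_diff_distrib)
  qed
  then show "AE x in lebesgue_on \<Omega>. weak_div \<Omega> v x = h x" by simp
qed

lemma has_weak_grad_lincomb:
  assumes w: "w\<^sub>1 \<in> H1 \<Omega>" "w\<^sub>2 \<in> H1 \<Omega>"
  shows "has_weak_grad \<Omega> (\<lambda>x. w\<^sub>1 x + c * w\<^sub>2 x) (\<lambda>x. weak_grad \<Omega> w\<^sub>1 x + c *\<^sub>R weak_grad \<Omega> w\<^sub>2 x)"
  unfolding has_weak_grad_def
proof (intro allI impI)
  fix \<psi> i assume \<psi>: "test_function \<Omega> \<psi>"
  note H = has_weak_grad_weak_grad[OF w(1), unfolded has_weak_grad_def, rule_format, OF \<psi>, of i]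
    has_weak_grad_weak_grad[OF w(2), unfolded has_weak_grad_def, rule_format, OF \<psi>, of i]
  note I = L2_mult_integrable[OF H1_L2[OF w(1)] L2_comp[OF test_function_L2(2)[OF \<psi>]], of i]
    L2_mult_integrable[OF H1_L2[OF w(2)] L2_comp[OF test_function_L2(2)[OF \<psi>]], of i]
    L2_mult_integrable[OF L2_comp[OF weak_grad_L2[OF w(1)]] test_function_L2(1)[OF \<psi>], of i]
    L2_mult_integrable[OF L2_comp[OF weak_grad_L2[OF w(2)]] test_function_L2(1)[OF \<psi>], of i]
  show "(\<integral>x. (w\<^sub>1 x + c * w\<^sub>2 x) * grad \<psi> x $ i \<partial>lebesgue_on \<Omega>) =
      - (\<integral>x. (weak_grad \<Omega> w\<^sub>1 x + c *\<^sub>R weak_grad \<Omega> w\<^sub>2 x) $ i * \<psi> x \<partial>lebesgue_on \<Omega>)"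
    using H I by (simp add: distrib_right mult.assoc)
qed

lemma H1_lincomb:
  assumes w: "w\<^sub>1 \<in> H1 \<Omega>" "w\<^sub>2 \<in> H1 \<Omega>"
  shows "(\<lambda>x. w\<^sub>1 x + c * w\<^sub>2 x) \<in> H1 \<Omega>"
  using has_weak_grad_lincomb[OF w] L2_lincomb[OF weak_grad_L2[OF w(1)] weak_grad_L2[OF w(2)]]
    L2_lincomb_real[OF H1_L2[OF w(1)] H1_L2[OF w(2)]]
  by (auto simp: H1_def)

lemma weak_grad_lincomb:
  assumes w: "w\<^sub>1 \<in> H1 \<Omega>" "w\<^sub>2 \<in> H1 \<Omega>"
  shows "AE x in lebesgue_on \<Omega>.
    weak_grad \<Omega> (\<lambda>x. w\<^sub>1 x + c * w\<^sub>2 x) x = weak_grad \<Omega> w\<^sub>1 x + c *\<^sub>R weak_grad \<Omega> w\<^sub>2 x"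
  using w by (intro weak_grad_unique H1_lincomb L2_lincomb weak_grad_L2 has_weak_grad_lincomb)

lemma smooth_H1:
  assumes "smooth \<phi>"
  shows "\<phi> \<in> H1 \<Omega>" "AE x in lebesgue_on \<Omega>. weak_grad \<Omega> \<phi> x = grad \<phi> x"
proof -
  have G: "grad \<phi> \<in> L2 (lebesgue_on \<Omega>)" "has_weak_grad \<Omega> \<phi> (grad \<phi>)"
    using assms integration_by_parts[OF open_\<Omega> assms]
    by (auto intro!: continuous_L2 smooth_continuous_grad simp: has_weak_grad_def)
  then show H: "\<phi> \<in> H1 \<Omega>"
    using continuous_L2[OF smooth_continuous[OF assms]] by (auto simp: H1_def)
  show "AE x in lebesgue_on \<Omega>. weak_grad \<Omega> \<phi> x = grad \<phi> x" by (rule weak_grad_unique[OF H G])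
qed

end

section \<open>Hausdorff measure of Lipschitz graphs\<close>

lemma sets_hausdorff_measure [simp]: "sets (hausdorff_measure m) = sets borel"
  and space_hausdorff_measure [simp]: "space (hausdorff_measure m) = UNIV"
  using sets.sigma_sets_eq[of borel] by (simp_all add: hausdorff_measure_def)

text \<open>
  The generated measure has either the values of the outer measure or, by the default of
  \<open>measure_of\<close>, the value zero everywhere. An upper bound on the outer measure serves in both cases.
\<close>

lemma emeasure_hausdorff_le: "emeasure (hausdorff_measure m) E \<le> hausdorff_outer m E"
  unfolding hausdorff_measure_def by (simp add: emeasure_measure_of_conv)

lemma cube_diameter_power_le:
  fixes u v :: "real^'n"
  assumes s: "\<And>i. v $ i - u $ i = s" and pos: "0 \<le> s"
  shows "diameter (cbox u v) ^ CARD('n) \<le> real CARD('n) ^ CARD('n) * measure lborel (cbox u v)"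
proof -
  have le: "\<forall>i\<in>Basis. u \<bullet> i \<le> v \<bullet> i"
    using s pos by (auto simp: Basis_vec_def inner_axis) (metis diff_ge_0_iff_ge)
  have "norm (v - u) \<le> (\<Sum>i\<in>UNIV. \<bar>(v - u) $ i\<bar>)" by (rule norm_le_l1_cart)
  also have "\<dots> = real CARD('n) * s" using s pos by simp
  finally have d: "diameter (cbox u v) \<le> real CARD('n) * s"
    using le by (simp add: diameter_cbox dist_norm norm_minus_commute)
  have "diameter (cbox u v) ^ CARD('n) \<le> (real CARD('n) * s) ^ CARD('n)"
    using d by (intro power_mono diameter_ge_0) auto
  also have "\<dots> = real CARD('n) ^ CARD('n) * measure lborel (cbox u v)"
  proof -
    have "measure lborel (cbox u v) = (\<Prod>i\<in>UNIV. v $ i - u $ i)"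
      using le content_cbox_cart[of u v] by (auto simp: box_ne_empty)
    then show ?thesis using s by (simp add: power_mult_distrib)
  qed
  finally show ?thesis .
qed

text \<open>
  The gauge confines each cube to \<open>T\<close> and to a small ball, and for cubes the volume controls the power
  \<open>d\<close> of the diameter. The family is enumerated by all natural numbers, with empty sets as padding.
\<close>

lemma ex_cube_cover:
  fixes A T :: "(real^'n) set"
  assumes T: "open T" and A: "A \<subseteq> T" "bounded A" and \<rho>: "0 < \<rho>"
  obtains K :: "nat \<Rightarrow> (real^'n) set" where
    "\<And>i. compact (K i)" "\<And>i. diameter (K i) \<le> \<rho>" "A \<subseteq> (\<Union>i. K i)"
    "\<And>i. diameter (K i) ^ CARD('n) \<le> real CARD('n) ^ CARD('n) * measure lborel (K i)"
    "(\<Sum>i. ennreal (measure lborel (K i))) \<le> emeasure lborel T"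
proof -
  obtain R where R: "0 < R" "A \<subseteq> cball 0 R" using A(2) bounded_pos[of A] by (auto simp: subset_iff)
  define b :: "real^'n" where "b = (\<chi> i. R)"
  have bi: "b \<bullet> i = R" if "i \<in> Basis" for i
    using that by (auto simp: b_def Basis_vec_def inner_axis)
  have sub: "A \<subseteq> cbox (- b) b"
  proof
    fix x assume "x \<in> A"
    then have "norm x \<le> R" using R by auto
    then have "\<bar>x $ i\<bar> \<le> R" for i using component_le_norm_cart[of x i] by linarith
    then have "- R \<le> x $ i \<and> x $ i \<le> R" for i by (metis abs_le_iff minus_le_iff)
    then show "x \<in> cbox (- b) b" by (simp add: mem_box_cart b_def)
  qed
  have ne: "box (- b) b \<noteq> {}" using R(1) by (simp add: box_ne_empty bi)
  have "gauge (\<lambda>x. if x \<in> T then T \<inter> ball x (\<rho> / 2) else ball x 1)"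
    using T \<rho> by (auto simp: gauge_def)
  from covering_lemma[OF sub ne this] obtain D where D: "countable D"
    "\<And>K. K \<in> D \<Longrightarrow> interior K \<noteq> {} \<and> (\<exists>c d. K = cbox c d)"
    "pairwise (\<lambda>A B. interior A \<inter> interior B = {}) D"
    "\<And>K. K \<in> D \<Longrightarrow> \<exists>x\<in>A \<inter> K. K \<subseteq> (if x \<in> T then T \<inter> ball x (\<rho> / 2) else ball x 1)"
    "\<And>u v. cbox u v \<in> D \<Longrightarrow> \<exists>n. \<forall>i\<in>Basis. v \<bullet> i - u \<bullet> i = (b \<bullet> i - (- b) \<bullet> i) / 2 ^ n"
    "A \<subseteq> \<Union>D" by metis
  have DT: "K \<subseteq> T" "diameter K \<le> \<rho>" if KD: "K \<in> D" for K
  proof -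
    obtain x where xA: "x \<in> A \<inter> K" and xK: "K \<subseteq> (if x \<in> T then T \<inter> ball x (\<rho> / 2) else ball x 1)"
      using D(4)[OF KD] by blast
    then have x: "x \<in> A" "K \<subseteq> T \<inter> ball x (\<rho> / 2)"
      using subsetD[OF A(1), of x] by simp_all
    then show "K \<subseteq> T" by simp
    have "norm (y - z) \<le> \<rho>" if "y \<in> K" "z \<in> K" for y z
    proof -
      have "dist x y < \<rho> / 2" "dist x z < \<rho> / 2" using that x(2) by auto
      then have "dist y z < \<rho>" using dist_triangle_half_r by blast
      then show ?thesis by (simp add: dist_norm)
    qed
    then show "diameter K \<le> \<rho>" using \<rho> by (intro diameter_le) auto
  qed
  have Dcube: "diameter K ^ CARD('n) \<le> real CARD('n) ^ CARD('n) * measure lborel K" if KD: "K \<in> D" for K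
  proof -
    obtain u v where K: "K = cbox u v" using D(2)[OF KD] by blast
    obtain n where n: "\<forall>i\<in>Basis. v \<bullet> i - u \<bullet> i = (b \<bullet> i - (- b) \<bullet> i) / 2 ^ n"
      using D(5)[of u v] KD K by blast
    have "v $ i - u $ i = (R + R) / 2 ^ n" for i
      using n[rule_format, of "axis i 1"] bi[of "axis i 1"]
      by (simp add: cart_eq_inner_axis inner_commute)
    then show ?thesis unfolding K using R(1) by (intro cube_diameter_power_le) auto
  qed
  define K where "K i = (if i \<in> to_nat_on D ` D then from_nat_into D i else {})" for i
  have K: "K i = {} \<or> K i \<in> D" for i
    using D(1) by (auto simp: K_def)
  have cK: "compact (K i)" for i using K[of i] D(2)[of "K i"] by (auto simp del: interior_cbox)
  show thesis
  proof
    show "compact (K i)" for i by (rule cK)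
    show "diameter (K i) \<le> \<rho>" for i using K[of i] DT \<rho> by auto
    have "k \<subseteq> (\<Union>i. K i)" if "k \<in> D" for k
    proof -
      have "K (to_nat_on D k) = k" using that D(1) by (simp add: K_def)
      then show ?thesis by blast
    qed
    then show "A \<subseteq> (\<Union>i. K i)" using D(6) by blast
    show "diameter (K i) ^ CARD('n) \<le> real CARD('n) ^ CARD('n) * measure lborel (K i)" for i
      using K[of i] Dcube by (auto simp: zero_power)
    have em: "ennreal (measure lborel (K i)) = emeasure lborel (interior (K i))" for i
    proof (cases "K i = {}")
      case False
      then obtain c d where cd: "K i = cbox c d" using K D(2) by blast
      have "emeasure lborel (cbox c d) = ennreal (measure lborel (cbox c d))"
        by (intro emeasure_eq_ennreal_measure) (simp add: emeasure_lborel_cbox_eq)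
      then show ?thesis by (simp add: cd emeasure_lborel_box_eq emeasure_lborel_cbox_eq)
    qed simp
    have "disjoint_family (\<lambda>i. interior (K i))"
      unfolding disjoint_family_on_def
    proof (intro ballI impI)
      fix i j :: nat assume "i \<noteq> j"
      show "interior (K i) \<inter> interior (K j) = {}"
      proof (cases "i \<in> to_nat_on D ` D \<and> j \<in> to_nat_on D ` D")
        case True
        then obtain k l where kl: "k \<in> D" "l \<in> D" "i = to_nat_on D k" "j = to_nat_on D l" by auto
        then have "K i = k" "K j = l" using D(1) by (simp_all add: K_def)
        moreover have "k \<noteq> l" using kl \<open>i \<noteq> j\<close> by auto
        ultimately show ?thesis using D(3) kl by (simp add: pairwise_def)
      qed (auto simp: K_def)
    qed
    then have "(\<Sum>i. ennreal (measure lborel (K i))) = emeasure lborel (\<Union>i. interior (K i))"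
      unfolding em by (intro suminf_emeasure) auto
    also have "\<dots> \<le> emeasure lborel T"
    proof (rule emeasure_mono)
      have "interior (K i) \<subseteq> T" for i using K[of i] DT(1)[of "K i"] interior_subset[of "K i"] by auto
      then show "(\<Union>i. interior (K i)) \<subseteq> T" by blast
    qed (use T in simp)
    finally show "(\<Sum>i. ennreal (measure lborel (K i))) \<le> emeasure lborel T" .
  qed
qed

text \<open>
  Cover the layer \<open>{x - s \<nu> | x \<in> E, 0 < s < \<delta>}\<close> by small cubes. For each \<open>s\<close>, the cubes meeting the level
  set \<open>h = s\<close>, moved back by \<open>s \<nu>\<close>, cover \<open>E\<close>. A cube \<open>Q\<close> meets level sets only for \<open>s\<close> in an interval of
  length comparable to \<open>diameter Q\<close>, so integrating the resulting bound over \<open>s\<close> turns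
  \<open>\<Sum> diameter\<^sup>d\<^sup>-\<^sup>1\<close> into \<open>\<Sum> diameter\<^sup>d\<close>, which is comparable to the volume.
\<close>

lemma hausdorff_outer_le_layer_volume:
  fixes E T :: "(real^'n) set" and h :: "real^'n \<Rightarrow> real"
  assumes n: "2 \<le> CARD('n)" and \<delta>: "0 < \<delta>" and lip: "C-lipschitz_on UNIV h"
    and shift: "\<And>y s. h (y - s *\<^sub>R \<nu>) = h y + s" and E: "\<And>x. x \<in> E \<Longrightarrow> h x = 0" "bounded E"
    and T: "open T" and layer: "\<And>x s. x \<in> E \<Longrightarrow> 0 < s \<Longrightarrow> s < \<delta> \<Longrightarrow> x - s *\<^sub>R \<nu> \<in> T"
  shows "hausdorff_outer (CARD('n) - 1) E * ennreal \<delta> \<le>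
    ennreal (2 * C * unit_ball_vol (real (CARD('n) - 1)) * real CARD('n) ^ CARD('n)) * emeasure lborel T"
proof -
  define m where "m = CARD('n) - 1"
  have m: "0 < m" "CARD('n) = Suc m" using n by (auto simp: m_def)
  have C: "0 \<le> C" using lip lipschitz_on_nonneg by blast
  define \<omega> where "\<omega> = unit_ball_vol (real m)"
  have \<omega>: "0 \<le> \<omega>" by (simp add: \<omega>_def)
  define c where "c = 2 * C * \<omega> * real CARD('n) ^ CARD('n)"
  have c: "0 \<le> c" using C \<omega> by (simp add: c_def)
  have content: "hausdorff_content m \<rho> E * ennreal \<delta> \<le> ennreal c * emeasure lborel T" if \<rho>: "0 < \<rho>" for \<rho>
  proof -
    define A where "A = {x - s *\<^sub>R \<nu> | x s. x \<in> E \<and> 0 < s \<and> s < \<delta>}"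
    have AT: "A \<subseteq> T" using layer by (auto simp: A_def)
    have bA: "bounded A"
    proof -
      obtain r where r: "\<And>x. x \<in> E \<Longrightarrow> norm x \<le> r" using E(2) by (auto simp: bounded_iff)
      have "norm (x - s *\<^sub>R \<nu>) \<le> r + \<delta> * norm \<nu>" if "x \<in> E" "0 < s" "s < \<delta>" for x s
        using r[OF that(1)] norm_triangle_ineq4[of x "s *\<^sub>R \<nu>"] that
          mult_right_mono[of s \<delta> "norm \<nu>"] by simp
      then show ?thesis unfolding bounded_iff A_def by blast
    qed
    obtain K :: "nat \<Rightarrow> (real^'n) set" where K: "\<And>i. compact (K i)" "\<And>i. diameter (K i) \<le> \<rho>" "A \<subseteq> (\<Union>i. K i)"
      "\<And>i. diameter (K i) ^ CARD('n) \<le> real CARD('n) ^ CARD('n) * measure lborel (K i)"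
      "(\<Sum>i. ennreal (measure lborel (K i))) \<le> emeasure lborel T"
      by (rule ex_cube_cover[OF T AT bA \<rho>]) blast
    define z where "z i = (SOME y. y \<in> K i)" for i
    have z: "z i \<in> K i" if "y \<in> K i" for i y unfolding z_def by (rule someI[of _ y]) (rule that)
    define d where "d i = diameter (K i)" for i
    have d0: "0 \<le> d i" for i
      unfolding d_def using K(1) by (intro diameter_ge_0 compact_imp_bounded)
    define J where "J i = {h (z i) - C * d i .. h (z i) + C * d i}" for i
    define w where "w i = ennreal (\<omega> * (d i / 2) ^ m)" for i
    have slice: "hausdorff_content m \<rho> E \<le> (\<Sum>i. w i * indicator (J i) s)" if s: "0 < s" "s < \<delta>" for s
    proof -
      define U where "U i = (if s \<in> J i then (\<lambda>y. s *\<^sub>R \<nu> + y) ` K i else {})" for i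
      have diamU: "0 \<le> diameter (U i)" "diameter (U i) \<le> (if s \<in> J i then d i else 0)" for i
      proof -
        have "bounded (U i)" using K(1) by (auto simp: U_def bounded_translation compact_imp_bounded)
        then show "0 \<le> diameter (U i)" by (rule diameter_ge_0)
        have "norm (x - y) \<le> d i" if "x \<in> K i" "y \<in> K i" for x y
          using diameter_bounded_bound[OF compact_imp_bounded[OF K(1)] that] by (simp add: d_def dist_norm)
        then show "diameter (U i) \<le> (if s \<in> J i then d i else 0)"
          using d0[of i] unfolding U_def by (auto intro!: diameter_le)
      qed
      have "E \<subseteq> (\<Union>i. U i)"
      proof
        fix x assume x: "x \<in> E"
        then have "x - s *\<^sub>R \<nu> \<in> A" using s by (auto simp: A_def)
        then obtain i where i: "x - s *\<^sub>R \<nu> \<in> K i" using K(3) by blast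
        have "\<bar>h (x - s *\<^sub>R \<nu>) - h (z i)\<bar> \<le> C * dist (x - s *\<^sub>R \<nu>) (z i)"
          using lipschitz_onD[OF lip] by (simp add: dist_real_def)
        also have "\<dots> \<le> C * d i"
          unfolding d_def using C K(1) i z by (intro mult_left_mono diameter_bounded_bound compact_imp_bounded) auto
        finally have "s \<in> J i" using shift[of x s] E(1)[OF x] by (auto simp: J_def abs_le_iff)
        then have "x \<in> U i" using i by (auto simp: U_def intro!: image_eqI[of _ _ "x - s *\<^sub>R \<nu>"])
        then show "x \<in> (\<Union>i. U i)" by blast
      qed
      moreover have "bounded (U i) \<and> diameter (U i) \<le> \<rho>" for i
      proof
        show "bounded (U i)" using K(1) by (auto simp: U_def bounded_translation compact_imp_bounded)
        show "diameter (U i) \<le> \<rho>" using diamU(2)[of i] K(2)[of i] \<rho> by (simp add: d_def split: if_splits)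
      qed
      ultimately have "hausdorff_content m \<rho> E \<le> (\<Sum>i. ennreal (\<omega> * (diameter (U i) / 2) ^ m))"
        unfolding hausdorff_content_def \<omega>_def by (intro INF_lower) auto
      also have "\<dots> \<le> (\<Sum>i. w i * indicator (J i) s)"
      proof (intro suminf_le summableI)
        fix i
        have "\<omega> * (diameter (U i) / 2) ^ m \<le> \<omega> * ((if s \<in> J i then d i else 0) / 2) ^ m"
          using diamU[of i] \<omega> by (intro mult_left_mono power_mono divide_right_mono) auto
        then show "ennreal (\<omega> * (diameter (U i) / 2) ^ m) \<le> w i * indicator (J i) s"
          using m(1) by (cases "s \<in> J i") (auto simp: w_def zero_power ennreal_neg intro: ennreal_leI)
      qed
      finally show ?thesis .
    qed
    have "hausdorff_content m \<rho> E * ennreal \<delta> = (\<integral>\<^sup>+s. hausdorff_content m \<rho> E * indicator {0<..<\<delta>} s \<partial>lborel)"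
      using \<delta> by (subst nn_integral_cmult_indicator) auto
    also have "\<dots> \<le> (\<integral>\<^sup>+s. (\<Sum>i. w i * indicator (J i) s) \<partial>lborel)"
      by (intro nn_integral_mono) (auto simp: indicator_def[of "{0<..<\<delta>}"] slice)
    also have "\<dots> = (\<Sum>i. w i * emeasure lborel (J i))"
      by (subst nn_integral_suminf) (auto simp: J_def nn_integral_cmult_indicator)
    also have "\<dots> \<le> (\<Sum>i. ennreal c * ennreal (measure lborel (K i)))"
    proof (intro suminf_le summableI)
      fix i
      have "w i * emeasure lborel (J i) = ennreal (\<omega> * (d i / 2) ^ m * (2 * C * d i))"
        using C d0[of i] \<omega> by (simp add: w_def J_def ennreal_mult''[symmetric])
      also have "\<dots> \<le> ennreal (c * measure lborel (K i))"
      proof (rule ennreal_leI)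
        have "(d i / 2) ^ m \<le> d i ^ m" using d0[of i] by (intro power_mono) auto
        then have "\<omega> * (d i / 2) ^ m * (2 * C * d i) \<le> \<omega> * d i ^ m * (2 * C * d i)"
          using \<omega> C d0[of i] by (intro mult_right_mono mult_left_mono) auto
        also have "\<dots> = 2 * C * \<omega> * d i ^ CARD('n)" by (simp add: m(2))
        also have "\<dots> \<le> 2 * C * \<omega> * (real CARD('n) ^ CARD('n) * measure lborel (K i))"
          using K(4)[of i] C \<omega> unfolding d_def by (intro mult_left_mono) auto
        finally show "\<omega> * (d i / 2) ^ m * (2 * C * d i) \<le> c * measure lborel (K i)"
          by (simp add: c_def mult_ac)
      qed
      finally show "w i * emeasure lborel (J i) \<le> ennreal c * ennreal (measure lborel (K i))"
        using c by (simp add: ennreal_mult)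
    qed
    also have "\<dots> = ennreal c * (\<Sum>i. ennreal (measure lborel (K i)))" by (rule ennreal_suminf_cmult)
    also have "\<dots> \<le> ennreal c * emeasure lborel T" by (intro mult_left_mono K(5)) simp
    finally show ?thesis .
  qed
  have "hausdorff_outer m E * ennreal \<delta> = (SUP \<rho>\<in>{0<..}. hausdorff_content m \<rho> E * ennreal \<delta>)"
    unfolding hausdorff_outer_def by (rule SUP_mult_right_ennreal)
  also have "\<dots> \<le> ennreal c * emeasure lborel T" by (intro SUP_least content) simp
  finally show ?thesis by (simp add: c_def \<omega>_def m_def)
qed

section \<open>Boundary charts\<close>

text \<open>
  The Cauchy-Schwarz inequality \<open>(\<integral> \<bar>u\<bar>)\<^sup>2 \<le> V \<integral> u\<^sup>2\<close>, with \<open>V\<close> the total mass, is the nonnegativity of the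
  variance of \<open>\<bar>u\<bar>\<close>.
\<close>

lemma integral_abs_tendsto_0:
  fixes u :: "nat \<Rightarrow> 'a \<Rightarrow> real"
  assumes fin: "finite_measure M" and u: "\<And>k. u k \<in> L2 M" and lim: "(\<lambda>k. L2_norm_sq M (u k)) \<longlonglongrightarrow> 0"
  shows "(\<lambda>k. \<integral>x. \<bar>u k x\<bar> \<partial>M) \<longlonglongrightarrow> 0"
proof -
  interpret finite_measure M by fact
  define V where "V = measure M (space M)"
  have V: "0 \<le> V" by (simp add: V_def)
  have bound: "(\<integral>x. \<bar>u k x\<bar> \<partial>M) \<le> sqrt (V * L2_norm_sq M (u k))" for k
  proof (cases "V = 0")
    case True
    have "emeasure M (space M) = 0" using True by (simp add: emeasure_eq_measure V_def)
    then have "AE x in M. \<bar>u k x\<bar> = 0" by (intro AE_I[of _ _ "space M"]) auto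
    then have "(\<integral>x. \<bar>u k x\<bar> \<partial>M) = 0" by (rule integral_eq_zero_AE)
    then show ?thesis using True by simp
  next
    case False
    define m where "m = (\<integral>x. \<bar>u k x\<bar> \<partial>M)"
    have i1: "integrable M (\<lambda>x. \<bar>u k x\<bar>)" by (rule integrable_abs[OF L2_integrable[OF fin u]])
    have i2: "integrable M (\<lambda>x. (u k x)\<^sup>2)" using L2_D(2)[OF u[of k]] by simp
    have "0 \<le> (\<integral>x. (V * \<bar>u k x\<bar> - m)\<^sup>2 \<partial>M)" by simp
    also have "\<dots> = (\<integral>x. V\<^sup>2 * (u k x)\<^sup>2 - 2 * V * m * \<bar>u k x\<bar> + m\<^sup>2 \<partial>M)"
    proof (rule Bochner_Integration.integral_cong[OF refl])
      have sq: "(V * a - m)\<^sup>2 = V\<^sup>2 * a\<^sup>2 - 2 * V * m * a + m\<^sup>2" for a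
        by (simp add: power2_eq_square algebra_simps)
      show "(V * \<bar>u k x\<bar> - m)\<^sup>2 = V\<^sup>2 * (u k x)\<^sup>2 - 2 * V * m * \<bar>u k x\<bar> + m\<^sup>2" for x
        using sq[of "\<bar>u k x\<bar>"] by (simp only: power2_abs)
    qed
    also have "\<dots> = V\<^sup>2 * L2_norm_sq M (u k) - 2 * V * m * m + m\<^sup>2 * V"
      using i1 i2 by (simp add: L2_norm_sq_def m_def V_def)
    also have "\<dots> = V * (V * L2_norm_sq M (u k) - m\<^sup>2)" by (simp add: power2_eq_square algebra_simps)
    finally have "m\<^sup>2 \<le> V * L2_norm_sq M (u k)" using False V by (simp add: zero_le_mult_iff)
    then show ?thesis unfolding m_def[symmetric] by (rule real_le_rsqrt)
  qed
  have "(\<lambda>k. sqrt (V * L2_norm_sq M (u k))) \<longlonglongrightarrow> sqrt (V * 0)"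
    by (intro tendsto_intros lim)
  then have lim0: "(\<lambda>k. sqrt (V * L2_norm_sq M (u k))) \<longlonglongrightarrow> 0" by simp
  show ?thesis
    by (rule tendsto_sandwich[OF _ _ tendsto_const lim0]) (simp_all add: bound)
qed

text \<open>
  Here \<open>h y\<close> is the height of the boundary graph above \<open>y\<close> in direction \<open>\<nu>\<close>. The boundary is a piece of the zero
  set of the Lipschitz function \<open>h\<close>, which increases at unit speed along \<open>- \<nu>\<close>; this describes the graph
  without splitting the space into horizontal and vertical coordinates.
\<close>

definition boundary_chart ::
    "(real^'n) set \<Rightarrow> real^'n \<Rightarrow> (real^'n \<Rightarrow> real) \<Rightarrow> real \<Rightarrow> real^'n \<Rightarrow> real \<Rightarrow> bool" where
  "boundary_chart \<Omega> x\<^sub>0 h C \<nu> r \<longleftrightarrow> C-lipschitz_on UNIV h \<and> (\<forall>y s. h (y - s *\<^sub>R \<nu>) = h y + s) \<and> 0 < r \<and>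
     (\<forall>x\<in>frontier \<Omega> \<inter> ball x\<^sub>0 r. h x = 0 \<and> (\<forall>s. 0 < s \<longrightarrow> s < r \<longrightarrow> x - s *\<^sub>R \<nu> \<in> \<Omega>))"

locale lipschitz_domain = bounded_open \<Omega> for \<Omega> :: "(real^'n) set" +
  assumes lip_\<Omega>: "lipschitz_boundary \<Omega>" and dim2: "2 \<le> CARD('n)"
begin

abbreviation S :: "(real^'n) measure" where "S \<equiv> surface_on (frontier \<Omega>)"

text \<open>
  A frontier point near \<open>x\<^sub>0\<close> lies neither strictly below the graph, as \<open>\<Omega>\<close> is open, nor strictly
  above it, as the points there have a neighbourhood disjoint from \<open>\<Omega>\<close>.
\<close>

lemma ex_boundary_chart:
  assumes x0: "x\<^sub>0 \<in> frontier \<Omega>"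
  shows "\<exists>h C \<nu> r. boundary_chart \<Omega> x\<^sub>0 h C \<nu> r"
proof -
  obtain U \<nu> L and a :: "real^'n \<Rightarrow> real" where U: "open U" "x\<^sub>0 \<in> U" and \<nu>: "norm \<nu> = 1"
    and a: "L-lipschitz_on {y. y \<bullet> \<nu> = 0} a"
    and \<Omega>U: "\<Omega> \<inter> U = {y \<in> U. y \<bullet> \<nu> < a (y - (y \<bullet> \<nu>) *\<^sub>R \<nu>)}"
    using bspec[OF lip_\<Omega>[unfolded lipschitz_boundary_def] x0] by (elim exE conjE) (rule that)
  have \<nu>\<nu>: "\<nu> \<bullet> \<nu> = 1" using \<nu> by (simp add: norm_eq_1)
  define \<pi> where "\<pi> y = y - (y \<bullet> \<nu>) *\<^sub>R \<nu>" for y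
  define h where "h y = a (\<pi> y) - y \<bullet> \<nu>" for y
  have \<pi>0: "\<pi> y \<bullet> \<nu> = 0" for y by (simp add: \<pi>_def inner_simps \<nu>\<nu>)
  have L: "0 \<le> L" using a lipschitz_on_nonneg by blast
  have lip: "(2 * L + 1)-lipschitz_on UNIV h"
  proof (rule lipschitz_onI)
    fix x y
    have xy: "\<bar>(x - y) \<bullet> \<nu>\<bar> \<le> dist x y" using Cauchy_Schwarz_ineq2[of "x - y" \<nu>] \<nu> by (simp add: dist_norm)
    have "\<pi> x - \<pi> y = (x - y) - ((x - y) \<bullet> \<nu>) *\<^sub>R \<nu>" by (simp add: \<pi>_def algebra_simps inner_simps)
    then have "dist (\<pi> x) (\<pi> y) \<le> 2 * dist x y"
      using norm_triangle_ineq4[of "x - y" "((x - y) \<bullet> \<nu>) *\<^sub>R \<nu>"] xy \<nu> by (simp add: dist_norm)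
    moreover have "dist (a (\<pi> x)) (a (\<pi> y)) \<le> L * dist (\<pi> x) (\<pi> y)"
      using lipschitz_onD[OF a] \<pi>0 by simp
    ultimately have "\<bar>a (\<pi> x) - a (\<pi> y)\<bar> \<le> L * (2 * dist x y)"
      using L mult_left_mono[of "dist (\<pi> x) (\<pi> y)" "2 * dist x y" L] by (simp add: dist_real_def)
    then show "dist (h x) (h y) \<le> (2 * L + 1) * dist x y"
      using xy by (simp add: h_def dist_real_def algebra_simps inner_simps)
  qed (use L in simp)
  have shift: "h (y - s *\<^sub>R \<nu>) = h y + s" for y s
  proof -
    have "\<pi> (y - s *\<^sub>R \<nu>) = \<pi> y" by (simp add: \<pi>_def inner_simps \<nu>\<nu> algebra_simps)
    then show ?thesis by (simp add: h_def inner_simps \<nu>\<nu>)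
  qed
  have \<Omega>h: "y \<in> \<Omega> \<longleftrightarrow> 0 < h y" if "y \<in> U" for y
    using \<Omega>U that by (auto simp: h_def \<pi>_def)
  have cont: "continuous_on UNIV h" by (rule lipschitz_on_continuous_on[OF lip])
  have h0: "h x = 0" if x: "x \<in> frontier \<Omega>" "x \<in> U" for x
  proof (rule ccontr)
    assume "h x \<noteq> 0"
    moreover have "x \<notin> \<Omega>" using x open_\<Omega> by (simp add: frontier_def interior_open)
    ultimately have neg: "h x < 0" using \<Omega>h[OF x(2)] by simp
    have "open ({y. h y < 0} \<inter> U)"
      using U(1) cont by (intro open_Int open_Collect_less continuous_on_const) auto
    moreover have "({y. h y < 0} \<inter> U) \<inter> \<Omega> = {}" using \<Omega>h by force
    ultimately have "({y. h y < 0} \<inter> U) \<inter> closure \<Omega> = {}" by (simp add: open_Int_closure_eq_empty)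
    then show False using neg x by (auto simp: frontier_def)
  qed
  obtain \<epsilon> where \<epsilon>: "0 < \<epsilon>" "ball x\<^sub>0 \<epsilon> \<subseteq> U" using U open_contains_ball by blast
  define r where "r = \<epsilon> / 2"
  have "h x = 0 \<and> (\<forall>s. 0 < s \<longrightarrow> s < r \<longrightarrow> x - s *\<^sub>R \<nu> \<in> \<Omega>)" if x: "x \<in> frontier \<Omega> \<inter> ball x\<^sub>0 r" for x
  proof (intro conjI allI impI)
    have xU: "x \<in> U" using x \<epsilon> by (auto simp: r_def)
    then show "h x = 0" using h0 x by simp
    fix s assume s: "0 < s" "s < r"
    have "dist x\<^sub>0 (x - s *\<^sub>R \<nu>) \<le> dist x\<^sub>0 x + dist x (x - s *\<^sub>R \<nu>)" by (rule dist_triangle)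
    also have "\<dots> < r + r" using x s \<nu> by (simp add: dist_norm)
    finally have "x - s *\<^sub>R \<nu> \<in> U" using \<epsilon> by (auto simp: r_def)
    moreover have "0 < h (x - s *\<^sub>R \<nu>)" using shift[of x s] \<open>h x = 0\<close> s by simp
    ultimately show "x - s *\<^sub>R \<nu> \<in> \<Omega>" using \<Omega>h by blast
  qed
  then have "boundary_chart \<Omega> x\<^sub>0 h (2 * L + 1) \<nu> r"
    using lip shift \<epsilon>(1) by (simp add: boundary_chart_def r_def)
  then show ?thesis by blast
qed

lemma bounded_frontier_\<Omega>: "bounded (frontier \<Omega>)"
  using compact_frontier_bounded[OF bounded_\<Omega>] by (rule compact_imp_bounded)

lemma compact_frontier_\<Omega>: "compact (frontier \<Omega>)"
  using bounded_\<Omega> by (rule compact_frontier_bounded)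

lemma chart_emeasure_le:
  assumes chart: "boundary_chart \<Omega> x\<^sub>0 h C \<nu> r" and E: "E \<subseteq> frontier \<Omega> \<inter> ball x\<^sub>0 r"
    and T: "open T" and layer: "\<And>x s. x \<in> E \<Longrightarrow> 0 < s \<Longrightarrow> s < r \<Longrightarrow> x - s *\<^sub>R \<nu> \<in> T"
  shows "emeasure (hausdorff_measure (CARD('n) - 1)) E * ennreal r \<le>
    ennreal (2 * C * unit_ball_vol (real (CARD('n) - 1)) * real CARD('n) ^ CARD('n)) * emeasure lborel T"
proof -
  have "hausdorff_outer (CARD('n) - 1) E * ennreal r \<le>
    ennreal (2 * C * unit_ball_vol (real (CARD('n) - 1)) * real CARD('n) ^ CARD('n)) * emeasure lborel T"
  proof (rule hausdorff_outer_le_layer_volume[OF dim2 _ _ _ _ _ T layer, where h=h])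
    show "bounded E" using E bounded_frontier_\<Omega> bounded_subset by blast
  qed (use chart E in \<open>auto simp: boundary_chart_def\<close>)
  moreover have "emeasure (hausdorff_measure (CARD('n) - 1)) E * ennreal r \<le> hausdorff_outer (CARD('n) - 1) E * ennreal r"
    by (intro mult_right_mono emeasure_hausdorff_le) simp
  ultimately show ?thesis by (rule order_trans[rotated])
qed

lemma frontier_chart_cover:
  obtains F where "finite F" "\<And>B. B \<in> F \<Longrightarrow> \<exists>x\<^sub>0 h C \<nu> r. boundary_chart \<Omega> x\<^sub>0 h C \<nu> r \<and> B = ball x\<^sub>0 r"
    "frontier \<Omega> \<subseteq> \<Union>F"
proof -
  define \<C> where "\<C> = {ball x\<^sub>0 r | x\<^sub>0 r. \<exists>h C \<nu>. boundary_chart \<Omega> x\<^sub>0 h C \<nu> r}"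
  have "frontier \<Omega> \<subseteq> \<Union>\<C>"
  proof
    fix x assume "x \<in> frontier \<Omega>"
    then obtain h C \<nu> r where c: "boundary_chart \<Omega> x h C \<nu> r" using ex_boundary_chart by blast
    then have "x \<in> ball x r" by (simp add: boundary_chart_def)
    then show "x \<in> \<Union>\<C>" using c unfolding \<C>_def by blast
  qed
  moreover have "\<forall>B\<in>\<C>. open B" by (auto simp: \<C>_def)
  ultimately obtain F where "F \<subseteq> \<C>" "finite F" "frontier \<Omega> \<subseteq> \<Union>F"
    using compactE[OF compact_frontier_\<Omega>] by metis
  then show thesis using that[of F] unfolding \<C>_def by blast
qed

text \<open>
  Each of finitely many charts that cover the compact boundary has its layer inside \<open>\<Omega>\<close>, which has finite volume.
\<close>

lemma finite_S: "finite_measure S"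
proof -
  let ?H = "hausdorff_measure (CARD('n) - 1) :: (real^'n) measure"
  obtain F where F: "finite F" "\<And>B. B \<in> F \<Longrightarrow> \<exists>x\<^sub>0 h C \<nu> r. boundary_chart \<Omega> x\<^sub>0 h C \<nu> r \<and> B = ball x\<^sub>0 r"
    "frontier \<Omega> \<subseteq> \<Union>F" by (rule frontier_chart_cover) blast
  have fin: "emeasure ?H (frontier \<Omega> \<inter> B) < \<infinity>" if "B \<in> F" for B
  proof -
    obtain x0 h C \<nu> r where c: "boundary_chart \<Omega> x0 h C \<nu> r" and B: "B = ball x0 r" using F(2)[OF \<open>B \<in> F\<close>] by blast
    have r: "0 < r" using c by (simp add: boundary_chart_def)
    have "emeasure ?H (frontier \<Omega> \<inter> B) * ennreal r \<le>
      ennreal (2 * C * unit_ball_vol (real (CARD('n) - 1)) * real CARD('n) ^ CARD('n)) * emeasure lborel \<Omega>"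
      unfolding B by (rule chart_emeasure_le[OF c _ open_\<Omega>]) (use c in \<open>auto simp: boundary_chart_def\<close>)
    also have "\<dots> < \<infinity>"
      using emeasure_bounded_finite[OF bounded_\<Omega>] by (simp add: ennreal_mult_less_top)
    finally show ?thesis using r by (auto simp: ennreal_mult_less_top)
  qed
  have "emeasure ?H (frontier \<Omega>) \<le> emeasure ?H (\<Union>B\<in>F. frontier \<Omega> \<inter> B)"
  proof (rule emeasure_mono)
    show "frontier \<Omega> \<subseteq> (\<Union>B\<in>F. frontier \<Omega> \<inter> B)" using F(3) by blast
    have "frontier \<Omega> \<inter> B \<in> sets ?H" if B: "B \<in> F" for B
    proof -
      have "open B" using F(2)[OF B] by auto
      then show ?thesis
        unfolding sets_hausdorff_measure by (rule sets.Int[OF borel_closed[OF frontier_closed] borel_open])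
    qed
    then show "(\<Union>B\<in>F. frontier \<Omega> \<inter> B) \<in> sets ?H" by (rule sets.finite_UN[OF F(1)])
  qed
  also have "\<dots> \<le> (\<Sum>B\<in>F. emeasure ?H (frontier \<Omega> \<inter> B))"
  proof (rule emeasure_subadditive_finite[OF F(1)])
    show "(\<lambda>B. frontier \<Omega> \<inter> B) ` F \<subseteq> sets ?H" using F(2) by (force intro: borel_closed[OF frontier_closed])
  qed
  also have "\<dots> < \<infinity>" using fin F(1) by simp
  finally have "emeasure ?H (frontier \<Omega>) \<noteq> \<infinity>" by simp
  moreover have "space S = frontier \<Omega>" by (simp add: surface_on_def space_restrict_space)
  moreover have "emeasure S (frontier \<Omega>) = emeasure ?H (frontier \<Omega>)"
    unfolding surface_on_def by (rule emeasure_restrict_space) (simp_all add: borel_closed)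
  ultimately show ?thesis by (intro finite_measureI) simp
qed

lemma AE_surface_iff:
  "\<Gamma> \<in> sets borel \<Longrightarrow> (AE x in surface_on \<Gamma>. P x) \<longleftrightarrow> (AE x in hausdorff_measure (CARD('n) - 1). (x :: real^'n) \<in> \<Gamma> \<longrightarrow> P x)"
  unfolding surface_on_def by (rule AE_restrict_space_iff) simp

lemma borel_measurable_surface: "f \<in> borel_measurable borel \<Longrightarrow> f \<in> borel_measurable (surface_on \<Gamma>)"
  unfolding surface_on_def by (intro measurable_restrict_space1) (simp add: measurable_cong_sets[OF sets_hausdorff_measure refl])

text \<open>
  A null set containing the layer lies in open sets of arbitrarily small volume.
\<close>

lemma chart_null:
  assumes chart: "boundary_chart \<Omega> x\<^sub>0 h C \<nu> r" and E: "E \<subseteq> frontier \<Omega> \<inter> ball x\<^sub>0 r"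
    and N: "N \<in> null_sets lborel" and layer: "\<And>x s. x \<in> E \<Longrightarrow> 0 < s \<Longrightarrow> s < r \<Longrightarrow> x - s *\<^sub>R \<nu> \<in> N"
  shows "emeasure (hausdorff_measure (CARD('n) - 1)) E = 0"
proof -
  let ?H = "hausdorff_measure (CARD('n) - 1) :: (real^'n) measure"
  define c where "c = 2 * C * unit_ball_vol (real (CARD('n) - 1)) * real CARD('n) ^ CARD('n)"
  have "0 \<le> C" using chart lipschitz_on_nonneg by (auto simp: boundary_chart_def)
  then have c: "0 \<le> c" by (simp add: c_def)
  have r: "0 < r" using chart by (simp add: boundary_chart_def)
  have NL: "N \<in> sets lebesgue" "emeasure lebesgue N = 0"
    using null_sets_completionI[OF N] by auto
  have le: "emeasure ?H E * ennreal r \<le> ennreal e" if e: "0 < e" for e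
  proof -
    define e' where "e' = e / (c + 1)"
    have e': "0 < e'" "c * e' \<le> e" using c e by (simp_all add: e'_def field_simps)
    obtain T where T: "open T" "N \<subseteq> T" "(T - N) \<in> lmeasurable" "emeasure lebesgue (T - N) < ennreal e'"
      using sets_lebesgue_outer_open[OF NL(1) e'(1)] .
    have "emeasure lborel T = emeasure lebesgue T" using T(1) by simp
    also have "\<dots> \<le> emeasure lebesgue (N \<union> (T - N))" using T NL by (intro emeasure_mono) auto
    also have "\<dots> \<le> emeasure lebesgue N + emeasure lebesgue (T - N)"
      using T NL by (intro emeasure_subadditive) auto
    finally have eT: "emeasure lborel T \<le> ennreal e'" using T(4) NL(2) by simp
    have "emeasure ?H E * ennreal r \<le> ennreal c * emeasure lborel T"
      unfolding c_def using T(2) layer by (intro chart_emeasure_le[OF chart E T(1)]) blast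
    also have "\<dots> \<le> ennreal c * ennreal e'" by (intro mult_left_mono eT) simp
    also have "\<dots> \<le> ennreal e" using c e' by (simp add: ennreal_mult[symmetric] ennreal_leI)
    finally show ?thesis .
  qed
  have "emeasure ?H E * ennreal r \<le> 0"
  proof (rule ennreal_le_epsilon)
    fix e :: real assume "0 < e"
    then show "emeasure ?H E * ennreal r \<le> 0 + ennreal e" using le[of e] by simp
  qed
  then show ?thesis using r by simp
qed

lemma continuous_L2_S:
  fixes f :: "real^'n \<Rightarrow> real"
  assumes "continuous_on UNIV f"
  shows "f \<in> L2 S"
proof -
  obtain B where B: "\<And>x. x \<in> closure \<Omega> \<Longrightarrow> norm (f x) \<le> B"
    using continuous_imp_bounded_on_closure[OF assms] by blast
  have "AE x in S. norm (f x) \<le> B"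
  proof (rule AE_I2)
    fix x assume "x \<in> space S"
    then have "x \<in> closure \<Omega>" by (simp add: surface_on_def space_restrict_space frontier_def)
    then show "norm (f x) \<le> B" by (rule B)
  qed
  then show ?thesis
    using assms by (intro bounded_imp_L2[OF finite_S]) (auto intro: borel_measurable_surface borel_measurable_continuous_onI)
qed

section \<open>Traces\<close>

text \<open>
  For \<open>\<phi>\<close> smooth, \<open>vertical_majorant \<nu> r \<phi> z\<close> bounds \<open>\<bar>\<phi> x\<bar>\<close> at the boundary point \<open>x\<close> above \<open>z\<close>,
  and its integral over the whole space is controlled by the \<open>L1\<close> norms of \<open>\<phi>\<close> and its gradient.
\<close>

definition vertical_majorant :: "real^'n \<Rightarrow> real \<Rightarrow> (real^'n \<Rightarrow> real) \<Rightarrow> real^'n \<Rightarrow> ennreal" where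
  "vertical_majorant \<nu> r \<phi> z = ennreal (indicator \<Omega> z * \<bar>\<phi> z\<bar>) +
     (\<integral>\<^sup>+t. indicator {0..r} t * ennreal (indicator \<Omega> (z + t *\<^sub>R \<nu>) * \<bar>grad \<phi> (z + t *\<^sub>R \<nu>) \<bullet> \<nu>\<bar>) \<partial>lborel)"

context
  fixes \<phi> :: "real^'n \<Rightarrow> real" and \<nu> :: "real^'n" and r :: real
  assumes \<phi>: "smooth \<phi>" and r: "0 < r"
begin

lemma borel_measurable_slope [measurable]:
  "(\<lambda>z. indicator \<Omega> z * \<bar>grad \<phi> z \<bullet> \<nu>\<bar>) \<in> borel_measurable borel"
  "(\<lambda>z. indicator \<Omega> z * \<bar>\<phi> z\<bar>) \<in> borel_measurable borel"
proof -
  have [measurable]: "grad \<phi> \<in> borel_measurable borel" "\<phi> \<in> borel_measurable borel" "\<Omega> \<in> sets borel"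
    using \<phi> open_\<Omega> by (auto intro!: borel_measurable_continuous_onI smooth_continuous smooth_continuous_grad)
  show "(\<lambda>z. indicator \<Omega> z * \<bar>grad \<phi> z \<bullet> \<nu>\<bar>) \<in> borel_measurable borel"
    "(\<lambda>z. indicator \<Omega> z * \<bar>\<phi> z\<bar>) \<in> borel_measurable borel" by measurable
qed

lemma borel_measurable_slope_pair [measurable]:
  "(\<lambda>(z, t). indicator {0..r} t * ennreal (indicator \<Omega> (z + t *\<^sub>R \<nu>) * \<bar>grad \<phi> (z + t *\<^sub>R \<nu>) \<bullet> \<nu>\<bar>))
     \<in> borel_measurable (lborel \<Otimes>\<^sub>M lborel)"
proof -
  have "(\<lambda>p. indicator {0..r} (snd p) * ennreal ((\<lambda>z. indicator \<Omega> z * \<bar>grad \<phi> z \<bullet> \<nu>\<bar>) (fst p + snd p *\<^sub>R \<nu>)))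
     \<in> borel_measurable (lborel \<Otimes>\<^sub>M lborel)"
    by (intro borel_measurable_times_ennreal measurable_compose[OF _ measurable_ennreal]
        measurable_compose[OF _ borel_measurable_slope(1)]) measurable
  then show ?thesis by (simp add: case_prod_beta')
qed

lemma borel_measurable_vertical_majorant: "vertical_majorant \<nu> r \<phi> \<in> borel_measurable lborel"
  unfolding vertical_majorant_def
  by (intro borel_measurable_add lborel.borel_measurable_nn_integral borel_measurable_slope_pair) measurable

text \<open>
  By Tonelli's theorem and translation invariance, integrating the slopes over all starting points \<open>z\<close> gives the
  same value for each \<open>t\<close>.
\<close>

lemma nn_integral_vertical_majorant:
  "(\<integral>\<^sup>+z. vertical_majorant \<nu> r \<phi> z \<partial>lborel) =
    ennreal ((\<integral>z. \<bar>\<phi> z\<bar> \<partial>lebesgue_on \<Omega>) + r * (\<integral>z. \<bar>grad \<phi> z \<bullet> \<nu>\<bar> \<partial>lebesgue_on \<Omega>))"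
proof -
  have Ob: "\<Omega> \<in> sets lebesgue" using open_\<Omega> by simp
  have nn: "(\<integral>\<^sup>+z. ennreal (indicator \<Omega> z * \<bar>f z\<bar>) \<partial>lborel) = ennreal (\<integral>z. \<bar>f z\<bar> \<partial>lebesgue_on \<Omega>)"
    if f: "continuous_on UNIV f" for f :: "real^'n \<Rightarrow> real"
  proof -
    have i: "integrable (lebesgue_on \<Omega>) (\<lambda>z. \<bar>f z\<bar>)"
      using L2_integrable[OF finite_\<Omega> continuous_L2[OF f]] by simp
    have "(\<integral>\<^sup>+z. ennreal (indicator \<Omega> z * \<bar>f z\<bar>) \<partial>lborel) = (\<integral>\<^sup>+z. ennreal (indicator \<Omega> z * \<bar>f z\<bar>) \<partial>lebesgue)"
      by (rule nn_integral_completion[symmetric])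
    also have "\<dots> = (\<integral>\<^sup>+z. ennreal \<bar>f z\<bar> * indicator \<Omega> z \<partial>lebesgue)"
      by (intro nn_integral_cong) (simp add: indicator_def)
    also have "\<dots> = (\<integral>\<^sup>+z. ennreal \<bar>f z\<bar> \<partial>lebesgue_on \<Omega>)"
      using Ob by (subst nn_integral_restrict_space) auto
    also have "\<dots> = ennreal (\<integral>z. \<bar>f z\<bar> \<partial>lebesgue_on \<Omega>)"
      by (rule nn_integral_eq_integral[OF i]) simp
    finally show ?thesis .
  qed
  define D where "D z = indicator \<Omega> z * \<bar>grad \<phi> z \<bullet> \<nu>\<bar>" for z
  have cD: "continuous_on UNIV (\<lambda>z. grad \<phi> z \<bullet> \<nu>)"
    by (intro continuous_on_inner smooth_continuous_grad \<phi> continuous_on_const)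
  have Dm [measurable]: "D \<in> borel_measurable borel" unfolding D_def by (rule borel_measurable_slope)
  have shift: "(\<integral>\<^sup>+z. ennreal (D (z + c)) \<partial>lborel) = (\<integral>\<^sup>+z. ennreal (D z) \<partial>lborel)" for c
  proof -
    have "(\<integral>\<^sup>+z. ennreal (D z) \<partial>lborel) = (\<integral>\<^sup>+z. ennreal (D z) \<partial>distr lborel borel ((+) c))"
      by (simp add: lborel_distr_plus)
    also have "\<dots> = (\<integral>\<^sup>+z. ennreal (D (c + z)) \<partial>lborel)" by (subst nn_integral_distr) auto
    finally show ?thesis by (simp add: add.commute)
  qed
  have pm: "(\<lambda>(z, t). indicator {0..r} t * ennreal (D (z + t *\<^sub>R \<nu>))) \<in> borel_measurable (lborel \<Otimes>\<^sub>M lborel)"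
    using borel_measurable_slope_pair by (simp add: D_def)
  have "(\<integral>\<^sup>+z. (\<integral>\<^sup>+t. indicator {0..r} t * ennreal (D (z + t *\<^sub>R \<nu>)) \<partial>lborel) \<partial>lborel)
      = (\<integral>\<^sup>+t. (\<integral>\<^sup>+z. indicator {0..r} t * ennreal (D (z + t *\<^sub>R \<nu>)) \<partial>lborel) \<partial>lborel)"
    by (rule lborel_pair.Fubini'[symmetric, OF pm])
  also have "\<dots> = (\<integral>\<^sup>+t. (\<integral>\<^sup>+z. ennreal (D z) \<partial>lborel) * indicator {0..r} t \<partial>lborel)"
  proof (rule nn_integral_cong)
    fix t :: real
    have "(\<integral>\<^sup>+z. indicator {0..r} t * ennreal (D (z + t *\<^sub>R \<nu>)) \<partial>lborel)
        = indicator {0..r} t * (\<integral>\<^sup>+z. ennreal (D (z + t *\<^sub>R \<nu>)) \<partial>lborel)"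
      by (rule nn_integral_cmult) measurable
    then show "(\<integral>\<^sup>+z. indicator {0..r} t * ennreal (D (z + t *\<^sub>R \<nu>)) \<partial>lborel)
        = (\<integral>\<^sup>+z. ennreal (D z) \<partial>lborel) * indicator {0..r} t"
      by (simp add: shift mult.commute)
  qed
  also have "\<dots> = ennreal r * ennreal (\<integral>z. \<bar>grad \<phi> z \<bullet> \<nu>\<bar> \<partial>lebesgue_on \<Omega>)"
    using r by (subst nn_integral_cmult_indicator) (auto simp: nn[OF cD, folded D_def] mult.commute)
  finally have second: "(\<integral>\<^sup>+z. (\<integral>\<^sup>+t. indicator {0..r} t * ennreal (D (z + t *\<^sub>R \<nu>)) \<partial>lborel) \<partial>lborel)
      = ennreal (r * (\<integral>z. \<bar>grad \<phi> z \<bullet> \<nu>\<bar> \<partial>lebesgue_on \<Omega>))"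
    using r by (simp add: ennreal_mult)
  have "(\<integral>\<^sup>+z. vertical_majorant \<nu> r \<phi> z \<partial>lborel) =
      (\<integral>\<^sup>+z. ennreal (indicator \<Omega> z * \<bar>\<phi> z\<bar>) \<partial>lborel) +
      (\<integral>\<^sup>+z. (\<integral>\<^sup>+t. indicator {0..r} t * ennreal (D (z + t *\<^sub>R \<nu>)) \<partial>lborel) \<partial>lborel)"
    unfolding vertical_majorant_def D_def[symmetric]
    by (intro nn_integral_add lborel.borel_measurable_nn_integral pm) measurable
  then show ?thesis
    unfolding second nn[OF smooth_continuous[OF \<phi>]] using r by (simp add: ennreal_plus)
qed

lemma abs_le_vertical_majorant:
  assumes s: "0 < s" "s < r" and seg: "\<And>t. 0 < t \<Longrightarrow> t < r \<Longrightarrow> x - t *\<^sub>R \<nu> \<in> \<Omega>"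
  shows "ennreal \<bar>\<phi> x\<bar> \<le> vertical_majorant \<nu> r \<phi> (x - s *\<^sub>R \<nu>)"
proof -
  define z where "z = x - s *\<^sub>R \<nu>"
  define g where "g t = grad \<phi> (z + t *\<^sub>R \<nu>) \<bullet> \<nu>" for t
  have cg: "continuous_on A g" for A
    unfolding g_def
    by (intro continuous_intros continuous_on_compose2[OF smooth_continuous_grad[OF \<phi>, of UNIV]]) auto
  have cgi: "isCont g t" for t
    using cg[of UNIV] by (simp add: continuous_on_eq_continuous_at)
  have D: "((\<lambda>t. \<phi> (z + t *\<^sub>R \<nu>)) has_real_derivative g t) (at t)" for t
    using has_real_derivative_along[of \<phi> z t \<nu> UNIV] smooth_differentiable[OF \<phi>] by (simp add: g_def)
  have "(\<integral>t. g t * indicator {0..s} t \<partial>lborel) = \<phi> (z + s *\<^sub>R \<nu>) - \<phi> (z + 0 *\<^sub>R \<nu>)"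
    using s cgi D by (intro integral_FTC_Icc_real) auto
  then have eq: "\<phi> x = \<phi> z + (\<integral>t. g t * indicator {0..s} t \<partial>lborel)" by (simp add: z_def)
  have int: "integrable lborel (\<lambda>t. g t * indicator {0..s} t)"
    using borel_integrable_compact[OF compact_Icc cg, of 0 s] by (simp add: mult.commute)
  have "\<bar>\<integral>t. g t * indicator {0..s} t \<partial>lborel\<bar> \<le> (\<integral>t. \<bar>g t * indicator {0..s} t\<bar> \<partial>lborel)"
    by (rule integral_abs_bound)
  then have "ennreal \<bar>\<integral>t. g t * indicator {0..s} t \<partial>lborel\<bar> \<le> (\<integral>\<^sup>+t. ennreal \<bar>g t * indicator {0..s} t\<bar> \<partial>lborel)"
    using int by (subst nn_integral_eq_integral) (auto intro: ennreal_leI)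
  also have "\<dots> \<le> (\<integral>\<^sup>+t. indicator {0..r} t * ennreal (indicator \<Omega> (z + t *\<^sub>R \<nu>) * \<bar>grad \<phi> (z + t *\<^sub>R \<nu>) \<bullet> \<nu>\<bar>) \<partial>lborel)"
  proof (rule nn_integral_mono_AE)
    \<comment> \<open>For \<open>t = s\<close> the point \<open>z + t *\<^sub>R \<nu>\<close> is \<open>x\<close> itself, which lies on the boundary, outside \<open>\<Omega>\<close>.\<close>
    have "AE t in lborel. t \<noteq> s" by (rule AE_lborel_singleton)
    then show "AE t in lborel. ennreal \<bar>g t * indicator {0..s} t\<bar> \<le>
      indicator {0..r} t * ennreal (indicator \<Omega> (z + t *\<^sub>R \<nu>) * \<bar>grad \<phi> (z + t *\<^sub>R \<nu>) \<bullet> \<nu>\<bar>)"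
    proof eventually_elim
      case (elim t)
      show ?case
      proof (cases "0 \<le> t \<and> t \<le> s")
        case True
        then have "x - (s - t) *\<^sub>R \<nu> \<in> \<Omega>" using elim s by (intro seg) auto
        then have "z + t *\<^sub>R \<nu> \<in> \<Omega>" by (simp add: z_def algebra_simps)
        then show ?thesis using True s by (simp add: g_def)
      qed simp
    qed
  qed
  finally have le: "ennreal \<bar>\<integral>t. g t * indicator {0..s} t \<partial>lborel\<bar> \<le>
      (\<integral>\<^sup>+t. indicator {0..r} t * ennreal (indicator \<Omega> (z + t *\<^sub>R \<nu>) * \<bar>grad \<phi> (z + t *\<^sub>R \<nu>) \<bullet> \<nu>\<bar>) \<partial>lborel)" .
  have "z \<in> \<Omega>" using seg s by (simp add: z_def)
  have "ennreal \<bar>\<phi> x\<bar> \<le> ennreal (\<bar>\<phi> z\<bar> + \<bar>\<integral>t. g t * indicator {0..s} t \<partial>lborel\<bar>)"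
    by (intro ennreal_leI) (simp add: eq)
  also have "\<dots> = ennreal \<bar>\<phi> z\<bar> + ennreal \<bar>\<integral>t. g t * indicator {0..s} t \<partial>lborel\<bar>" by (simp add: ennreal_plus)
  also have "\<dots> \<le> vertical_majorant \<nu> r \<phi> z"
    unfolding vertical_majorant_def using le \<open>z \<in> \<Omega>\<close> by (intro add_mono) auto
  finally show ?thesis by (simp add: z_def)
qed

end

text \<open>
  The majorants tend to zero in \<open>L1\<close>, hence almost everywhere along a subsequence. If \<open>x\<close> belongs to
  the set \<open>E\<close> of boundary points where the subsequence does not tend to zero, then the majorants do not tend to
  zero at any point of the layer below \<open>x\<close>. So the layer of \<open>E\<close> is a null set, and so is \<open>E\<close>.
\<close>

lemma trace_of_zero_in_chart:
  fixes \<zeta> :: "nat \<Rightarrow> real^'n \<Rightarrow> real"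
  assumes chart: "boundary_chart \<Omega> x\<^sub>0 h C \<nu> r"
    and \<zeta>: "\<And>k. smooth (\<zeta> k)" and g: "g \<in> L2 S"
    and limO: "(\<lambda>k. L2_norm_sq (lebesgue_on \<Omega>) (\<zeta> k) + L2_norm_sq (lebesgue_on \<Omega>) (grad (\<zeta> k))) \<longlonglongrightarrow> 0"
    and limS: "(\<lambda>k. L2_norm_sq S (\<lambda>x. \<zeta> k x - g x)) \<longlonglongrightarrow> 0"
  shows "AE x in S. x \<in> ball x\<^sub>0 r \<longrightarrow> g x = 0"
proof -
  let ?H = "hausdorff_measure (CARD('n) - 1) :: (real^'n) measure"
  have r: "0 < r" using chart by (simp add: boundary_chart_def)
  have "(\<lambda>x. \<zeta> k x - g x) \<in> L2 S" for k
    using \<zeta> by (intro L2_diff continuous_L2_S smooth_continuous g)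
  then have "integrable S (\<lambda>x. (\<zeta> k x - g x)\<^sup>2)" for k using L2_D(2) by fastforce
  moreover have "(\<lambda>k. \<integral>x. norm ((\<zeta> k x - g x)\<^sup>2) \<partial>S) \<longlonglongrightarrow> 0"
    using limS by (simp add: L2_norm_sq_def)
  ultimately obtain r1 where r1: "strict_mono r1" "AE x in S. (\<lambda>n. (\<zeta> (r1 n) x - g x)\<^sup>2) \<longlonglongrightarrow> 0"
    using tendsto_L1_AE_subseq[of S "\<lambda>k x. (\<zeta> k x - g x)\<^sup>2"] by blast
  define \<phi> where "\<phi> n = \<zeta> (r1 n)" for n
  have \<phi>: "smooth (\<phi> n)" for n by (simp add: \<phi>_def \<zeta>)
  have lim\<phi>: "(\<lambda>n. L2_norm_sq (lebesgue_on \<Omega>) (\<phi> n) + L2_norm_sq (lebesgue_on \<Omega>) (grad (\<phi> n))) \<longlonglongrightarrow> 0"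
    using LIMSEQ_subseq_LIMSEQ[OF limO r1(1)] by (simp add: o_def \<phi>_def)
  have l0: "(\<lambda>n. L2_norm_sq (lebesgue_on \<Omega>) (\<phi> n)) \<longlonglongrightarrow> 0"
    by (rule tendsto_sandwich[OF _ _ tendsto_const lim\<phi>]) (auto simp: L2_norm_sq_nonneg)
  have l1: "(\<lambda>n. L2_norm_sq (lebesgue_on \<Omega>) (grad (\<phi> n))) \<longlonglongrightarrow> 0"
    by (rule tendsto_sandwich[OF _ _ tendsto_const lim\<phi>]) (auto simp: L2_norm_sq_nonneg)
  have cs: "continuous_on UNIV (\<lambda>x. grad (\<phi> n) x \<bullet> \<nu>)" for n
    by (intro continuous_on_inner smooth_continuous_grad \<phi> continuous_on_const)
  have l2: "(\<lambda>n. L2_norm_sq (lebesgue_on \<Omega>) (\<lambda>x. grad (\<phi> n) x \<bullet> \<nu>)) \<longlonglongrightarrow> 0"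
  proof (rule tendsto_sandwich[OF _ _ tendsto_const])
    show "\<forall>\<^sub>F n in sequentially. 0 \<le> L2_norm_sq (lebesgue_on \<Omega>) (\<lambda>x. grad (\<phi> n) x \<bullet> \<nu>)"
      by (simp add: L2_norm_sq_nonneg)
    have "L2_norm_sq (lebesgue_on \<Omega>) (\<lambda>x. grad (\<phi> n) x \<bullet> \<nu>) \<le> (norm \<nu>)\<^sup>2 * L2_norm_sq (lebesgue_on \<Omega>) (grad (\<phi> n))" for n
    proof -
      have "L2_norm_sq (lebesgue_on \<Omega>) (\<lambda>x. grad (\<phi> n) x \<bullet> \<nu>) \<le> (\<integral>x. (norm \<nu>)\<^sup>2 * (norm (grad (\<phi> n) x))\<^sup>2 \<partial>lebesgue_on \<Omega>)"
        unfolding L2_norm_sq_def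
      proof (rule integral_mono)
        show "integrable (lebesgue_on \<Omega>) (\<lambda>x. (norm (grad (\<phi> n) x \<bullet> \<nu>))\<^sup>2)"
          by (rule L2_D(2)[OF continuous_L2[OF cs]])
        show "integrable (lebesgue_on \<Omega>) (\<lambda>x. (norm \<nu>)\<^sup>2 * (norm (grad (\<phi> n) x))\<^sup>2)"
          using L2_D(2)[OF continuous_L2[OF smooth_continuous_grad[OF \<phi>[of n]]]] by simp
        fix x
        have "\<bar>grad (\<phi> n) x \<bullet> \<nu>\<bar> \<le> norm \<nu> * norm (grad (\<phi> n) x)"
          using Cauchy_Schwarz_ineq2[of "grad (\<phi> n) x" \<nu>] by (simp add: mult.commute)
        then have "(\<bar>grad (\<phi> n) x \<bullet> \<nu>\<bar>)\<^sup>2 \<le> (norm \<nu> * norm (grad (\<phi> n) x))\<^sup>2" by (rule power_mono) simp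
        then show "(norm (grad (\<phi> n) x \<bullet> \<nu>))\<^sup>2 \<le> (norm \<nu>)\<^sup>2 * (norm (grad (\<phi> n) x))\<^sup>2"
          by (simp add: power_mult_distrib)
      qed
      then show ?thesis by (simp add: L2_norm_sq_def)
    qed
    then show "\<forall>\<^sub>F n in sequentially. L2_norm_sq (lebesgue_on \<Omega>) (\<lambda>x. grad (\<phi> n) x \<bullet> \<nu>) \<le> (norm \<nu>)\<^sup>2 * L2_norm_sq (lebesgue_on \<Omega>) (grad (\<phi> n))"
      by simp
    show "(\<lambda>n. (norm \<nu>)\<^sup>2 * L2_norm_sq (lebesgue_on \<Omega>) (grad (\<phi> n))) \<longlonglongrightarrow> 0"
      using tendsto_mult_left[OF l1, of "(norm \<nu>)\<^sup>2"] by simp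
  qed
  define c where "c n = (\<integral>z. \<bar>\<phi> n z\<bar> \<partial>lebesgue_on \<Omega>) + r * (\<integral>z. \<bar>grad (\<phi> n) z \<bullet> \<nu>\<bar> \<partial>lebesgue_on \<Omega>)" for n
  have c0: "0 \<le> c n" for n unfolding c_def using r by (intro add_nonneg_nonneg mult_nonneg_nonneg) auto
  have clim: "c \<longlonglongrightarrow> 0"
  proof -
    have "c \<longlonglongrightarrow> 0 + r * 0"
      unfolding c_def
      by (intro tendsto_add tendsto_mult tendsto_const integral_abs_tendsto_0 finite_\<Omega> continuous_L2 cs smooth_continuous \<phi> l0 l2)
    then show ?thesis by simp
  qed
  define V where "V n = vertical_majorant \<nu> r (\<phi> n)" for n
  have V: "V n \<in> borel_measurable lborel" "(\<integral>\<^sup>+z. V n z \<partial>lborel) = ennreal (c n)" for n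
    unfolding V_def c_def by (rule borel_measurable_vertical_majorant[OF \<phi> r], rule nn_integral_vertical_majorant[OF \<phi> r])
  have Vfin: "AE z in lborel. V n z \<noteq> \<infinity>" for n
    using V(2)[of n] by (intro nn_integral_PInf_AE V(1)) simp
  define F where "F n z = enn2real (V n z)" for n z
  have hb: "has_bochner_integral lborel (F n) (c n)" for n
  proof (rule has_bochner_integral_nn_integral)
    show "F n \<in> borel_measurable lborel" unfolding F_def using V(1)[of n] by simp
    have "(\<integral>\<^sup>+z. ennreal (F n z) \<partial>lborel) = (\<integral>\<^sup>+z. V n z \<partial>lborel)"
      using Vfin[of n] by (intro nn_integral_cong_AE) (auto elim!: eventually_mono simp: F_def less_top)
    then show "(\<integral>\<^sup>+z. ennreal (F n z) \<partial>lborel) = ennreal (c n)" by (simp add: V(2))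
  qed (auto simp: F_def c0)
  have "(\<lambda>n. \<integral>z. norm (F n z) \<partial>lborel) \<longlonglongrightarrow> 0"
  proof -
    have "norm (F n z) = F n z" for n z by (simp add: F_def)
    then show ?thesis using clim by (simp add: has_bochner_integral_integral_eq[OF hb])
  qed
  then obtain r2 where r2: "strict_mono r2" "AE z in lborel. (\<lambda>n. F (r2 n) z) \<longlonglongrightarrow> 0"
    using tendsto_L1_AE_subseq[of lborel F] hb by (auto simp: has_bochner_integral_iff)
  have "AE z in lborel. \<forall>n. V n z \<noteq> \<infinity>" using Vfin by (simp add: AE_all_countable)
  with r2(2) have "AE z in lborel. (\<lambda>n. F (r2 n) z) \<longlonglongrightarrow> 0 \<and> (\<forall>n. V n z \<noteq> \<infinity>)" by eventually_elim simp
  then obtain N where N: "{z \<in> space lborel. \<not> ((\<lambda>n. F (r2 n) z) \<longlonglongrightarrow> 0 \<and> (\<forall>n. V n z \<noteq> \<infinity>))} \<subseteq> N"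
    "emeasure lborel N = 0" "N \<in> sets lborel" by (rule AE_E)
  define E where "E = {x. x \<in> frontier \<Omega> \<inter> ball x\<^sub>0 r \<and> \<not> (\<lambda>n. \<phi> (r2 n) x) \<longlonglongrightarrow> 0}"
  have Eb: "E \<in> sets borel"
  proof -
    have [measurable]: "\<phi> n \<in> borel_measurable borel" for n
      by (intro borel_measurable_continuous_onI smooth_continuous \<phi>)
    have [measurable]: "frontier \<Omega> \<inter> ball x\<^sub>0 r \<in> sets borel"
      by (intro sets.Int borel_closed borel_open) auto
    show ?thesis unfolding E_def by measurable
  qed
  have "emeasure ?H E = 0"
  proof (rule chart_null[OF chart])
    show "E \<subseteq> frontier \<Omega> \<inter> ball x\<^sub>0 r" by (auto simp: E_def)
    show "N \<in> null_sets lborel" using N by auto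
    fix x s assume x: "x \<in> E" and s: "0 < s" "s < r"
    show "x - s *\<^sub>R \<nu> \<in> N"
    proof (rule ccontr)
      define z where "z = x - s *\<^sub>R \<nu>"
      assume "x - s *\<^sub>R \<nu> \<notin> N"
      then have z: "(\<lambda>n. F (r2 n) z) \<longlonglongrightarrow> 0" "\<And>n. V n z \<noteq> \<infinity>" using N(1) by (auto simp: z_def)
      have seg: "x - t *\<^sub>R \<nu> \<in> \<Omega>" if "0 < t" "t < r" for t
        using x chart that by (auto simp: E_def boundary_chart_def)
      have "\<bar>\<phi> n x\<bar> \<le> F n z" for n
      proof -
        have "ennreal \<bar>\<phi> n x\<bar> \<le> V n z"
          unfolding V_def z_def by (rule abs_le_vertical_majorant[OF \<phi> r s seg])
        also have "\<dots> = ennreal (F n z)" using z(2)[of n] by (simp add: F_def less_top)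
        finally show ?thesis by (simp add: F_def)
      qed
      then have "(\<lambda>n. \<phi> (r2 n) x) \<longlonglongrightarrow> 0"
        by (intro tendsto_rabs_zero_cancel[OF tendsto_sandwich[OF _ _ tendsto_const z(1)]]) auto
      then show False using x by (simp add: E_def)
    qed
  qed
  then have "E \<in> null_sets ?H" using Eb by auto
  then have "AE x in ?H. x \<notin> E" by (rule AE_not_in)
  then have "AE x in S. x \<notin> E" by (subst AE_surface_iff) (auto elim: eventually_mono)
  moreover have "AE x in S. x \<in> frontier \<Omega>"
    by (intro AE_I2) (simp add: surface_on_def space_restrict_space)
  ultimately show ?thesis
    using r1(2)
  proof eventually_elim
    case (elim x)
    show ?case
    proof
      assume "x \<in> ball x\<^sub>0 r"
      then have l: "(\<lambda>n. \<phi> (r2 n) x) \<longlonglongrightarrow> 0" using elim by (simp add: E_def)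
      have "(\<lambda>n. (\<phi> (r2 n) x - g x)\<^sup>2) \<longlonglongrightarrow> 0"
        using LIMSEQ_subseq_LIMSEQ[OF elim(3) r2(1)] by (simp add: o_def \<phi>_def)
      moreover have "(\<lambda>n. (\<phi> (r2 n) x - g x)\<^sup>2) \<longlonglongrightarrow> (0 - g x)\<^sup>2"
        by (intro tendsto_intros l)
      ultimately have "(0 - g x)\<^sup>2 = 0" using LIMSEQ_unique by blast
      then show "g x = 0" by simp
    qed
  qed
qed

lemma trace_of_zero:
  fixes \<zeta> :: "nat \<Rightarrow> real^'n \<Rightarrow> real"
  assumes "\<And>k. smooth (\<zeta> k)" "g \<in> L2 S"
    "(\<lambda>k. L2_norm_sq (lebesgue_on \<Omega>) (\<zeta> k) + L2_norm_sq (lebesgue_on \<Omega>) (grad (\<zeta> k))) \<longlonglongrightarrow> 0"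
    "(\<lambda>k. L2_norm_sq S (\<lambda>x. \<zeta> k x - g x)) \<longlonglongrightarrow> 0"
  shows "AE x in S. g x = 0"
proof -
  obtain F where F: "finite F" "\<And>B. B \<in> F \<Longrightarrow> \<exists>x\<^sub>0 h C \<nu> r. boundary_chart \<Omega> x\<^sub>0 h C \<nu> r \<and> B = ball x\<^sub>0 r"
    "frontier \<Omega> \<subseteq> \<Union>F" by (rule frontier_chart_cover) blast
  have "AE x in S. \<forall>B\<in>F. x \<in> B \<longrightarrow> g x = 0"
    using F(2) trace_of_zero_in_chart[OF _ assms] by (intro AE_finite_allI F(1)) blast
  moreover have "AE x in S. x \<in> frontier \<Omega>"
    by (intro AE_I2) (simp add: surface_on_def space_restrict_space)
  ultimately show ?thesis
  proof eventually_elim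
    case (elim x)
    then obtain B where "B \<in> F" "x \<in> B" using F(3) by (meson UnionE subsetD)
    then show ?case using elim by blast
  qed
qed

lemma has_trace_D:
  assumes "has_trace \<Omega> w g"
  shows "w \<in> H1 \<Omega>" "g \<in> L2 S"
  using assms by (simp_all add: has_trace_def)

lemma has_traceE:
  assumes "has_trace \<Omega> w g"
  obtains \<phi> where "\<And>k. smooth (\<phi> k)"
    "(\<lambda>k. L2_norm_sq (lebesgue_on \<Omega>) (\<lambda>x. \<phi> k x - w x)
       + L2_norm_sq (lebesgue_on \<Omega>) (\<lambda>x. grad (\<phi> k) x - weak_grad \<Omega> w x)) \<longlonglongrightarrow> 0"
    "(\<lambda>k. L2_norm_sq S (\<lambda>x. \<phi> k x - g x)) \<longlonglongrightarrow> 0"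
  using assms unfolding has_trace_def by blast

lemma tendsto_L2_norm_sq_lincomb:
  fixes u v :: "nat \<Rightarrow> 'x \<Rightarrow> 'y::euclidean_space"
  assumes "\<And>k. u k \<in> L2 M" "\<And>k. v k \<in> L2 M"
    "(\<lambda>k. L2_norm_sq M (u k)) \<longlonglongrightarrow> 0" "(\<lambda>k. L2_norm_sq M (v k)) \<longlonglongrightarrow> 0"
  shows "(\<lambda>k. L2_norm_sq M (\<lambda>x. u k x + c *\<^sub>R v k x)) \<longlonglongrightarrow> 0"
proof (rule tendsto_sandwich[OF _ _ tendsto_const])
  show "(\<lambda>k. 2 * L2_norm_sq M (u k) + 2 * c\<^sup>2 * L2_norm_sq M (v k)) \<longlonglongrightarrow> 0"
    using tendsto_add[OF tendsto_mult_left[OF assms(3), of 2] tendsto_mult_left[OF assms(4), of "2 * c\<^sup>2"]] by simp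
qed (auto simp: L2_norm_sq_nonneg intro!: always_eventually L2_norm_sq_lincomb_le assms)

lemma has_trace_approx_L2:
  assumes "has_trace \<Omega> w g" "smooth \<phi>"
  shows "(\<lambda>x. \<phi> x - w x) \<in> L2 (lebesgue_on \<Omega>)" "(\<lambda>x. grad \<phi> x - weak_grad \<Omega> w x) \<in> L2 (lebesgue_on \<Omega>)"
    "(\<lambda>x. \<phi> x - g x) \<in> L2 S"
  by (intro L2_diff continuous_L2[OF smooth_continuous] H1_L2 has_trace_D(1)[OF assms(1)] assms(2),
      intro L2_diff continuous_L2[OF smooth_continuous_grad] weak_grad_L2 has_trace_D(1)[OF assms(1)] assms(2),
      intro L2_diff continuous_L2_S[OF smooth_continuous] has_trace_D(2)[OF assms(1)] assms(2))

text \<open>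
  Linear combinations of approximating sequences approximate. The gradients are compared with the linear combination
  of the chosen weak gradients, so that for \<open>w\<^sub>1 = w\<^sub>2\<close> and \<open>c = -1\<close> the limit is exactly zero.
\<close>

lemma has_trace_approx_lincomb:
  assumes t: "has_trace \<Omega> w\<^sub>1 g\<^sub>1" "has_trace \<Omega> w\<^sub>2 g\<^sub>2"
  obtains \<phi> where "\<And>k. smooth (\<phi> k)"
    "(\<lambda>k. L2_norm_sq (lebesgue_on \<Omega>) (\<lambda>x. \<phi> k x - (w\<^sub>1 x + c * w\<^sub>2 x))
      + L2_norm_sq (lebesgue_on \<Omega>) (\<lambda>x. grad (\<phi> k) x - (weak_grad \<Omega> w\<^sub>1 x + c *\<^sub>R weak_grad \<Omega> w\<^sub>2 x))) \<longlonglongrightarrow> 0"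
    "(\<lambda>k. L2_norm_sq S (\<lambda>x. \<phi> k x - (g\<^sub>1 x + c * g\<^sub>2 x))) \<longlonglongrightarrow> 0"
proof -
  obtain \<phi> where \<phi>: "\<And>k. smooth (\<phi> k)"
    "(\<lambda>k. L2_norm_sq (lebesgue_on \<Omega>) (\<lambda>x. \<phi> k x - w\<^sub>1 x)
       + L2_norm_sq (lebesgue_on \<Omega>) (\<lambda>x. grad (\<phi> k) x - weak_grad \<Omega> w\<^sub>1 x)) \<longlonglongrightarrow> 0"
    "(\<lambda>k. L2_norm_sq S (\<lambda>x. \<phi> k x - g\<^sub>1 x)) \<longlonglongrightarrow> 0" by (rule has_traceE[OF t(1)]) blast
  obtain \<psi> where \<psi>: "\<And>k. smooth (\<psi> k)"
    "(\<lambda>k. L2_norm_sq (lebesgue_on \<Omega>) (\<lambda>x. \<psi> k x - w\<^sub>2 x)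
       + L2_norm_sq (lebesgue_on \<Omega>) (\<lambda>x. grad (\<psi> k) x - weak_grad \<Omega> w\<^sub>2 x)) \<longlonglongrightarrow> 0"
    "(\<lambda>k. L2_norm_sq S (\<lambda>x. \<psi> k x - g\<^sub>2 x)) \<longlonglongrightarrow> 0" by (rule has_traceE[OF t(2)]) blast
  have split: "a \<longlonglongrightarrow> 0" "b \<longlonglongrightarrow> 0" if "(\<lambda>k. a k + b k) \<longlonglongrightarrow> 0" "\<And>k. 0 \<le> a k" "\<And>k. 0 \<le> b k"
    for a b :: "nat \<Rightarrow> real"
    by (rule tendsto_sandwich[OF _ _ tendsto_const that(1)]; use that in simp)+
  note \<phi>s = split[OF \<phi>(2) L2_norm_sq_nonneg L2_norm_sq_nonneg]
  note \<psi>s = split[OF \<psi>(2) L2_norm_sq_nonneg L2_norm_sq_nonneg]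
  note A\<phi> = has_trace_approx_L2[OF t(1) \<phi>(1)] and A\<psi> = has_trace_approx_L2[OF t(2) \<psi>(1)]
  define \<theta> where "\<theta> k x = \<phi> k x + c * \<psi> k x" for k x
  have g\<theta>: "grad (\<theta> k) x = grad (\<phi> k) x + c *\<^sub>R grad (\<psi> k) x" for k x
    unfolding \<theta>_def by (rule grad_lincomb[OF \<phi>(1) \<psi>(1)])
  show thesis
  proof
    show "smooth (\<theta> k)" for k unfolding \<theta>_def by (intro smooth_lincomb \<phi> \<psi>)
    have e1: "(\<lambda>x. \<theta> k x - (w\<^sub>1 x + c * w\<^sub>2 x)) = (\<lambda>x. (\<phi> k x - w\<^sub>1 x) + c *\<^sub>R (\<psi> k x - w\<^sub>2 x))" for k
      by (simp add: \<theta>_def fun_eq_iff algebra_simps)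
    have e2: "(\<lambda>x. grad (\<theta> k) x - (weak_grad \<Omega> w\<^sub>1 x + c *\<^sub>R weak_grad \<Omega> w\<^sub>2 x)) =
        (\<lambda>x. (grad (\<phi> k) x - weak_grad \<Omega> w\<^sub>1 x) + c *\<^sub>R (grad (\<psi> k) x - weak_grad \<Omega> w\<^sub>2 x))" for k
      by (simp add: g\<theta> fun_eq_iff algebra_simps)
    have e3: "(\<lambda>x. \<theta> k x - (g\<^sub>1 x + c * g\<^sub>2 x)) = (\<lambda>x. (\<phi> k x - g\<^sub>1 x) + c *\<^sub>R (\<psi> k x - g\<^sub>2 x))" for k
      by (simp add: \<theta>_def fun_eq_iff algebra_simps)
    show "(\<lambda>k. L2_norm_sq (lebesgue_on \<Omega>) (\<lambda>x. \<theta> k x - (w\<^sub>1 x + c * w\<^sub>2 x))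
      + L2_norm_sq (lebesgue_on \<Omega>) (\<lambda>x. grad (\<theta> k) x - (weak_grad \<Omega> w\<^sub>1 x + c *\<^sub>R weak_grad \<Omega> w\<^sub>2 x))) \<longlonglongrightarrow> 0"
      unfolding e1 e2
      by (intro tendsto_add_zero tendsto_L2_norm_sq_lincomb A\<phi> A\<psi> \<phi>s \<psi>s)
    show "(\<lambda>k. L2_norm_sq S (\<lambda>x. \<theta> k x - (g\<^sub>1 x + c * g\<^sub>2 x))) \<longlonglongrightarrow> 0"
      unfolding e3 by (intro tendsto_L2_norm_sq_lincomb A\<phi> A\<psi> \<phi>(3) \<psi>(3))
  qed
qed

text \<open>
  The difference of two sequences that approximate \<open>w\<close> tends to zero in the interior, and its boundary values
  tend to \<open>g\<^sub>1 - g\<^sub>2\<close>.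
\<close>

lemma has_trace_unique:
  assumes t: "has_trace \<Omega> w g\<^sub>1" "has_trace \<Omega> w g\<^sub>2"
  shows "AE x in S. g\<^sub>1 x = g\<^sub>2 x"
proof -
  obtain \<phi> where \<phi>: "\<And>k. smooth (\<phi> k)"
    "(\<lambda>k. L2_norm_sq (lebesgue_on \<Omega>) (\<lambda>x. \<phi> k x - (w x + (-1) * w x))
      + L2_norm_sq (lebesgue_on \<Omega>) (\<lambda>x. grad (\<phi> k) x - (weak_grad \<Omega> w x + (-1) *\<^sub>R weak_grad \<Omega> w x))) \<longlonglongrightarrow> 0"
    "(\<lambda>k. L2_norm_sq S (\<lambda>x. \<phi> k x - (g\<^sub>1 x + (-1) * g\<^sub>2 x))) \<longlonglongrightarrow> 0"
    by (rule has_trace_approx_lincomb[OF t, of "-1"]) blast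
  have "AE x in S. g\<^sub>1 x + (-1) * g\<^sub>2 x = 0"
    by (rule trace_of_zero[OF \<phi>(1) L2_lincomb_real[OF has_trace_D(2)[OF t(1)] has_trace_D(2)[OF t(2)]] _ \<phi>(3)])
      (use \<phi>(2) in simp)
  then show ?thesis by simp
qed

lemma has_trace_lincomb:
  assumes t: "has_trace \<Omega> w\<^sub>1 g\<^sub>1" "has_trace \<Omega> w\<^sub>2 g\<^sub>2"
  shows "has_trace \<Omega> (\<lambda>x. w\<^sub>1 x + c * w\<^sub>2 x) (\<lambda>x. g\<^sub>1 x + c * g\<^sub>2 x)"
proof -
  note H = has_trace_D[OF t(1)] has_trace_D[OF t(2)]
  obtain \<phi> where \<phi>: "\<And>k. smooth (\<phi> k)"
    "(\<lambda>k. L2_norm_sq (lebesgue_on \<Omega>) (\<lambda>x. \<phi> k x - (w\<^sub>1 x + c * w\<^sub>2 x))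
      + L2_norm_sq (lebesgue_on \<Omega>) (\<lambda>x. grad (\<phi> k) x - (weak_grad \<Omega> w\<^sub>1 x + c *\<^sub>R weak_grad \<Omega> w\<^sub>2 x))) \<longlonglongrightarrow> 0"
    "(\<lambda>k. L2_norm_sq S (\<lambda>x. \<phi> k x - (g\<^sub>1 x + c * g\<^sub>2 x))) \<longlonglongrightarrow> 0"
    by (rule has_trace_approx_lincomb[OF t]) blast
  have "L2_norm_sq (lebesgue_on \<Omega>) (\<lambda>x. grad (\<phi> k) x - weak_grad \<Omega> (\<lambda>x. w\<^sub>1 x + c * w\<^sub>2 x) x) =
      L2_norm_sq (lebesgue_on \<Omega>) (\<lambda>x. grad (\<phi> k) x - (weak_grad \<Omega> w\<^sub>1 x + c *\<^sub>R weak_grad \<Omega> w\<^sub>2 x))" for k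
  proof -
    have [measurable]: "weak_grad \<Omega> (\<lambda>x. w\<^sub>1 x + c * w\<^sub>2 x) \<in> borel_measurable (lebesgue_on \<Omega>)"
      "weak_grad \<Omega> w\<^sub>1 \<in> borel_measurable (lebesgue_on \<Omega>)" "weak_grad \<Omega> w\<^sub>2 \<in> borel_measurable (lebesgue_on \<Omega>)"
      "grad (\<phi> k) \<in> borel_measurable (lebesgue_on \<Omega>)"
      by (rule L2_D(1), intro weak_grad_L2 H1_lincomb H continuous_L2[OF smooth_continuous_grad] \<phi>)+
    show ?thesis
      unfolding L2_norm_sq_def using weak_grad_lincomb[OF H(1) H(3), of c]
      by (intro integral_cong_AE) (auto elim!: eventually_mono)
  qed
  then show ?thesis
    unfolding has_trace_def using \<phi> H by (auto intro!: H1_lincomb L2_lincomb_real exI[of _ \<phi>])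
qed

lemma has_trace_cong:
  assumes t: "has_trace \<Omega> w g" and g': "g' \<in> borel_measurable S" "AE x in S. g x = g' x"
  shows "has_trace \<Omega> w g'"
proof -
  note H = has_trace_D[OF t]
  have g'L2: "g' \<in> L2 S" using g' by (intro L2_bound[OF H(2), of _ 1]) (auto elim!: eventually_mono)
  obtain \<phi> where \<phi>: "\<And>k. smooth (\<phi> k)"
    "(\<lambda>k. L2_norm_sq (lebesgue_on \<Omega>) (\<lambda>x. \<phi> k x - w x)
       + L2_norm_sq (lebesgue_on \<Omega>) (\<lambda>x. grad (\<phi> k) x - weak_grad \<Omega> w x)) \<longlonglongrightarrow> 0"
    "(\<lambda>k. L2_norm_sq S (\<lambda>x. \<phi> k x - g x)) \<longlonglongrightarrow> 0" by (rule has_traceE[OF t]) blast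
  have "L2_norm_sq S (\<lambda>x. \<phi> k x - g' x) = L2_norm_sq S (\<lambda>x. \<phi> k x - g x)" for k
  proof -
    have [measurable]: "\<phi> k \<in> borel_measurable S" "g \<in> borel_measurable S" "g' \<in> borel_measurable S"
      using H g' by (auto intro!: L2_D(1) continuous_L2_S smooth_continuous \<phi>)
    show ?thesis
      unfolding L2_norm_sq_def using g'(2) by (intro integral_cong_AE) (auto elim!: eventually_mono)
  qed
  then show ?thesis unfolding has_trace_def using \<phi> H(1) g'L2 by (auto intro!: exI[of _ \<phi>])
qed

lemma has_trace_smooth:
  assumes "smooth \<phi>" shows "has_trace \<Omega> \<phi> \<phi>"
proof -
  have [measurable]: "weak_grad \<Omega> \<phi> \<in> borel_measurable (lebesgue_on \<Omega>)" "grad \<phi> \<in> borel_measurable (lebesgue_on \<Omega>)"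
    by (rule L2_D(1), intro weak_grad_L2 smooth_H1(1) continuous_L2[OF smooth_continuous_grad] assms)+
  have "L2_norm_sq (lebesgue_on \<Omega>) (\<lambda>x. grad \<phi> x - weak_grad \<Omega> \<phi> x) = (\<integral>x. 0 \<partial>lebesgue_on \<Omega>)"
    unfolding L2_norm_sq_def using smooth_H1(2)[OF assms]
    by (intro integral_cong_AE) (auto elim!: eventually_mono)
  then show ?thesis
    unfolding has_trace_def using assms
    by (auto intro!: smooth_H1 continuous_L2_S smooth_continuous exI[of _ "\<lambda>_. \<phi>"] simp: L2_norm_sq_def)
qed

lemma has_trace_trace_op:
  assumes "has_trace \<Omega> w g"
  shows "has_trace \<Omega> w (trace_op \<Omega> w)" "AE x in S. trace_op \<Omega> w x = g x"
proof -
  show "has_trace \<Omega> w (trace_op \<Omega> w)" unfolding trace_op_def by (rule someI[of _ g]) (rule assms)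
  then show "AE x in S. trace_op \<Omega> w x = g x" by (rule has_trace_unique[OF _ assms])
qed

end

section \<open>The Hahn-Banach theorem for spaces of functions\<close>

locale function_space =
  fixes X :: "('a \<Rightarrow> real) set"
  assumes zero_mem: "(\<lambda>s. 0) \<in> X"
    and lincomb_mem: "x \<in> X \<Longrightarrow> y \<in> X \<Longrightarrow> (\<lambda>s. x s + c * y s) \<in> X"
begin

lemma add_mem: "x \<in> X \<Longrightarrow> y \<in> X \<Longrightarrow> (\<lambda>s. x s + y s) \<in> X"
  using lincomb_mem[of x y 1] by simp

lemma scale_mem: "x \<in> X \<Longrightarrow> (\<lambda>s. c * x s) \<in> X"
  using lincomb_mem[OF zero_mem, of x c] by simp

lemma minus_mem: "x \<in> X \<Longrightarrow> (\<lambda>s. - x s) \<in> X"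
  using scale_mem[of x "-1"] by simp

lemma diff_mem: "x \<in> X \<Longrightarrow> y \<in> X \<Longrightarrow> (\<lambda>s. x s - y s) \<in> X"
  using lincomb_mem[of x y "-1"] by simp

definition sublinear :: "(('a \<Rightarrow> real) \<Rightarrow> real) \<Rightarrow> bool" where
  "sublinear q \<longleftrightarrow> (\<forall>x\<in>X. \<forall>y\<in>X. q (\<lambda>s. x s + y s) \<le> q x + q y) \<and>
     (\<forall>x\<in>X. \<forall>c>0. q (\<lambda>s. c * x s) \<le> c * q x)"

lemma sublinear_add: "sublinear q \<Longrightarrow> x \<in> X \<Longrightarrow> y \<in> X \<Longrightarrow> q (\<lambda>s. x s + y s) \<le> q x + q y"
  by (simp add: sublinear_def)

lemma sublinear_scale:
  assumes q: "sublinear q" and x: "x \<in> X" and c: "0 < c"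
  shows "q (\<lambda>s. c * x s) = c * q x"
proof (rule antisym)
  show "q (\<lambda>s. c * x s) \<le> c * q x" using assms by (simp add: sublinear_def)
  have "q (\<lambda>s. (1/c) * (c * x s)) \<le> (1/c) * q (\<lambda>s. c * x s)"
    using q scale_mem[OF x, of c] c unfolding sublinear_def by (metis zero_less_divide_1_iff)
  then show "c * q x \<le> q (\<lambda>s. c * x s)" using c by (simp add: field_simps)
qed

lemma sublinear_zero: "sublinear q \<Longrightarrow> q (\<lambda>s. 0) = 0"
  using sublinear_scale[OF _ zero_mem, of q 2] by simp

lemma sublinear_lower: "sublinear q \<Longrightarrow> x \<in> X \<Longrightarrow> - q (\<lambda>s. - x s) \<le> q x"
proof -
  assume q: "sublinear q" and x: "x \<in> X"
  have "q (\<lambda>s. x s + - x s) \<le> q x + q (\<lambda>s. - x s)"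
    by (rule sublinear_add[OF q x minus_mem[OF x]])
  then show ?thesis using sublinear_zero[OF q] by simp
qed

text \<open>
  The common form of the three infima below: over a chain of sublinear functionals, over the shifts along a fixed
  direction, and over the subspace from which a functional is extended.
\<close>

lemma sublinear_INF:
  fixes F :: "'i \<Rightarrow> ('a \<Rightarrow> real) \<Rightarrow> real"
  assumes ne: "I \<noteq> {}" and bdd: "\<And>x. x \<in> X \<Longrightarrow> bdd_below ((\<lambda>i. F i x) ` I)"
    and add: "\<And>i j x y. i \<in> I \<Longrightarrow> j \<in> I \<Longrightarrow> x \<in> X \<Longrightarrow> y \<in> X \<Longrightarrow> \<exists>k\<in>I. F k (\<lambda>s. x s + y s) \<le> F i x + F j y"
    and scale: "\<And>i x c. i \<in> I \<Longrightarrow> x \<in> X \<Longrightarrow> 0 < c \<Longrightarrow> \<exists>k\<in>I. F k (\<lambda>s. c * x s) \<le> c * F i x"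
  shows "sublinear (\<lambda>x. INF i\<in>I. F i x)"
proof -
  let ?q = "\<lambda>x. INF i\<in>I. F i x"
  have lower: "?q x \<le> F i x" if "i \<in> I" "x \<in> X" for i x
    using that by (intro cINF_lower bdd)
  have "?q (\<lambda>s. x s + y s) \<le> ?q x + ?q y" if x: "x \<in> X" and y: "y \<in> X" for x y
  proof -
    have ij: "?q (\<lambda>s. x s + y s) \<le> F i x + F j y" if "i \<in> I" "j \<in> I" for i j
      using add[OF that x y] lower[OF _ add_mem[OF x y]] by (meson order_trans)
    have "?q (\<lambda>s. x s + y s) - F j y \<le> ?q x" if "j \<in> I" for j
      using ne ij[OF _ that] by (intro cINF_greatest) (auto simp: algebra_simps)
    then have "?q (\<lambda>s. x s + y s) - ?q x \<le> ?q y"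
      using ne by (intro cINF_greatest) (auto simp: algebra_simps)
    then show ?thesis by simp
  qed
  moreover have "?q (\<lambda>s. c * x s) \<le> c * ?q x" if x: "x \<in> X" and c: "0 < c" for x c
  proof -
    have "?q (\<lambda>s. c * x s) / c \<le> ?q x"
    proof (rule cINF_greatest[OF ne])
      fix i assume "i \<in> I"
      then have "?q (\<lambda>s. c * x s) \<le> c * F i x"
        using scale[OF _ x c] lower[OF _ scale_mem[OF x]] by (meson order_trans)
      then show "?q (\<lambda>s. c * x s) / c \<le> F i x" using c by (simp add: field_simps)
    qed
    then show ?thesis using c by (simp add: field_simps)
  qed
  ultimately show ?thesis by (simp add: sublinear_def)
qed

text \<open>
  Zorn's lemma. Chains have a lower bound because \<open>- m (- x)\<close> bounds every sublinear functional below \<open>m\<close>.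
  Functionals are set to zero outside \<open>X\<close> to make the pointwise order antisymmetric.
\<close>

lemma ex_minimal_sublinear:
  assumes m: "sublinear m"
  shows "\<exists>q. sublinear q \<and> (\<forall>x\<in>X. q x \<le> m x) \<and>
    (\<forall>q'. sublinear q' \<longrightarrow> (\<forall>x\<in>X. q' x \<le> q x) \<longrightarrow> (\<forall>x\<in>X. q' x = q x))"
proof -
  define A where "A = {q. sublinear q \<and> (\<forall>x\<in>X. q x \<le> m x) \<and> (\<forall>x. x \<notin> X \<longrightarrow> q x = 0)}"
  define P where "P q q' \<longleftrightarrow> (\<forall>x. q' x \<le> q x)" for q q' :: "('a \<Rightarrow> real) \<Rightarrow> real"
  have trunc: "sublinear (\<lambda>x. if x \<in> X then q x else 0)" if "sublinear q" for q
    using that by (auto simp: sublinear_def add_mem scale_mem)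
  have po: "partial_order_on A (relation_of P A)"
    by (rule partial_order_on_relation_ofI) (auto simp: P_def fun_eq_iff intro: order_trans antisym)
  have "\<exists>q\<in>A. \<forall>q'\<in>A. P q q' \<longrightarrow> q' = q"
  proof (rule predicate_Zorn[OF po])
    fix C assume "C \<in> Chains (relation_of P A)"
    then have C: "C \<subseteq> A" "\<And>a b. a \<in> C \<Longrightarrow> b \<in> C \<Longrightarrow> P a b \<or> P b a"
      unfolding Chains_def relation_of_def by auto
    show "\<exists>u\<in>A. \<forall>a\<in>C. P a u"
    proof (cases "C = {}")
      case True
      have "(\<lambda>x. if x \<in> X then m x else 0) \<in> A" using trunc[OF m] by (simp add: A_def)
      then show ?thesis using True by blast
    next
      case False
      have bdd: "bdd_below ((\<lambda>q. q x) ` C)" if x: "x \<in> X" for x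
      proof (rule bdd_belowI2)
        fix q assume "q \<in> C"
        then have q: "sublinear q" "q (\<lambda>s. - x s) \<le> m (\<lambda>s. - x s)"
          using C(1) minus_mem[OF x] by (auto simp: A_def)
        then show "- m (\<lambda>s. - x s) \<le> q x" using sublinear_lower[OF q(1) x] by linarith
      qed
      have "sublinear (\<lambda>x. INF q\<in>C. q x)"
      proof (rule sublinear_INF[OF False bdd])
        fix i j x y assume ij: "i \<in> C" "j \<in> C" and xy: "x \<in> X" "y \<in> X"
        have sub: "sublinear i" "sublinear j" using ij C(1) by (auto simp: A_def)
        show "\<exists>k\<in>C. k (\<lambda>s. x s + y s) \<le> i x + j y"
        proof (cases "P i j")
          case True
          have "j (\<lambda>s. x s + y s) \<le> j x + j y" using sub xy by (simp add: sublinear_def)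
          then show ?thesis using True ij(2) unfolding P_def by (intro bexI[of _ j]) (auto intro: order_trans add_right_mono)
        next
          case False
          then have "P j i" using C(2) ij by blast
          have "i (\<lambda>s. x s + y s) \<le> i x + i y" using sub xy by (simp add: sublinear_def)
          then show ?thesis using \<open>P j i\<close> ij(1) unfolding P_def by (intro bexI[of _ i]) (auto intro: order_trans add_left_mono)
        qed
      next
        fix i x c assume "i \<in> C" "x \<in> X" "0 < (c::real)"
        then show "\<exists>k\<in>C. k (\<lambda>s. c * x s) \<le> c * i x"
          using C(1) by (intro bexI[of _ i]) (auto simp: A_def sublinear_def)
      qed
      then have sub: "sublinear (\<lambda>x. if x \<in> X then INF q\<in>C. q x else 0)" by (rule trunc)
      have low: "(INF q\<in>C. q x) \<le> q x" if "q \<in> C" "x \<in> X" for q x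
        using that by (intro cINF_lower bdd)
      obtain q0 where q0: "q0 \<in> C" using False by blast
      have "(\<lambda>x. if x \<in> X then INF q\<in>C. q x else 0) \<in> A"
        using sub low[OF q0] q0 C(1) by (auto simp: A_def intro: order_trans)
      moreover have "P q (\<lambda>x. if x \<in> X then INF q\<in>C. q x else 0)" if "q \<in> C" for q
        using that C(1) low by (auto simp: P_def A_def)
      ultimately show ?thesis by blast
    qed
  qed
  then obtain q where q: "q \<in> A" "\<And>q'. q' \<in> A \<Longrightarrow> P q q' \<Longrightarrow> q' = q" by blast
  have "\<forall>x\<in>X. q' x = q x" if q': "sublinear q'" "\<forall>x\<in>X. q' x \<le> q x" for q'
  proof -
    define q'' where "q'' = (\<lambda>x. if x \<in> X then q' x else 0)"
    have "q'' \<in> A" using q(1) q' trunc[OF q'(1)] by (auto simp: A_def q''_def intro: order_trans)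
    moreover have "P q q''" using q(1) q'(2) by (auto simp: P_def q''_def A_def)
    ultimately have "q'' = q" by (rule q(2))
    then show ?thesis by (auto simp: q''_def fun_eq_iff) metis
  qed
  then show ?thesis using q(1) by (intro exI[of _ q]) (auto simp: A_def)
qed

text \<open>
  If \<open>q\<close> is minimal, then it equals the smaller sublinear functional
  \<open>x \<mapsto> inf\<^sub>t (q (x + t x\<^sub>0) - t q x\<^sub>0)\<close>; the value at \<open>t = 1\<close> shows that \<open>q\<close> is superadditive as well.
\<close>

lemma minimal_sublinear_linear:
  assumes q: "sublinear q"
    and min: "\<And>q'. sublinear q' \<Longrightarrow> \<forall>x\<in>X. q' x \<le> q x \<Longrightarrow> \<forall>x\<in>X. q' x = q x"
    and x: "x \<in> X" and y: "y \<in> X"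
  shows "q (\<lambda>s. x s + c * y s) = q x + c * q y"
proof -
  have add: "q (\<lambda>s. x s + x\<^sub>0 s) = q x + q x\<^sub>0" if x: "x \<in> X" and x0: "x\<^sub>0 \<in> X" for x x\<^sub>0
  proof -
    define F where "F t x = q (\<lambda>s. x s + t * x\<^sub>0 s) - t * q x\<^sub>0" for t x
    have bdd: "bdd_below ((\<lambda>t. F t x) ` {0..})" if x: "x \<in> X" for x
    proof (rule bdd_belowI2)
      fix t :: real assume t: "t \<in> {0..}"
      have "t * q x\<^sub>0 = q (\<lambda>s. t * x\<^sub>0 s)"
        using sublinear_scale[OF q x0, of t] sublinear_zero[OF q] t by (cases "t = 0") auto
      also have "\<dots> = q (\<lambda>s. (x s + t * x\<^sub>0 s) + - x s)" by simp
      also have "\<dots> \<le> q (\<lambda>s. x s + t * x\<^sub>0 s) + q (\<lambda>s. - x s)"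
        by (rule sublinear_add[OF q lincomb_mem[OF x x0] minus_mem[OF x]])
      finally show "- q (\<lambda>s. - x s) \<le> F t x" by (simp add: F_def)
    qed
    have "sublinear (\<lambda>x. INF t\<in>{0..}. F t x)"
    proof (rule sublinear_INF[OF _ bdd])
      fix i j :: real and x y assume ij: "i \<in> {0..}" "j \<in> {0..}" and xy: "x \<in> X" "y \<in> X"
      have "q (\<lambda>s. (x s + i * x\<^sub>0 s) + (y s + j * x\<^sub>0 s)) \<le> q (\<lambda>s. x s + i * x\<^sub>0 s) + q (\<lambda>s. y s + j * x\<^sub>0 s)"
        by (rule sublinear_add[OF q lincomb_mem[OF xy(1) x0] lincomb_mem[OF xy(2) x0]])
      then have "F (i + j) (\<lambda>s. x s + y s) \<le> F i x + F j y"
        by (simp add: F_def algebra_simps)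
      then show "\<exists>k\<in>{0..}. F k (\<lambda>s. x s + y s) \<le> F i x + F j y" using ij by (intro bexI[of _ "i + j"]) auto
    next
      fix i c :: real and x assume i: "i \<in> {0..}" and x: "x \<in> X" and c: "0 < c"
      have "q (\<lambda>s. c * (x s + i * x\<^sub>0 s)) = c * q (\<lambda>s. x s + i * x\<^sub>0 s)"
        by (rule sublinear_scale[OF q lincomb_mem[OF x x0] c])
      then have "F (c * i) (\<lambda>s. c * x s) = c * F i x" by (simp add: F_def algebra_simps)
      then show "\<exists>k\<in>{0..}. F k (\<lambda>s. c * x s) \<le> c * F i x"
        using i c by (intro bexI[of _ "c * i"]) auto
    qed simp
    moreover have low: "(INF t\<in>{0..}. F t x) \<le> F t x" if "x \<in> X" "0 \<le> t" for x t
      using that by (intro cINF_lower bdd) auto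
    have "\<forall>x\<in>X. (INF t\<in>{0..}. F t x) \<le> q x" using low[of _ 0] by (simp add: F_def)
    ultimately have "(INF t\<in>{0..}. F t x) = q x" using min[of "\<lambda>x. INF t\<in>{0..}. F t x"] x by blast
    then have "q x \<le> q (\<lambda>s. x s + x\<^sub>0 s) - q x\<^sub>0" using low[OF x, of 1] by (simp add: F_def)
    moreover have "q (\<lambda>s. x s + x\<^sub>0 s) \<le> q x + q x\<^sub>0" by (rule sublinear_add[OF q x x0])
    ultimately show ?thesis by linarith
  qed
  have neg: "q (\<lambda>s. - y s) = - q y" if "y \<in> X" for y
    using add[OF that minus_mem[OF that]] sublinear_zero[OF q] by simp
  have "q (\<lambda>s. c * y s) = c * q y"
  proof -
    consider "0 < c" | "c = 0" | "c < 0" by linarith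
    then show ?thesis
    proof cases
      case 1 then show ?thesis by (rule sublinear_scale[OF q y])
    next
      case 2 then show ?thesis using sublinear_zero[OF q] by simp
    next
      case 3
      have "q (\<lambda>s. - (- c * y s)) = - q (\<lambda>s. - c * y s)" by (rule neg[OF scale_mem[OF y]])
      then show ?thesis using sublinear_scale[OF q y, of "- c"] 3 by simp
    qed
  qed
  then show ?thesis using add[OF x scale_mem[OF y], of c] by simp
qed

text \<open>
  The infimal convolution \<open>x \<mapsto> inf\<^sub>y (m (x - y) + l y)\<close> is sublinear, and every linear functional below it is below
  \<open>m\<close> and below \<open>l\<close>, hence equal to \<open>l\<close> on \<open>Y\<close>. A minimal sublinear functional below it is linear.
\<close>

lemma hahn_banach:
  assumes m: "sublinear m"
    and Y: "function_space Y" "Y \<subseteq> X"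
    and lin: "\<And>x y c. x \<in> Y \<Longrightarrow> y \<in> Y \<Longrightarrow> l (\<lambda>s. x s + c * y s) = l x + c * l y"
    and le: "\<And>y. y \<in> Y \<Longrightarrow> l y \<le> m y"
  obtains L where "\<And>x y c. x \<in> X \<Longrightarrow> y \<in> X \<Longrightarrow> L (\<lambda>s. x s + c * y s) = L x + c * L y"
    "\<And>x. x \<in> X \<Longrightarrow> L x \<le> m x" "\<And>y. y \<in> Y \<Longrightarrow> L y = l y"
proof -
  interpret Y: function_space Y by fact
  have l0: "l (\<lambda>s. 0) = 0" using lin[OF Y.zero_mem Y.zero_mem, of "-1"] by simp
  have lminus: "l (\<lambda>s. - y s) = - l y" if "y \<in> Y" for y
    using lin[OF Y.zero_mem that, of "-1"] l0 by simp
  have lscale: "l (\<lambda>s. c * y s) = c * l y" if "y \<in> Y" for y c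
    using lin[OF Y.zero_mem that, of c] l0 by simp
  define F where "F y x = m (\<lambda>s. x s - y s) + l y" for y x
  have bdd: "bdd_below ((\<lambda>y. F y x) ` Y)" if x: "x \<in> X" for x
  proof (rule bdd_belowI2)
    fix y assume y: "y \<in> Y"
    then have yX: "y \<in> X" using Y(2) by blast
    have "m (\<lambda>s. (x s - y s) + - x s) \<le> m (\<lambda>s. x s - y s) + m (\<lambda>s. - x s)"
      by (rule sublinear_add[OF m diff_mem[OF x yX] minus_mem[OF x]])
    moreover have "- l y \<le> m (\<lambda>s. - y s)" using le[OF Y.minus_mem[OF y]] lminus[OF y] by simp
    ultimately show "- m (\<lambda>s. - x s) \<le> F y x" by (simp add: F_def)
  qed
  have sub: "sublinear (\<lambda>x. INF y\<in>Y. F y x)"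
  proof (rule sublinear_INF[OF _ bdd])
    show "Y \<noteq> {}" using Y.zero_mem by blast
    fix i j x y assume ij: "i \<in> Y" "j \<in> Y" and xy: "x \<in> X" "y \<in> X"
    have "m (\<lambda>s. (x s - i s) + (y s - j s)) \<le> m (\<lambda>s. x s - i s) + m (\<lambda>s. y s - j s)"
      using ij Y(2) by (intro sublinear_add[OF m] diff_mem xy) auto
    moreover have "l (\<lambda>s. i s + j s) = l i + l j" using lin[OF ij, of 1] by simp
    moreover have "(\<lambda>s. (x s + y s) - (i s + j s)) = (\<lambda>s. (x s - i s) + (y s - j s))" by (simp add: fun_eq_iff)
    ultimately have "F (\<lambda>s. i s + j s) (\<lambda>s. x s + y s) \<le> F i x + F j y" by (simp add: F_def)
    then show "\<exists>k\<in>Y. F k (\<lambda>s. x s + y s) \<le> F i x + F j y" using Y.add_mem[OF ij] by blast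
  next
    fix i x and c :: real assume i: "i \<in> Y" and x: "x \<in> X" and c: "0 < c"
    have iX: "i \<in> X" using i Y(2) by blast
    have "F (\<lambda>s. c * i s) (\<lambda>s. c * x s) = m (\<lambda>s. c * (x s - i s)) + l (\<lambda>s. c * i s)"
      unfolding F_def by (simp only: right_diff_distrib)
    also have "\<dots> = c * F i x"
      unfolding F_def lscale[OF i] sublinear_scale[OF m diff_mem[OF x iX] c] by (simp only: distrib_left)
    finally have "F (\<lambda>s. c * i s) (\<lambda>s. c * x s) = c * F i x" .
    then show "\<exists>k\<in>Y. F k (\<lambda>s. c * x s) \<le> c * F i x" using Y.scale_mem[OF i, of c] by (intro bexI[of _ "\<lambda>s. c * i s"]) auto
  qed
  have low: "(INF y\<in>Y. F y x) \<le> F y x" if "y \<in> Y" "x \<in> X" for x y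
    using that by (intro cINF_lower bdd)
  obtain L where L: "sublinear L" "\<forall>x\<in>X. L x \<le> (INF y\<in>Y. F y x)"
    "\<forall>q'. sublinear q' \<longrightarrow> (\<forall>x\<in>X. q' x \<le> L x) \<longrightarrow> (\<forall>x\<in>X. q' x = L x)"
    using ex_minimal_sublinear[OF sub] by blast
  have linL: "L (\<lambda>s. x s + c * y s) = L x + c * L y" if "x \<in> X" "y \<in> X" for x y c
    by (rule minimal_sublinear_linear[OF L(1) _ that]) (use L(3) in blast)
  have Ly: "L y \<le> l y" if y: "y \<in> Y" for y
  proof -
    have yX: "y \<in> X" using y Y(2) by blast
    have "L y \<le> F y y" using L(2) low[OF y yX] yX by (blast intro: order_trans)
    then show ?thesis using sublinear_zero[OF m] by (simp add: F_def)
  qed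
  show thesis
  proof
    show "L (\<lambda>s. x s + c * y s) = L x + c * L y" if "x \<in> X" "y \<in> X" for x y c by (rule linL[OF that])
    show "L x \<le> m x" if x: "x \<in> X" for x
    proof -
      have "L x \<le> F (\<lambda>s. 0) x" using L(2) low[OF Y.zero_mem x] x by (blast intro: order_trans)
      then show ?thesis by (simp add: F_def l0)
    qed
    show "L y = l y" if y: "y \<in> Y" for y
    proof (rule antisym[OF Ly[OF y]])
      have yX: "y \<in> X" using y Y(2) by blast
      have "L (\<lambda>s. - y s) = - L y"
        using linL[OF zero_mem yX, of "-1"] sublinear_zero[OF L(1)] by simp
      then show "l y \<le> L y" using Ly[OF Y.minus_mem[OF y]] lminus[OF y] by simp
    qed
  qed
qed

end

section \<open>Representation of functionals by densities\<close>

lemma AE_nonneg_if_set_integrals_nonneg: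
  fixes k :: "'a \<Rightarrow> real"
  assumes k: "integrable M k" and 0: "\<And>A. A \<in> sets M \<Longrightarrow> 0 \<le> (\<integral>x. k x * indicator A x \<partial>M)"
  shows "AE x in M. 0 \<le> k x"
proof -
  have [measurable]: "k \<in> borel_measurable M" using k by simp
  define N where "N = {x \<in> space M. k x < 0}"
  have N: "N \<in> sets M" by (simp add: N_def)
  have i: "integrable M (\<lambda>x. k x * indicator N x)"
    using integrable_mult_indicator[OF N k] by (simp add: mult.commute)
  have "(\<integral>x. - (k x * indicator N x) \<partial>M) = 0"
  proof (rule antisym)
    show "(\<integral>x. - (k x * indicator N x) \<partial>M) \<le> 0" using 0[OF N] i by simp
    show "0 \<le> (\<integral>x. - (k x * indicator N x) \<partial>M)"
      by (intro integral_nonneg_AE AE_I2) (auto simp: N_def indicator_def)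
  qed
  moreover have "AE x in M. 0 \<le> - (k x * indicator N x)"
    by (intro AE_I2) (auto simp: N_def indicator_def)
  ultimately have "AE x in M. - (k x * indicator N x) = 0"
    using integral_nonneg_eq_0_iff_AE[of M "\<lambda>x. - (k x * indicator N x)"] i by simp
  then show ?thesis
    by (rule AE_mp) (auto intro!: AE_I2 simp: N_def indicator_def not_less)
qed

lemma L2_function_space: "function_space (L2 M :: ('a \<Rightarrow> real) set)"
  by (intro function_space.intro L2_zero L2_lincomb_real)

text \<open>
  A linear functional that vanishes on indicators vanishes on simple functions, and every square integrable
  \<open>\<eta>\<close> is a dominated limit of simple functions.
\<close>

lemma L2_functional_eq_0:
  fixes \<Phi> :: "('a \<Rightarrow> real) \<Rightarrow> real"
  assumes fin: "finite_measure M"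
    and lin: "\<And>x y c. x \<in> L2 M \<Longrightarrow> y \<in> L2 M \<Longrightarrow> \<Phi> (\<lambda>s. x s + c * y s) = \<Phi> x + c * \<Phi> y"
    and d: "d \<in> L2 M" and bound: "\<And>\<eta>. \<eta> \<in> L2 M \<Longrightarrow> \<bar>\<Phi> \<eta>\<bar> \<le> (\<integral>s. d s * \<bar>\<eta> s\<bar> \<partial>M)"
    and ind: "\<And>A. A \<in> sets M \<Longrightarrow> \<Phi> (indicator A) = 0"
    and \<eta>: "\<eta> \<in> L2 M"
  shows "\<Phi> \<eta> = 0"
proof -
  interpret finite_measure M by fact
  have indL2: "(indicator A :: 'a \<Rightarrow> real) \<in> L2 M" if "A \<in> sets M" for A
    using that by (intro bounded_imp_L2[OF fin, of _ 1] AE_I2) (auto split: split_indicator)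
  have \<Phi>0: "\<Phi> (\<lambda>s. 0) = 0" using lin[OF L2_zero L2_zero, of "-1"] by simp
  have sums: "(\<lambda>s. \<Sum>y\<in>Y. y * indicator (B y) s) \<in> L2 M \<and> \<Phi> (\<lambda>s. \<Sum>y\<in>Y. y * indicator (B y) s) = 0"
    if "finite Y" "\<And>y. y \<in> Y \<Longrightarrow> B y \<in> sets M" for Y :: "real set" and B
    using that
  proof (induction Y rule: finite_induct)
    case empty
    then show ?case by (simp add: L2_zero \<Phi>0)
  next
    case (insert y Y)
    then have IH: "(\<lambda>s. \<Sum>y\<in>Y. y * indicator (B y) s) \<in> L2 M" "\<Phi> (\<lambda>s. \<Sum>y\<in>Y. y * indicator (B y) s) = 0"
      and B: "B y \<in> sets M" by auto
    have eq: "(\<lambda>s. \<Sum>y\<in>insert y Y. y * indicator (B y) s) = (\<lambda>s. (\<Sum>y\<in>Y. y * indicator (B y) s) + y * indicator (B y) s)"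
      by (simp only: sum.insert[OF insert.hyps] add.commute)
    have "\<Phi> (\<lambda>s. (\<Sum>y\<in>Y. y * indicator (B y) s) + y * indicator (B y) s) = 0 + y * 0"
      unfolding lin[OF IH(1) indL2[OF B]] IH(2) ind[OF B] ..
    then show ?case
      unfolding eq using L2_lincomb_real[OF IH(1) indL2[OF B], of y] by simp
  qed
  have cong: "\<Phi> x = \<Phi> y" if "x \<in> L2 M" "y \<in> L2 M" "\<And>s. s \<in> space M \<Longrightarrow> x s = y s" for x y
  proof -
    have "\<bar>\<Phi> (\<lambda>s. x s + (-1) * y s)\<bar> \<le> (\<integral>s. d s * \<bar>x s + (-1) * y s\<bar> \<partial>M)"
      by (intro bound L2_lincomb_real that)
    also have "\<dots> = (\<integral>s. 0 \<partial>M)" using that(3) by (intro Bochner_Integration.integral_cong) auto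
    finally show ?thesis using lin[OF that(1,2), of "-1"] by simp
  qed
  have simple: "\<Phi> F = 0" if F: "simple_function M F" "F \<in> L2 M" for F
  proof -
    define F' where "F' s = (\<Sum>y\<in>F ` space M. y * indicator (F -` {y} \<inter> space M) s)" for s
    have eq: "F s = F' s" if "s \<in> space M" for s
    proof -
      have "F' s = (\<Sum>y\<in>F ` space M. if y = F s then F s else 0)"
        unfolding F'_def using that by (intro sum.cong) (auto split: split_indicator)
      then show ?thesis using F(1) that by (simp add: simple_function_def)
    qed
    have "F' \<in> L2 M \<and> \<Phi> F' = 0"
      unfolding F'_def[abs_def] using F(1) by (intro sums) (auto simp: simple_function_def)
    then show ?thesis using cong[of F F'] F(2) eq by simp
  qed
  obtain F where F: "\<And>i. simple_function M (F i)" "\<And>x. x \<in> space M \<Longrightarrow> (\<lambda>i. F i x) \<longlonglongrightarrow> \<eta> x"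
    "\<And>i x. x \<in> space M \<Longrightarrow> dist (F i x) 0 \<le> 2 * dist (\<eta> x) 0"
    using borel_measurable_implies_sequence_metric[OF L2_D(1)[OF \<eta>], of 0] by blast
  have FL2: "F i \<in> L2 M" for i
    using F(3) by (intro L2_bound[OF \<eta>, of _ 2]) (auto intro: borel_measurable_simple_function F(1))
  note [measurable] = L2_D(1)[OF \<eta>] L2_D(1)[OF d] L2_D(1)[OF FL2]
  have "\<bar>\<Phi> \<eta>\<bar> \<le> (\<integral>s. d s * \<bar>\<eta> s - F i s\<bar> \<partial>M)" for i
    using bound[OF L2_lincomb_real[OF \<eta> FL2], of "-1" i] lin[OF \<eta> FL2, of "-1" i] simple[OF F(1) FL2]
    by simp
  moreover have "(\<lambda>i. \<integral>s. d s * \<bar>\<eta> s - F i s\<bar> \<partial>M) \<longlonglongrightarrow> (\<integral>s. 0 \<partial>M)"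
  proof (rule integral_dominated_convergence[where w="\<lambda>s. 3 * \<bar>d s * \<eta> s\<bar>"])
    show "integrable M (\<lambda>s. 3 * \<bar>d s * \<eta> s\<bar>)" using L2_mult_integrable[OF d \<eta>] by simp
    show "AE s in M. (\<lambda>i. d s * \<bar>\<eta> s - F i s\<bar>) \<longlonglongrightarrow> 0"
    proof (rule AE_I2)
      fix s assume "s \<in> space M"
      then have "(\<lambda>i. d s * \<bar>\<eta> s - F i s\<bar>) \<longlonglongrightarrow> d s * \<bar>\<eta> s - \<eta> s\<bar>" by (intro tendsto_intros F)
      then show "(\<lambda>i. d s * \<bar>\<eta> s - F i s\<bar>) \<longlonglongrightarrow> 0" by simp
    qed
    show "AE s in M. norm (d s * \<bar>\<eta> s - F i s\<bar>) \<le> 3 * \<bar>d s * \<eta> s\<bar>" for i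
    proof (rule AE_I2)
      fix s assume "s \<in> space M"
      then have "\<bar>\<eta> s - F i s\<bar> \<le> 3 * \<bar>\<eta> s\<bar>" using F(3)[of s i] by simp
      then have "\<bar>d s\<bar> * \<bar>\<eta> s - F i s\<bar> \<le> \<bar>d s\<bar> * (3 * \<bar>\<eta> s\<bar>)" by (intro mult_left_mono) auto
      then show "norm (d s * \<bar>\<eta> s - F i s\<bar>) \<le> 3 * \<bar>d s * \<eta> s\<bar>" by (simp add: abs_mult)
    qed
  qed measurable
  ultimately have "\<bar>\<Phi> \<eta>\<bar> \<le> (\<integral>s. 0 \<partial>M)" by (intro LIMSEQ_le_const) auto
  then show ?thesis by simp
qed

text \<open>
  On indicators, a positive functional dominated by \<open>\<eta> \<mapsto> \<integral> d \<eta>\<close> is a measure, with continuity at the empty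
  set inherited from the integral of \<open>d\<close>. The Radon-Nikodym density of this measure represents the functional.
\<close>

lemma L2_positive_functional_density:
  fixes \<Lambda> :: "('a \<Rightarrow> real) \<Rightarrow> real"
  assumes fin: "finite_measure M" and d: "d \<in> L2 M"
    and lin: "\<And>x y c. x \<in> L2 M \<Longrightarrow> y \<in> L2 M \<Longrightarrow> \<Lambda> (\<lambda>s. x s + c * y s) = \<Lambda> x + c * \<Lambda> y"
    and pos: "\<And>\<eta>. \<eta> \<in> L2 M \<Longrightarrow> (\<And>s. 0 \<le> \<eta> s) \<Longrightarrow> 0 \<le> \<Lambda> \<eta>"
    and le: "\<And>\<eta>. \<eta> \<in> L2 M \<Longrightarrow> (\<And>s. 0 \<le> \<eta> s) \<Longrightarrow> \<Lambda> \<eta> \<le> (\<integral>s. d s * \<eta> s \<partial>M)"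
  shows "\<exists>h\<in>L2 M. (AE s in M. 0 \<le> h s \<and> h s \<le> d s) \<and> (\<forall>\<eta>\<in>L2 M. \<Lambda> \<eta> = (\<integral>s. h s * \<eta> s \<partial>M))"
proof -
  interpret finite_measure M by fact
  have [measurable]: "d \<in> borel_measurable M" by (rule L2_D(1)[OF d])
  have di: "integrable M d" by (rule L2_integrable[OF fin d])
  have indL2: "(indicator A :: 'a \<Rightarrow> real) \<in> L2 M" if "A \<in> sets M" for A
    using that by (intro bounded_imp_L2[OF fin, of _ 1] AE_I2) (auto split: split_indicator)
  have \<Lambda>0: "\<Lambda> (\<lambda>s. 0) = 0" using lin[OF L2_zero L2_zero, of "-1"] by simp
  have ind_pos: "0 \<le> \<Lambda> (indicator A)" if "A \<in> sets M" for A by (rule pos[OF indL2[OF that]]) simp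
  have ind_le: "\<Lambda> (indicator A) \<le> (\<integral>s. d s * indicator A s \<partial>M)" if "A \<in> sets M" for A
    by (rule le[OF indL2[OF that]]) simp
  define \<mu> where "\<mu> A = ennreal (\<Lambda> (indicator A))" for A
  have add: "additive (sets M) \<mu>"
    unfolding additive_def
  proof (intro ballI impI)
    fix A B assume AB: "A \<in> sets M" "B \<in> sets M" "A \<inter> B = {}"
    have "indicator (A \<union> B) = (\<lambda>s. indicator A s + 1 * indicator B s :: real)"
      using AB(3) by (auto simp: indicator_def fun_eq_iff)
    then have "\<Lambda> (indicator (A \<union> B)) = \<Lambda> (indicator A) + \<Lambda> (indicator B)"
      using lin[OF indL2[OF AB(1)] indL2[OF AB(2)], of 1] by simp
    then show "\<mu> (A \<union> B) = \<mu> A + \<mu> B" using AB ind_pos by (simp add: \<mu>_def ennreal_plus)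
  qed
  have posit: "positive (sets M) \<mu>"
  proof -
    have "(indicator {} :: 'a \<Rightarrow> real) = (\<lambda>s. 0)" by (simp add: fun_eq_iff)
    then show ?thesis using \<Lambda>0 by (simp add: positive_def \<mu>_def)
  qed
  have "countably_additive (sets M) \<mu>"
  proof (rule sets.empty_continuous_imp_countably_additive[OF posit add])
    show "\<forall>A\<in>sets M. \<mu> A \<noteq> \<infinity>" by (simp add: \<mu>_def)
    fix A :: "nat \<Rightarrow> 'a set" assume A: "range A \<subseteq> sets M" "decseq A" "(\<Inter>i. A i) = {}"
    have Am [measurable]: "A i \<in> sets M" for i using A(1) by auto
    have "(\<lambda>i. \<integral>s. d s * indicator (A i) s \<partial>M) \<longlonglongrightarrow> (\<integral>s. 0 \<partial>M)"
    proof (rule integral_dominated_convergence[where w="\<lambda>s. \<bar>d s\<bar>"])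
      show "AE s in M. (\<lambda>i. d s * indicator (A i) s) \<longlonglongrightarrow> 0"
      proof (rule AE_I2)
        fix s
        obtain i where "s \<notin> A i" using A(3) by blast
        then have "s \<notin> A j" if "j \<ge> i" for j using A(2) that by (auto dest: decseqD)
        then have "eventually (\<lambda>j. d s * indicator (A j) s = 0) sequentially"
          by (intro eventually_sequentiallyI[of i]) simp
        then show "(\<lambda>i. d s * indicator (A i) s) \<longlonglongrightarrow> 0" by (rule tendsto_eventually)
      qed
      show "AE s in M. norm (d s * indicator (A i) s) \<le> \<bar>d s\<bar>" for i
        by (intro AE_I2) (simp add: indicator_def)
    qed (use di in auto)
    then have lim: "(\<lambda>i. \<integral>s. d s * indicator (A i) s \<partial>M) \<longlonglongrightarrow> 0" by simp
    have "(\<lambda>i. \<Lambda> (indicator (A i))) \<longlonglongrightarrow> 0"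
      by (rule tendsto_sandwich[OF _ _ tendsto_const lim]) (simp_all add: ind_pos ind_le Am)
    then show "(\<lambda>i. \<mu> (A i)) \<longlonglongrightarrow> 0" unfolding \<mu>_def using tendsto_ennrealI by fastforce
  qed
  then have ms: "measure_space (space M) (sets M) \<mu>"
    using posit by (simp add: measure_space_def sets.sigma_algebra_axioms)
  define N where "N = measure_of (space M) (sets M) \<mu>"
  have setsN: "sets N = sets M" by (simp add: N_def)
  have emN: "emeasure N A = \<mu> A" if "A \<in> sets M" for A
    unfolding N_def using emeasure_measure_of_sigma[of "space M" "sets M" \<mu> A] ms that
    by (simp add: measure_space_def)
  have "absolutely_continuous M N"
    unfolding absolutely_continuous_def
  proof
    fix A assume A: "A \<in> null_sets M"
    then have Am: "A \<in> sets M" by auto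
    have "(\<integral>s. d s * indicator A s \<partial>M) = (\<integral>s. 0 \<partial>M)"
      using AE_not_in[OF A] Am by (intro integral_cong_AE) auto
    then have "\<Lambda> (indicator A) = 0" using ind_le[OF Am] ind_pos[OF Am] by simp
    then show "A \<in> null_sets N" using Am by (auto simp: null_sets_def setsN emN \<mu>_def)
  qed
  then obtain f where f: "f \<in> borel_measurable M" "density M f = N"
    using Radon_Nikodym[of N] setsN by auto
  have fA: "(\<integral>\<^sup>+s. f s * indicator A s \<partial>M) = ennreal (\<Lambda> (indicator A))" if "A \<in> sets M" for A
    using emeasure_density[OF f(1) that] emN[OF that] f(2) by (simp add: \<mu>_def)
  define h where "h s = enn2real (f s)" for s
  have hm [measurable]: "h \<in> borel_measurable M" unfolding h_def using f(1) by simp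
  have "(\<integral>\<^sup>+s. f s \<partial>M) \<noteq> \<infinity>"
  proof -
    have "(\<integral>\<^sup>+s. f s \<partial>M) = (\<integral>\<^sup>+s. f s * indicator (space M) s \<partial>M)" by (intro nn_integral_cong) simp
    then show ?thesis using fA[of "space M"] by simp
  qed
  then have "AE s in M. f s \<noteq> \<infinity>" by (rule nn_integral_PInf_AE[OF f(1)])
  then have fh: "AE s in M. f s = ennreal (h s)" by eventually_elim (auto simp: h_def less_top)
  have h0: "0 \<le> h s" for s by (simp add: h_def)
  have hA: "integrable M (\<lambda>s. h s * indicator A s) \<and> (\<integral>s. h s * indicator A s \<partial>M) = \<Lambda> (indicator A)"
    if A: "A \<in> sets M" for A
  proof -
    have [measurable]: "A \<in> sets M" by fact
    have "(\<integral>\<^sup>+s. ennreal (h s * indicator A s) \<partial>M) = (\<integral>\<^sup>+s. f s * indicator A s \<partial>M)"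
      using fh by (intro nn_integral_cong_AE) (auto elim!: eventually_mono simp: indicator_def)
    then have "(\<integral>\<^sup>+s. ennreal (h s * indicator A s) \<partial>M) = ennreal (\<Lambda> (indicator A))" using fA[OF A] by simp
    then have "has_bochner_integral M (\<lambda>s. h s * indicator A s) (\<Lambda> (indicator A))"
      using ind_pos[OF A] h0 by (intro has_bochner_integral_nn_integral) auto
    then show ?thesis by (simp add: has_bochner_integral_iff)
  qed
  have hi: "integrable M h"
    using conjunct1[OF hA[OF sets.top]] by (subst Bochner_Integration.integrable_cong[OF refl, of _ _ "\<lambda>s. h s * indicator (space M) s"]) auto
  have "AE s in M. 0 \<le> d s - h s"
  proof (rule AE_nonneg_if_set_integrals_nonneg)
    show "integrable M (\<lambda>s. d s - h s)" using di hi by simp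
    fix A assume A: "A \<in> sets M"
    have "(\<integral>s. (d s - h s) * indicator A s \<partial>M) = (\<integral>s. d s * indicator A s \<partial>M) - (\<integral>s. h s * indicator A s \<partial>M)"
      using hA[OF A] L2_mult_integrable[OF d indL2[OF A]] by (simp add: left_diff_distrib)
    then show "0 \<le> (\<integral>s. (d s - h s) * indicator A s \<partial>M)" using ind_le[OF A] hA[OF A] by simp
  qed
  then have hd: "AE s in M. 0 \<le> h s \<and> h s \<le> d s" by eventually_elim (simp add: h0)
  have "AE s in M. norm (h s) \<le> 1 * norm (d s)" using hd by eventually_elim simp
  then have hL2: "h \<in> L2 M" by (rule L2_bound[OF d hm])
  have "\<Lambda> \<eta> - (\<integral>s. h s * \<eta> s \<partial>M) = 0" if \<eta>: "\<eta> \<in> L2 M" for \<eta>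
  proof (rule L2_functional_eq_0[OF fin _ L2_scale[OF d, of 2] _ _ \<eta>])
    fix x y :: "'a \<Rightarrow> real" and c assume xy: "x \<in> L2 M" "y \<in> L2 M"
    show "\<Lambda> (\<lambda>s. x s + c * y s) - (\<integral>s. h s * (x s + c * y s) \<partial>M) =
      \<Lambda> x - (\<integral>s. h s * x s \<partial>M) + c * (\<Lambda> y - (\<integral>s. h s * y s \<partial>M))"
      using L2_inner_lincomb_right_real[OF hL2 xy, of c] lin[OF xy, of c]
      by (simp add: L2_inner_def algebra_simps)
  next
    fix \<xi> :: "'a \<Rightarrow> real" assume \<xi>: "\<xi> \<in> L2 M"
    define a b where "a s = max 0 (\<xi> s)" and "b s = max 0 (- \<xi> s)" for s
    note [measurable] = L2_D(1)[OF \<xi>]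
    have a: "a \<in> L2 M" unfolding a_def by (rule L2_bound[OF \<xi>, of _ 1]) auto
    have b: "b \<in> L2 M" unfolding b_def by (rule L2_bound[OF \<xi>, of _ 1]) auto
    have ab: "0 \<le> a s" "0 \<le> b s" "\<xi> s = a s + (-1) * b s" "\<bar>\<xi> s\<bar> = a s + 1 * b s" for s
      by (auto simp: a_def b_def)
    have e: "\<xi> = (\<lambda>s. a s + (-1) * b s)" by (rule ext) (rule ab(3))
    have "\<Lambda> \<xi> = \<Lambda> a + (-1) * \<Lambda> b" unfolding lin[OF a b, symmetric] by (rule arg_cong[OF e])
    then have "\<Lambda> \<xi> = \<Lambda> a - \<Lambda> b" by simp
    moreover have "\<Lambda> a \<le> (\<integral>s. d s * a s \<partial>M)" "\<Lambda> b \<le> (\<integral>s. d s * b s \<partial>M)" "0 \<le> \<Lambda> a" "0 \<le> \<Lambda> b"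
      using a b ab by (auto intro: le pos)
    moreover have "(\<integral>s. d s * \<bar>\<xi> s\<bar> \<partial>M) = (\<integral>s. d s * a s \<partial>M) + (\<integral>s. d s * b s \<partial>M)"
      using L2_mult_integrable[OF d a] L2_mult_integrable[OF d b] unfolding ab(4)
      by (simp add: distrib_left)
    ultimately have "\<bar>\<Lambda> \<xi>\<bar> \<le> (\<integral>s. d s * \<bar>\<xi> s\<bar> \<partial>M)" by linarith
    moreover have "\<bar>\<integral>s. h s * \<xi> s \<partial>M\<bar> \<le> (\<integral>s. d s * \<bar>\<xi> s\<bar> \<partial>M)"
    proof -
      have i: "integrable M (\<lambda>s. \<bar>h s * \<xi> s\<bar>)" using L2_mult_integrable[OF hL2 \<xi>] by simp
      have "(\<lambda>s. \<bar>\<xi> s\<bar>) \<in> L2 M" by (rule L2_bound[OF \<xi>, of _ 1]) auto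
      then have i2: "integrable M (\<lambda>s. d s * \<bar>\<xi> s\<bar>)" by (rule L2_mult_integrable[OF d])
      have "\<bar>\<integral>s. h s * \<xi> s \<partial>M\<bar> \<le> (\<integral>s. \<bar>h s * \<xi> s\<bar> \<partial>M)" by (rule integral_abs_bound)
      also have "\<dots> \<le> (\<integral>s. d s * \<bar>\<xi> s\<bar> \<partial>M)"
        by (rule integral_mono_AE[OF i i2]) (use hd in \<open>eventually_elim, auto simp: abs_mult intro: mult_right_mono\<close>)
      finally show ?thesis .
    qed
    ultimately show "\<bar>\<Lambda> \<xi> - (\<integral>s. h s * \<xi> s \<partial>M)\<bar> \<le> (\<integral>s. 2 *\<^sub>R d s * \<bar>\<xi> s\<bar> \<partial>M)"
      by (simp add: mult.assoc)
  next
    fix A assume "A \<in> sets M"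
    then show "\<Lambda> (indicator A) - (\<integral>s. h s * indicator A s \<partial>M) = 0" using hA by simp
  qed
  then show ?thesis using hL2 hd by (intro bexI[of _ h]) auto
qed

lemma L2_bounded_functional_density:
  fixes L :: "('a \<Rightarrow> real) \<Rightarrow> real"
  assumes fin: "finite_measure M" and \<alpha>: "\<alpha> \<in> L2 M" and \<beta>: "\<beta> \<in> L2 M"
    and lin: "\<And>x y c. x \<in> L2 M \<Longrightarrow> y \<in> L2 M \<Longrightarrow> L (\<lambda>s. x s + c * y s) = L x + c * L y"
    and ge: "\<And>\<eta>. \<eta> \<in> L2 M \<Longrightarrow> (\<And>s. 0 \<le> \<eta> s) \<Longrightarrow> (\<integral>s. \<alpha> s * \<eta> s \<partial>M) \<le> L \<eta>"
    and le: "\<And>\<eta>. \<eta> \<in> L2 M \<Longrightarrow> (\<And>s. 0 \<le> \<eta> s) \<Longrightarrow> L \<eta> \<le> (\<integral>s. \<beta> s * \<eta> s \<partial>M)"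
  shows "\<exists>h\<in>L2 M. (AE s in M. \<alpha> s \<le> h s \<and> h s \<le> \<beta> s) \<and> (\<forall>\<eta>\<in>L2 M. L \<eta> = (\<integral>s. h s * \<eta> s \<partial>M))"
proof -
  have "\<exists>h\<in>L2 M. (AE s in M. 0 \<le> h s \<and> h s \<le> \<beta> s - \<alpha> s) \<and>
      (\<forall>\<eta>\<in>L2 M. L \<eta> - (\<integral>s. \<alpha> s * \<eta> s \<partial>M) = (\<integral>s. h s * \<eta> s \<partial>M))"
  proof (rule L2_positive_functional_density[OF fin L2_diff[OF \<beta> \<alpha>]])
    fix x y :: "'a \<Rightarrow> real" and c assume xy: "x \<in> L2 M" "y \<in> L2 M"
    show "L (\<lambda>s. x s + c * y s) - (\<integral>s. \<alpha> s * (x s + c * y s) \<partial>M) =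
      L x - (\<integral>s. \<alpha> s * x s \<partial>M) + c * (L y - (\<integral>s. \<alpha> s * y s \<partial>M))"
      using L2_inner_lincomb_right_real[OF \<alpha> xy, of c] lin[OF xy, of c]
      by (simp add: L2_inner_def algebra_simps)
  next
    fix \<eta> :: "'a \<Rightarrow> real" assume \<eta>: "\<eta> \<in> L2 M" and pos: "\<And>s. 0 \<le> \<eta> s"
    show "0 \<le> L \<eta> - (\<integral>s. \<alpha> s * \<eta> s \<partial>M)" using ge[OF \<eta> pos] by simp
    show "L \<eta> - (\<integral>s. \<alpha> s * \<eta> s \<partial>M) \<le> (\<integral>s. (\<beta> s - \<alpha> s) * \<eta> s \<partial>M)"
      using le[OF \<eta> pos] L2_mult_integrable[OF \<alpha> \<eta>] L2_mult_integrable[OF \<beta> \<eta>] by (simp add: left_diff_distrib)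
  qed
  then obtain h where h: "h \<in> L2 M" "AE s in M. 0 \<le> h s \<and> h s \<le> \<beta> s - \<alpha> s"
    "\<And>\<eta>. \<eta> \<in> L2 M \<Longrightarrow> L \<eta> - (\<integral>s. \<alpha> s * \<eta> s \<partial>M) = (\<integral>s. h s * \<eta> s \<partial>M)" by blast
  have "L \<eta> = (\<integral>s. (\<alpha> s + 1 * h s) * \<eta> s \<partial>M)" if "\<eta> \<in> L2 M" for \<eta>
    using h(3)[OF that] L2_mult_integrable[OF \<alpha> that] L2_mult_integrable[OF h(1) that] by (simp add: distrib_right)
  moreover have "AE s in M. \<alpha> s \<le> \<alpha> s + 1 * h s \<and> \<alpha> s + 1 * h s \<le> \<beta> s" using h(2) by eventually_elim simp
  ultimately show ?thesis
    by (intro bexI[of _ "\<lambda>s. \<alpha> s + 1 * h s"] conjI ballI L2_lincomb_real[OF \<alpha> h(1)])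
qed

section \<open>Square roots of coercive symmetric matrices\<close>

lemma symmetric_matrix_inner:
  fixes A :: "real^'n^'n"
  assumes "transpose A = A"
  shows "x \<bullet> (A *v y) = (A *v x) \<bullet> y"
  by (metis assms dot_lmul_matrix transpose_matrix_vector)

text \<open>
  Polarization of \<open>x \<bullet> X y\<close>, with \<open>x\<close> parallel to \<open>X y\<close> and of the same norm as \<open>y\<close>.
\<close>

lemma symmetric_form_norm_le:
  fixes X :: "'a::real_inner \<Rightarrow> 'a"
  assumes lin: "linear X" and sym: "\<And>x y. x \<bullet> X y = X x \<bullet> y"
    and lb: "\<And>x. 0 \<le> x \<bullet> X x" and ub: "\<And>x. x \<bullet> X x \<le> r * (norm x)\<^sup>2"
  shows "norm (X y) \<le> r * norm y"
proof (cases "X y = 0 \<or> y = 0")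
  case True
  have "0 \<le> r * (norm y)\<^sup>2" using lb[of y] ub[of y] by linarith
  then show ?thesis using True linear_0[OF lin]
    by (cases "y = 0") (auto simp: zero_le_mult_iff)
next
  case False
  define x where "x = (norm y / norm (X y)) *\<^sub>R X y"
  have nx: "norm x = norm y" using False by (simp add: x_def)
  have r: "0 \<le> r" using lb[of y] ub[of y] False
    by (smt (verit) mult_nonneg_nonneg mult_neg_pos zero_less_power zero_less_norm_iff)
  have "4 * (x \<bullet> X y) = (x + y) \<bullet> X (x + y) - (x - y) \<bullet> X (x - y)"
    using sym[of x y]
    by (simp add: linear_add[OF lin] linear_diff[OF lin] inner_simps inner_commute)
  also have "\<dots> \<le> r * (norm (x + y))\<^sup>2" using ub[of "x + y"] lb[of "x - y"] by linarith
  also have "\<dots> \<le> r * (2 * norm y)\<^sup>2"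
    using norm_triangle_ineq[of x y] r nx by (intro mult_left_mono power_mono) auto
  finally have "x \<bullet> X y \<le> r * norm y * norm y" by (simp add: power2_eq_square)
  moreover have "x \<bullet> X y = norm y * norm (X y)"
    using False by (simp add: x_def power2_norm_eq_inner[symmetric] power2_eq_square)
  ultimately have "norm y * norm (X y) \<le> norm y * (r * norm y)" by (simp add: mult_ac)
  then show ?thesis using False by (simp add: mult_le_cancel_left)
qed

text \<open>
  The operator \<open>Y = 1 - sqrt (1 - X)\<close> is the fixed point of \<open>Y \<mapsto> (X + Y\<^sup>2) / 2\<close>, which is a contraction on the
  self-adjoint operators of norm at most \<open>1 - sqrt (1 - norm X)\<close>.
\<close>

lemma ex_symmetric_half_square_fixpoint:
  fixes X :: "'a::euclidean_space \<Rightarrow>\<^sub>L 'a"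
  assumes X: "norm X < 1" and sym: "\<And>x y. x \<bullet> X y = X x \<bullet> y"
  shows "\<exists>Y :: 'a \<Rightarrow>\<^sub>L 'a. norm Y < 1 \<and> (\<forall>x y. x \<bullet> blinfun_apply Y y = blinfun_apply Y x \<bullet> y) \<and> 2 *\<^sub>R Y = X + (Y o\<^sub>L Y)"
proof -
  define s where "s = 1 - sqrt (1 - norm X)"
  have s: "0 \<le> s" "s < 1" using X by (auto simp: s_def)
  have s2: "norm X + s * s = 2 * s"
    using X by (simp add: s_def algebra_simps)
  define S where "S = {Y :: 'a \<Rightarrow>\<^sub>L 'a. norm Y \<le> s \<and> (\<forall>x y. x \<bullet> blinfun_apply Y y = blinfun_apply Y x \<bullet> y)}"
  define F where "F = (\<lambda>Y :: 'a \<Rightarrow>\<^sub>L 'a. (1/2) *\<^sub>R (X + (Y o\<^sub>L Y)))"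
  have "S = cball 0 s \<inter> (\<Inter>x. \<Inter>y. {Y. x \<bullet> blinfun_apply Y y = blinfun_apply Y x \<bullet> y})"
    by (auto simp: S_def)
  moreover have "closed {Y. x \<bullet> blinfun_apply Y y = blinfun_apply Y x \<bullet> y}" for x y :: 'a
    by (intro closed_Collect_eq continuous_intros)
  ultimately have "closed S" by (auto intro!: closed_Int closed_INT)
  then have "complete S" by (simp add: complete_eq_closed)
  moreover have "0 \<in> S" using s by (simp add: S_def)
  moreover have "F ` S \<subseteq> S"
  proof (rule image_subsetI)
    fix Y assume Y: "Y \<in> S"
    have "norm (Y o\<^sub>L Y) \<le> s * s"
      using norm_blinfun_compose[of Y Y] Y s mult_mono[of "norm Y" s "norm Y" s]
      by (auto simp: S_def)
    then have "norm (F Y) \<le> s"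
      using norm_triangle_ineq[of X "Y o\<^sub>L Y"] s2 by (simp add: F_def)
    moreover have "x \<bullet> F Y y = F Y x \<bullet> y" for x y
    proof -
      have "x \<bullet> Y (Y y) = Y (Y x) \<bullet> y" using Y by (simp add: S_def)
      then show ?thesis
        using sym[of x y] by (simp add: F_def blinfun.bilinear_simps inner_simps)
    qed
    ultimately show "F Y \<in> S" by (simp add: S_def)
  qed
  moreover have "dist (F Y) (F Z) \<le> s * dist Y Z" if "Y \<in> S \<and> Z \<in> S" for Y Z
  proof -
    have "(Y o\<^sub>L Y) - (Z o\<^sub>L Z) = (Y o\<^sub>L (Y - Z)) + ((Y - Z) o\<^sub>L Z)"
      by (rule blinfun_eqI) (simp add: blinfun.bilinear_simps)
    moreover have "norm (Y o\<^sub>L (Y - Z)) \<le> s * norm (Y - Z)"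
      using that norm_blinfun_compose[of Y "Y - Z"] mult_right_mono[of "norm Y" s "norm (Y - Z)"]
      by (simp add: S_def)
    moreover have "norm ((Y - Z) o\<^sub>L Z) \<le> s * norm (Y - Z)"
      using that norm_blinfun_compose[of "Y - Z" Z] mult_left_mono[of "norm Z" s "norm (Y - Z)"]
      by (simp add: S_def mult.commute)
    ultimately have "norm ((Y o\<^sub>L Y) - (Z o\<^sub>L Z)) \<le> 2 * s * norm (Y - Z)"
      using norm_triangle_ineq[of "Y o\<^sub>L (Y - Z)" "(Y - Z) o\<^sub>L Z"] by simp
    moreover have "F Y - F Z = (1/2) *\<^sub>R ((Y o\<^sub>L Y) - (Z o\<^sub>L Z))"
      by (simp add: F_def algebra_simps)
    ultimately show ?thesis by (simp add: dist_norm)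
  qed
  ultimately have "\<exists>!Y. Y \<in> S \<and> F Y = Y" using s by (intro Banach_fix) auto
  then obtain Y where Y: "Y \<in> S" "F Y = Y" by blast
  have "2 *\<^sub>R Y = 2 *\<^sub>R F Y" by (simp only: Y)
  then have "2 *\<^sub>R Y = X + (Y o\<^sub>L Y)" by (simp add: F_def)
  then show ?thesis using Y s by (intro exI[of _ Y]) (auto simp: S_def)
qed

text \<open>
  Apply the fixed point lemma to \<open>X = 1 - A / k\<^sub>1\<close>, of norm at most \<open>1 - k\<^sub>0 / k\<^sub>1\<close>: then
  \<open>(1 - Y)\<^sup>2 = 1 - X = A / k\<^sub>1\<close>.
\<close>

lemma ex_matrix_sqrt:
  fixes A :: "real^'n^'n"
  assumes sym: "transpose A = A" and k: "0 < k\<^sub>0"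
    and bnd: "\<And>x. k\<^sub>0 * (norm x)\<^sup>2 \<le> x \<bullet> (A *v x) \<and> x \<bullet> (A *v x) \<le> k\<^sub>1 * (norm x)\<^sup>2"
  shows "\<exists>B. transpose B = B \<and> (\<forall>x. 0 \<le> x \<bullet> (B *v x)) \<and> B ** B = A"
proof -
  have k01: "k\<^sub>0 \<le> k\<^sub>1" using bnd[of "axis undefined 1"] by (auto simp: norm_axis_1)
  then have k1: "0 < k\<^sub>1" using k by simp
  define X0 where "X0 = (\<lambda>x. x - (1/k\<^sub>1) *\<^sub>R (A *v x))"
  have linX: "linear X0" unfolding X0_def
    by (intro linear_compose_sub linear_id[unfolded id_def] linear_compose_scale_right matrix_vector_mul_linear)
  have symX: "x \<bullet> X0 y = X0 x \<bullet> y" for x y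
    by (simp add: X0_def inner_simps symmetric_matrix_inner[OF sym])
  have qX: "x \<bullet> X0 x = (norm x)\<^sup>2 - (x \<bullet> (A *v x)) / k\<^sub>1" for x
    by (simp add: X0_def inner_simps power2_norm_eq_inner)
  have nX: "norm (X0 x) \<le> (1 - k\<^sub>0 / k\<^sub>1) * norm x" for x
  proof (rule symmetric_form_norm_le[OF linX symX])
    fix y
    show "0 \<le> y \<bullet> X0 y" using bnd[of y] k1 by (simp add: qX field_simps)
    show "y \<bullet> X0 y \<le> (1 - k\<^sub>0 / k\<^sub>1) * (norm y)\<^sup>2" using bnd[of y] k1 by (simp add: qX field_simps)
  qed
  define X where "X = Blinfun X0"
  have Xa: "blinfun_apply X = X0"
    unfolding X_def using linX by (intro bounded_linear_Blinfun_apply) (simp add: linear_conv_bounded_linear)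
  have "norm X \<le> 1 - k\<^sub>0 / k\<^sub>1"
    using nX k k01 k1 by (intro norm_blinfun_bound) (auto simp: Xa)
  also have "\<dots> < 1" using k k1 by simp
  finally obtain Y where Y: "norm Y < 1" "\<And>x y. x \<bullet> blinfun_apply Y y = Y x \<bullet> y" "2 *\<^sub>R Y = X + (Y o\<^sub>L Y)"
    using ex_symmetric_half_square_fixpoint[of X] symX by (auto simp: Xa)
  define B where "B = (\<lambda>x. sqrt k\<^sub>1 *\<^sub>R (x - Y x))"
  have linB: "linear B" unfolding B_def
    by (intro linear_compose_scale_right linear_compose_sub linear_id[unfolded id_def] bounded_linear.linear[OF blinfun.bounded_linear_right])
  have Bv: "matrix B *v x = B x" for x using linB by (intro matrix_works) (simp add: linear_def scalar_mult_eq_scaleR)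
  have symB: "x \<bullet> B y = B x \<bullet> y" for x y by (simp add: B_def inner_simps Y)
  have "transpose (matrix B) = matrix B"
  proof -
    have "transpose (matrix B) *v x = matrix B *v x" for x
    proof (rule vector_eq_rdot[THEN iffD1], rule allI)
      fix z
      have "(transpose (matrix B) *v x) \<bullet> z = x \<bullet> (matrix B *v z)"
        by (simp add: transpose_matrix_vector dot_lmul_matrix)
      then show "(transpose (matrix B) *v x) \<bullet> z = (matrix B *v x) \<bullet> z" by (simp add: Bv symB)
    qed
    then show ?thesis by (simp add: matrix_eq)
  qed
  moreover have "0 \<le> x \<bullet> (matrix B *v x)" for x
  proof -
    have "x \<bullet> Y x \<le> norm x * norm (Y x)" by (rule norm_cauchy_schwarz)
    also have "\<dots> \<le> norm x * (norm Y * norm x)" by (intro mult_left_mono norm_blinfun) auto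
    also have "\<dots> \<le> norm x * (1 * norm x)" using Y by (intro mult_left_mono mult_right_mono) auto
    finally have "0 \<le> x \<bullet> (x - Y x)"
      by (simp add: inner_simps power2_norm_eq_inner[symmetric] power2_eq_square)
    then show ?thesis using k1 unfolding Bv by (simp add: B_def)
  qed
  moreover have "matrix B ** matrix B = A"
  proof -
    have "B (B x) = A *v x" for x
    proof -
      have eq: "2 *\<^sub>R Y x = X0 x + Y (Y x)"
        using arg_cong[OF Y(3), of "\<lambda>Z. blinfun_apply Z x"] by (simp add: blinfun.bilinear_simps Xa)
      have "B (B x) = k\<^sub>1 *\<^sub>R (x - 2 *\<^sub>R Y x + Y (Y x))"
        using k1 by (simp add: B_def blinfun.bilinear_simps algebra_simps scaleR_2)
      also have "\<dots> = A *v x" unfolding eq using k1 by (simp add: X0_def algebra_simps)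
      finally show ?thesis .
    qed
    then show ?thesis by (simp add: matrix_eq matrix_vector_mul_assoc[symmetric] Bv)
  qed
  ultimately show ?thesis by blast
qed

lemma matrix_mult_inv_cancel:
  fixes A :: "real^'n^'n"
  assumes "invertible A"
  shows "A *v (matrix_inv A *v x) = x" "matrix_inv A *v (A *v x) = x"
proof -
  have "A ** matrix_inv A = mat 1 \<and> matrix_inv A ** A = mat 1"
    using assms someI_ex[of "\<lambda>B. A ** B = mat 1 \<and> B ** A = mat 1"]
    by (auto simp: invertible_def matrix_inv_def)
  then show "A *v (matrix_inv A *v x) = x" "matrix_inv A *v (A *v x) = x"
    by (simp_all add: matrix_vector_mul_assoc)
qed

context
  fixes A :: "real^'n^'n" and k\<^sub>0 k\<^sub>1 :: real
  assumes sym: "transpose A = A" and k: "0 < k\<^sub>0"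
    and bnd: "\<And>x. k\<^sub>0 * (norm x)\<^sup>2 \<le> x \<bullet> (A *v x) \<and> x \<bullet> (A *v x) \<le> k\<^sub>1 * (norm x)\<^sup>2"
begin

lemma matrix_sqrt_sym: "transpose (matrix_sqrt A) = matrix_sqrt A"
  and matrix_sqrt_square: "matrix_sqrt A ** matrix_sqrt A = A"
  using someI_ex[OF ex_matrix_sqrt[OF sym k bnd]] by (auto simp: matrix_sqrt_def)

lemma matrix_sqrt_sqrt: "matrix_sqrt A *v (matrix_sqrt A *v x) = A *v x"
  by (simp add: matrix_vector_mul_assoc matrix_sqrt_square)

lemma norm_matrix_sqrt: "(norm (matrix_sqrt A *v x))\<^sup>2 = x \<bullet> (A *v x)"
  by (metis matrix_sqrt_sqrt matrix_sqrt_sym power2_norm_eq_inner symmetric_matrix_inner)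

lemma coercive_invertible: "invertible A"
proof -
  have "x = 0" if "A *v x = 0" for x
    using bnd[of x] that k by (auto simp: mult_le_0_iff)
  then show ?thesis
    using matrix_left_invertible_ker invertible_left_inverse by blast
qed

lemma matrix_inv_sqrt_sqrt: "matrix_inv (matrix_sqrt A) *v (matrix_sqrt A *v x) = x"
  and matrix_sqrt_inv_sqrt: "matrix_sqrt A *v (matrix_inv (matrix_sqrt A) *v x) = x"
proof -
  have "invertible (matrix_sqrt A)"
    by (metis coercive_invertible invertible_det_nz matrix_sqrt_square det_mul mult_zero_left)
  then show "matrix_inv (matrix_sqrt A) *v (matrix_sqrt A *v x) = x"
    "matrix_sqrt A *v (matrix_inv (matrix_sqrt A) *v x) = x"
    by (simp_all add: matrix_mult_inv_cancel)
qed

lemma matrix_inv_sqrt_mult: "matrix_inv (matrix_sqrt A) *v (A *v x) = matrix_sqrt A *v x"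
  by (metis matrix_sqrt_sqrt matrix_inv_sqrt_sqrt)

lemma inner_matrix_sqrt_inv: "(matrix_sqrt A *v x) \<bullet> (matrix_inv (matrix_sqrt A) *v y) = x \<bullet> y"
  by (metis matrix_sqrt_inv_sqrt matrix_sqrt_sym symmetric_matrix_inner)

text \<open>
  The right hand side does not involve the chosen square root, so that it is measurable in the matrix.
\<close>

lemma norm_matrix_inv_sqrt:
  "(norm (matrix_inv (matrix_sqrt A) *v x))\<^sup>2 = (matrix_inv A *v x) \<bullet> x"
proof -
  define y where "y = matrix_inv A *v x"
  have "A *v y = x"
    using coercive_invertible by (simp add: y_def matrix_mult_inv_cancel)
  then show ?thesis
    by (metis y_def matrix_inv_sqrt_mult norm_matrix_sqrt)
qed

lemma norm_matrix_inv_sqrt_le: "(norm (matrix_inv (matrix_sqrt A) *v x))\<^sup>2 \<le> (norm x)\<^sup>2 / k\<^sub>0"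
proof -
  define y where "y = matrix_inv A *v x"
  have Ay: "A *v y = x"
    using coercive_invertible by (simp add: y_def matrix_mult_inv_cancel)
  have 1: "k\<^sub>0 * (norm y)\<^sup>2 \<le> y \<bullet> x" using bnd[of y] Ay by simp
  have 2: "y \<bullet> x \<le> norm y * norm x" by (rule norm_cauchy_schwarz)
  have "k\<^sub>0 * norm y \<le> norm x"
  proof (cases "y = 0")
    case False
    have "(k\<^sub>0 * norm y) * norm y \<le> norm x * norm y"
      using 1 2 by (simp add: power2_eq_square mult_ac)
    then show ?thesis using False by simp
  qed simp
  then have "norm y * norm x \<le> norm x / k\<^sub>0 * norm x"
    using k by (intro mult_right_mono) (auto simp: field_simps)
  then show ?thesis
    using 2 unfolding norm_matrix_inv_sqrt y_def[symmetric] by (simp add: power2_eq_square)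
qed

lemma norm_coercive_mult_le: "norm (A *v x) \<le> k\<^sub>1 * norm x"
proof (rule symmetric_form_norm_le[OF matrix_vector_mul_linear symmetric_matrix_inner[OF sym]])
  fix y
  show "y \<bullet> (A *v y) \<le> k\<^sub>1 * (norm y)\<^sup>2" using bnd by blast
  have "0 \<le> k\<^sub>0 * (norm y)\<^sup>2" using k by simp
  then show "0 \<le> y \<bullet> (A *v y)" using bnd[of y] by linarith
qed

end

text \<open>
  Cramer's rule exhibits the inverse as a rational function of the entries, hence as measurable.
\<close>

lemma matrix_inv_eq_cramer:
  fixes A :: "real^'n^'n"
  assumes "invertible A"
  shows "matrix_inv A *v b = (\<chi> k. det (\<chi> i j. if j = k then b $ i else A $ i $ j) / det A)"
proof -
  have "A *v (matrix_inv A *v b) = b"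
    using assms by (simp add: matrix_mult_inv_cancel)
  then show ?thesis using cramer[of A "matrix_inv A *v b" b] assms by (simp add: invertible_det_nz)
qed

lemma borel_measurable_vec_lambda:
  fixes g :: "'a \<Rightarrow> 'n::finite \<Rightarrow> real"
  assumes "\<And>i. (\<lambda>x. g x i) \<in> borel_measurable M"
  shows "(\<lambda>x. \<chi> i. g x i) \<in> borel_measurable M"
proof (rule borel_measurable_euclidean_space[THEN iffD2], rule ballI)
  fix b :: "real^'n" assume "b \<in> Basis"
  then obtain i where "b = axis i 1" by (auto simp: Basis_vec_def)
  then show "(\<lambda>x. (\<chi> i. g x i) \<bullet> b) \<in> borel_measurable M"
    using assms by (simp add: inner_axis)
qed

lemma borel_measurable_vec_nth' [measurable (raw)]:
  fixes g :: "'a \<Rightarrow> 'b::real_normed_vector^'n"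
  assumes "g \<in> borel_measurable M"
  shows "(\<lambda>x. g x $ i) \<in> borel_measurable M"
  by (rule borel_measurable_continuous_on[OF _ assms]) (intro continuous_intros)

lemma borel_measurable_det:
  fixes A :: "'a \<Rightarrow> real^'n^'n"
  assumes "\<And>i j. (\<lambda>x. A x $ i $ j) \<in> borel_measurable M"
  shows "(\<lambda>x. det (A x)) \<in> borel_measurable M"
  unfolding det_def using assms by (intro borel_measurable_sum borel_measurable_times borel_measurable_prod) auto

lemma borel_measurable_matrix_mult:
  fixes A :: "'a \<Rightarrow> real^'n^'n"
  assumes [measurable]: "A \<in> borel_measurable M" "b \<in> borel_measurable M"
  shows "(\<lambda>x. A x *v b x) \<in> borel_measurable M"
  unfolding matrix_vector_mult_def by (intro borel_measurable_vec_lambda) measurable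

lemma borel_measurable_matrix_inv_mult:
  fixes A :: "'a \<Rightarrow> real^'n^'n"
  assumes [measurable]: "A \<in> borel_measurable M" "b \<in> borel_measurable M"
    and inv: "\<And>x. x \<in> space M \<Longrightarrow> invertible (A x)"
  shows "(\<lambda>x. matrix_inv (A x) *v b x) \<in> borel_measurable M"
proof -
  have "(\<lambda>x. \<chi> k. det (\<chi> i j. if j = k then b x $ i else A x $ i $ j) / det (A x)) \<in> borel_measurable M"
    by (intro borel_measurable_vec_lambda borel_measurable_divide borel_measurable_det) auto
  then show ?thesis
    by (subst measurable_cong[where g="\<lambda>x. \<chi> k. det (\<chi> i j. if j = k then b x $ i else A x $ i $ j) / det (A x)"])
      (auto simp: matrix_inv_eq_cramer inv)
qed

section \<open>Normal fluxes on the contact boundary\<close>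

locale mixed_boundary = lipschitz_domain \<Omega> for \<Omega> :: "(real^'n) set" +
  fixes \<Gamma>\<^sub>D \<Gamma>\<^sub>C :: "(real^'n) set"
  assumes open_D: "openin (top_of_set (frontier \<Omega>)) \<Gamma>\<^sub>D"
    and open_C: "openin (top_of_set (frontier \<Omega>)) \<Gamma>\<^sub>C"
    and disj: "\<Gamma>\<^sub>D \<inter> \<Gamma>\<^sub>C = {}"
    and interface_null: "AE x in surface_on (frontier \<Omega>). x \<in> \<Gamma>\<^sub>D \<union> \<Gamma>\<^sub>C"
begin

abbreviation SC :: "(real^'n) measure" where "SC \<equiv> surface_on \<Gamma>\<^sub>C"
abbreviation SD :: "(real^'n) measure" where "SD \<equiv> surface_on \<Gamma>\<^sub>D"
abbreviation M :: "(real^'n) measure" where "M \<equiv> lebesgue_on \<Omega>"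

lemma openin_frontier:
  assumes "openin (top_of_set (frontier \<Omega>)) \<Gamma>"
  shows "\<Gamma> \<subseteq> frontier \<Omega>" "\<Gamma> \<in> sets borel" "closed (frontier \<Omega> - \<Gamma>)"
proof -
  obtain U where U: "open U" "\<Gamma> = frontier \<Omega> \<inter> U" using assms by (auto simp: openin_open)
  show "\<Gamma> \<subseteq> frontier \<Omega>" using U by blast
  show "\<Gamma> \<in> sets borel" unfolding U(2) using U(1) by (intro sets.Int borel_closed borel_open) auto
  have "frontier \<Omega> - \<Gamma> = frontier \<Omega> - U" using U by blast
  then show "closed (frontier \<Omega> - \<Gamma>)" using U(1) by (simp add: closed_Diff)
qed

lemmas \<Gamma>C = openin_frontier[OF open_C]
lemmas \<Gamma>D = openin_frontier[OF open_D]

lemma surface_restrict: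
  assumes "\<Gamma> \<subseteq> frontier \<Omega>" "\<Gamma> \<in> sets borel"
  shows "surface_on \<Gamma> = restrict_space S \<Gamma>" "\<Gamma> \<in> sets S"
proof -
  have "frontier \<Omega> \<inter> \<Gamma> = \<Gamma>" using assms(1) by blast
  then show "surface_on \<Gamma> = restrict_space S \<Gamma>"
    unfolding surface_on_def using assms by (subst restrict_restrict_space) auto
  show "\<Gamma> \<in> sets S" unfolding surface_on_def using assms by (subst sets_restrict_space_iff) auto
qed

lemma AE_part: "AE x in S. P x \<Longrightarrow> \<Gamma> \<subseteq> frontier \<Omega> \<Longrightarrow> \<Gamma> \<in> sets borel \<Longrightarrow> AE x in surface_on \<Gamma>. P x"
  by (auto simp: AE_surface_iff elim!: eventually_mono)

lemma AE_S_iff_part: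
  "\<Gamma> \<subseteq> frontier \<Omega> \<Longrightarrow> \<Gamma> \<in> sets borel \<Longrightarrow> (AE x in surface_on \<Gamma>. P x) \<longleftrightarrow> (AE x in S. x \<in> \<Gamma> \<longrightarrow> P x)"
  by (auto simp: AE_surface_iff elim!: eventually_mono)

lemma measurable_SC: "g \<in> borel_measurable S \<Longrightarrow> g \<in> borel_measurable SC"
  by (simp add: surface_restrict[OF \<Gamma>C(1,2)] measurable_restrict_space1)

lemma finite_SC: "finite_measure SC"
  using surface_restrict[OF \<Gamma>C(1,2)] finite_S finite_measure_restrict_space by metis

lemma L2_S_imp_SC: "g \<in> L2 S \<Longrightarrow> g \<in> L2 SC" for g :: "real^'n \<Rightarrow> real"
proof -
  assume g: "g \<in> L2 S"
  have "integrable SC (\<lambda>x. (norm (g x))\<^sup>2)"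
    using integrable_mult_indicator[OF surface_restrict(2)[OF \<Gamma>C(1,2)] L2_D(2)[OF g]] surface_restrict(2)[OF \<Gamma>C(1,2)]
    by (simp add: surface_restrict(1)[OF \<Gamma>C(1,2)] integrable_restrict_space sets.Int_space_eq2 Int_commute)
  then show ?thesis using measurable_SC[OF L2_D(1)[OF g]] by (simp add: L2_def)
qed

lemma trace_AE_SC: "AE x in S. P x \<Longrightarrow> AE x in SC. P x"
  by (rule AE_part) (use \<Gamma>C in auto)

lemma zero_ext_measurable:
  assumes "g \<in> borel_measurable S"
  shows "zero_ext \<Gamma>\<^sub>C g \<in> borel_measurable S"
proof -
  have [measurable]: "\<Gamma>\<^sub>C \<in> sets S" by (rule surface_restrict(2)[OF \<Gamma>C(1,2)])
  have "(\<lambda>x. indicator \<Gamma>\<^sub>C x * g x) \<in> borel_measurable S" using assms by measurable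
  moreover have "(\<lambda>x. indicator \<Gamma>\<^sub>C x * g x) = zero_ext \<Gamma>\<^sub>C g" by (auto simp: zero_ext_def fun_eq_iff)
  ultimately show ?thesis by simp
qed

text \<open>
  The points of the boundary outside both parts form a null set.
\<close>

lemma zero_ext_AE_eq:
  assumes "AE x in SD. g x = 0"
  shows "AE x in S. g x = zero_ext \<Gamma>\<^sub>C g x"
proof -
  have "AE x in S. x \<in> \<Gamma>\<^sub>D \<longrightarrow> g x = 0" using assms AE_S_iff_part[OF \<Gamma>D(1,2)] by simp
  with interface_null show ?thesis
    by eventually_elim (auto simp: zero_ext_def)
qed

text \<open>
  The trace \<open>g\<close> agrees almost everywhere with its zero extension from the contact boundary, which is thus a trace of
  \<open>w\<close> as well and an admissible argument of the flux condition.
\<close>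

lemma green_on_contact:
  assumes fl: "has_flux \<Omega> \<Gamma>\<^sub>C v h" and t: "has_trace \<Omega> w g" and g0: "AE x in SD. g x = 0"
  shows "L2_inner M v (weak_grad \<Omega> w) + L2_inner M (weak_div \<Omega> v) w = L2_inner SC h g"
proof -
  obtain T where T: "has_normal_trace \<Omega> v T"
    "\<And>\<eta>. \<eta> \<in> H_half_00 \<Omega> \<Gamma>\<^sub>C \<Longrightarrow> T (zero_ext \<Gamma>\<^sub>C \<eta>) = L2_inner SC h \<eta>"
    using fl unfolding has_flux_def by blast
  note H = has_trace_D[OF t]
  have zm: "zero_ext \<Gamma>\<^sub>C g \<in> borel_measurable S" by (rule zero_ext_measurable[OF L2_D(1)[OF H(2)]])
  have tz: "has_trace \<Omega> w (zero_ext \<Gamma>\<^sub>C g)" by (rule has_trace_cong[OF t zm zero_ext_AE_eq[OF g0]])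
  have "g \<in> H_half \<Omega> \<Gamma>\<^sub>C"
    unfolding H_half_def trace_equals_on_def using H t L2_D(1)[OF L2_S_imp_SC[OF H(2)]] by auto
  moreover have "zero_ext \<Gamma>\<^sub>C g \<in> H_half \<Omega> (frontier \<Omega>)"
    unfolding H_half_def trace_equals_on_def using H(1) tz zm by auto
  ultimately have "T (zero_ext \<Gamma>\<^sub>C g) = L2_inner SC h g" by (intro T(2)) (simp add: H_half_00_def)
  moreover have "T (zero_ext \<Gamma>\<^sub>C g) = L2_inner M v (weak_grad \<Omega> w) + L2_inner M (weak_div \<Omega> v) w"
    using T(1) H(1) tz unfolding has_normal_trace_def by blast
  ultimately show ?thesis by simp
qed

text \<open>
  Smooth functions supported away from the rest of the boundary are admissible in Green's formula, and there are enough
  of them for the fundamental lemma because the contact boundary is relatively open.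
\<close>

lemma flux_unique:
  assumes h1: "has_flux \<Omega> \<Gamma>\<^sub>C v h\<^sub>1" and h2: "has_flux \<Omega> \<Gamma>\<^sub>C v h\<^sub>2"
  shows "AE x in SC. h\<^sub>1 x = h\<^sub>2 x"
proof -
  let ?H = "hausdorff_measure (CARD('n) - 1) :: (real^'n) measure"
  \<comment> \<open>An open set whose intersection with the boundary is the contact part.\<close>
  define O' where "O' = - (frontier \<Omega> - \<Gamma>\<^sub>C)"
  have O': "open O'" unfolding O'_def by (rule open_Compl[OF \<Gamma>C(3)])
  have L: "h\<^sub>1 \<in> L2 SC" "h\<^sub>2 \<in> L2 SC" using h1 h2 by (simp_all add: has_flux_def)
  have Hs: "\<Gamma>\<^sub>C \<inter> space ?H \<in> sets ?H" using \<Gamma>C(2) by simp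
  define k where "k x = indicator \<Gamma>\<^sub>C x *\<^sub>R (h\<^sub>1 x - h\<^sub>2 x)" for x
  have "integrable SC (\<lambda>x. h\<^sub>1 x - h\<^sub>2 x)" by (rule L2_integrable[OF finite_SC L2_diff[OF L]])
  moreover have "integrable (restrict_space ?H \<Gamma>\<^sub>C) (\<lambda>x. h\<^sub>1 x - h\<^sub>2 x) \<longleftrightarrow> integrable ?H k"
    unfolding k_def[abs_def] by (rule integrable_restrict_space[OF Hs])
  ultimately have ki: "integrable ?H k" unfolding surface_on_def by blast
  have "AE x in ?H. x \<in> O' \<longrightarrow> k x = 0"
  proof (rule fundamental_lemma_borel[OF _ ki O'])
    fix \<phi> assume \<phi>: "test_function O' \<phi>"
    note sup = test_function_support[OF \<phi>]
    have t: "has_trace \<Omega> \<phi> \<phi>" by (rule has_trace_smooth[OF sup(1)])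
    have "\<phi> x = 0" if "x \<in> \<Gamma>\<^sub>D" for x
      using that disj \<Gamma>D(1) by (intro sup(3)) (auto simp: O'_def)
    then have g0: "AE x in SD. \<phi> x = 0"
      by (intro AE_I2) (simp add: surface_on_def space_restrict_space)
    have \<phi>L: "\<phi> \<in> L2 SC" by (rule L2_S_imp_SC[OF has_trace_D(2)[OF t]])
    have "L2_inner SC h\<^sub>1 \<phi> = L2_inner SC h\<^sub>2 \<phi>"
      using green_on_contact[OF h1 t g0] green_on_contact[OF h2 t g0] by simp
    then have "(\<integral>x. (h\<^sub>1 x - h\<^sub>2 x) * \<phi> x \<partial>SC) = 0"
      using L2_mult_integrable[OF L(1) \<phi>L] L2_mult_integrable[OF L(2) \<phi>L]
      by (simp add: L2_inner_def left_diff_distrib)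
    moreover have "(\<integral>x. (h\<^sub>1 x - h\<^sub>2 x) * \<phi> x \<partial>SC) = (\<integral>x. indicator \<Gamma>\<^sub>C x *\<^sub>R ((h\<^sub>1 x - h\<^sub>2 x) * \<phi> x) \<partial>?H)"
      unfolding surface_on_def by (rule integral_restrict_space[OF Hs])
    moreover have "(\<integral>x. indicator \<Gamma>\<^sub>C x *\<^sub>R ((h\<^sub>1 x - h\<^sub>2 x) * \<phi> x) \<partial>?H) = (\<integral>x. k x * \<phi> x \<partial>?H)"
      by (simp add: k_def mult.assoc)
    ultimately show "(\<integral>x. k x * \<phi> x \<partial>?H) = 0" by simp
  qed simp
  then show ?thesis
    unfolding AE_surface_iff[OF \<Gamma>C(2)] by eventually_elim (auto simp: k_def O'_def)
qed

lemma has_flux_flux: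
  assumes "v \<in> V_space \<Omega> \<Gamma>\<^sub>C" shows "has_flux \<Omega> \<Gamma>\<^sub>C v (flux \<Omega> \<Gamma>\<^sub>C v)"
  using assms someI_ex[of "has_flux \<Omega> \<Gamma>\<^sub>C v"] by (simp add: V_space_def flux_def)

end

section \<open>The contact energy density\<close>

text \<open>
  For \<open>a \<le> b\<close> this is \<open>max (a * t) (b * t)\<close>, the support function of the interval \<open>{a..b}\<close>.
\<close>

definition contact_density :: "real \<Rightarrow> real \<Rightarrow> real \<Rightarrow> real" where
  "contact_density a b t = b * pos_part t - a * neg_part t"

text \<open>
  The one-sided derivative of \<open>contact_density a b\<close> at \<open>t\<close> in direction \<open>s\<close>.
\<close>

definition contact_slope :: "real \<Rightarrow> real \<Rightarrow> real \<Rightarrow> real \<Rightarrow> real" where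
  "contact_slope a b t s = (if 0 < t then b * s else if t < 0 then a * s else contact_density a b s)"

lemma contact_density_bound: "\<bar>contact_density a b (t + s) - contact_density a b t\<bar> \<le> (\<bar>a\<bar> + \<bar>b\<bar>) * \<bar>s\<bar>"
proof -
  have "contact_density a b (t + s) - contact_density a b t =
      b * (pos_part (t + s) - pos_part t) - a * (neg_part (t + s) - neg_part t)"
    by (simp add: contact_density_def algebra_simps)
  also have "\<bar>\<dots>\<bar> \<le> \<bar>b\<bar> * \<bar>pos_part (t + s) - pos_part t\<bar> + \<bar>a\<bar> * \<bar>neg_part (t + s) - neg_part t\<bar>"
    by (metis abs_mult abs_triangle_ineq4)
  also have "\<dots> \<le> \<bar>b\<bar> * \<bar>s\<bar> + \<bar>a\<bar> * \<bar>s\<bar>"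
    by (intro add_mono mult_left_mono) (auto simp: pos_part_def neg_part_def)
  finally show ?thesis by (simp add: algebra_simps)
qed

lemma contact_density_difference_quotient:
  assumes \<tau>: "\<tau> \<longlonglongrightarrow> 0" "\<And>n. 0 < \<tau> n"
  shows "(\<lambda>n. (contact_density a b (t + \<tau> n * s) - contact_density a b t) / \<tau> n) \<longlonglongrightarrow> contact_slope a b t s"
proof -
  have lim: "(\<lambda>n. t + \<tau> n * s) \<longlonglongrightarrow> t"
    using tendsto_add[OF tendsto_const tendsto_mult[OF \<tau>(1) tendsto_const], of t s] by simp
  have "\<forall>\<^sub>F n in sequentially. (contact_density a b (t + \<tau> n * s) - contact_density a b t) / \<tau> n = contact_slope a b t s"
  proof -
    consider "0 < t" | "t < 0" | "t = 0" by linarith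
    then show ?thesis
    proof cases
      case 1
      have "\<forall>\<^sub>F n in sequentially. 0 < t + \<tau> n * s" using order_tendstoD(1)[OF lim 1] .
      then show ?thesis
      proof eventually_elim
        case (elim n)
        then show ?case using 1 \<tau>(2)[of n]
          by (simp add: contact_density_def contact_slope_def pos_part_def neg_part_def field_simps)
      qed
    next
      case 2
      have "\<forall>\<^sub>F n in sequentially. t + \<tau> n * s < 0" using order_tendstoD(2)[OF lim 2] .
      then show ?thesis
      proof eventually_elim
        case (elim n)
        then show ?case using 2 \<tau>(2)[of n]
          by (simp add: contact_density_def contact_slope_def pos_part_def neg_part_def field_simps)
      qed
    next
      case 3
      have "contact_density a b (\<tau> n * s) = \<tau> n * contact_density a b s" for n
        using \<tau>(2)[of n] by (simp add: contact_density_def pos_part_def neg_part_def max_def zero_le_mult_iff mult_le_0_iff algebra_simps)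
      then have "(contact_density a b (t + \<tau> n * s) - contact_density a b t) / \<tau> n = contact_slope a b t s" for n
        using 3 \<tau>(2)[of n] by (simp add: contact_slope_def) (simp add: contact_density_def pos_part_def neg_part_def)
      then show ?thesis by simp
    qed
  qed
  then show ?thesis by (rule tendsto_eventually)
qed

lemma contact_slope_subadditive: "a \<le> b \<Longrightarrow> contact_slope a b t (s + s') \<le> contact_slope a b t s + contact_slope a b t s'"
proof -
  assume ab: "a \<le> b"
  have e: "contact_density a b r = max (a * r) (b * r)" for r
    using ab mult_right_mono[of a b r] mult_right_mono_neg[of a b r]
    by (cases "0 \<le> r") (auto simp: contact_density_def pos_part_def neg_part_def max_def)
  show ?thesis by (simp add: contact_slope_def e distrib_left) (simp add: max_def)
qed

lemma contact_slope_scale: "0 < c \<Longrightarrow> contact_slope a b t (c * s) = c * contact_slope a b t s"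
  by (simp add: contact_slope_def contact_density_def pos_part_def neg_part_def max_def
      zero_le_mult_iff mult_le_0_iff algebra_simps)

lemma contact_slope_bound: "\<bar>contact_slope a b t s\<bar> \<le> (\<bar>a\<bar> + \<bar>b\<bar>) * \<bar>s\<bar>"
proof -
  have 1: "\<bar>contact_density a b s\<bar> \<le> (\<bar>a\<bar> + \<bar>b\<bar>) * \<bar>s\<bar>"
    using contact_density_bound[of a b 0 s] by (simp add: contact_density_def pos_part_def neg_part_def)
  have 2: "\<bar>b * s\<bar> \<le> (\<bar>a\<bar> + \<bar>b\<bar>) * \<bar>s\<bar>" "\<bar>a * s\<bar> \<le> (\<bar>a\<bar> + \<bar>b\<bar>) * \<bar>s\<bar>"
    by (auto simp: abs_mult distrib_right)
  show ?thesis using 1 2 by (simp add: contact_slope_def)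
qed

lemma contact_slope_le: "a \<le> b \<Longrightarrow> 0 \<le> s \<Longrightarrow> contact_slope a b t s \<le> b * s"
  and contact_slope_le_neg: "a \<le> b \<Longrightarrow> 0 \<le> s \<Longrightarrow> contact_slope a b t (- s) \<le> - (a * s)"
  by (auto simp: contact_slope_def contact_density_def pos_part_def neg_part_def mult_right_mono)

lemma contact_slope_self: "contact_slope a b t t = contact_density a b t"
  "contact_slope a b t (- t) = - contact_density a b t"
  by (auto simp: contact_slope_def contact_density_def pos_part_def neg_part_def)

lemma contact_slope_0: "contact_slope a b t 0 = 0"
  by (simp add: contact_slope_def contact_density_def pos_part_def neg_part_def)

lemma borel_measurable_contact [measurable]:
  assumes [measurable]: "a \<in> borel_measurable M" "b \<in> borel_measurable M" "t \<in> borel_measurable M" "s \<in> borel_measurable M"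
  shows "(\<lambda>x. contact_density (a x) (b x) (t x)) \<in> borel_measurable M"
    and "(\<lambda>x. contact_slope (a x) (b x) (t x) (s x)) \<in> borel_measurable M"
  unfolding contact_slope_def contact_density_def pos_part_def neg_part_def by measurable

section \<open>The gap identity\<close>

locale mixed_problem = mixed_boundary \<Omega> \<Gamma>\<^sub>D \<Gamma>\<^sub>C for \<Omega> \<Gamma>\<^sub>D \<Gamma>\<^sub>C :: "(real^'n) set" +
  fixes f p\<^sub>D \<alpha> \<beta> :: "real^'n \<Rightarrow> real" and K :: "real^'n \<Rightarrow> real^'n^'n" and k\<^sub>0 k\<^sub>1 :: real
  assumes f: "f \<in> L2 M"
    and p\<^sub>D: "p\<^sub>D \<in> H_half \<Omega> \<Gamma>\<^sub>D"
    and K_meas: "K \<in> borel_measurable M"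
    and K_sym: "\<And>x. x \<in> \<Omega> \<Longrightarrow> transpose (K x) = K x"
    and k0: "0 < k\<^sub>0"
    and K_bounds: "\<And>x \<xi>. x \<in> \<Omega> \<Longrightarrow>
          k\<^sub>0 * (norm \<xi>)\<^sup>2 \<le> \<xi> \<bullet> (K x *v \<xi>) \<and> \<xi> \<bullet> (K x *v \<xi>) \<le> k\<^sub>1 * (norm \<xi>)\<^sup>2"
    and \<alpha>: "\<alpha> \<in> L2 SC"
    and \<beta>: "\<beta> \<in> L2 SC"
    and \<alpha>_le_\<beta>: "AE x in SC. \<alpha> x \<le> \<beta> x"
begin

abbreviation "I \<equiv> primal_energy \<Omega> \<Gamma>\<^sub>C K f \<alpha> \<beta>"
abbreviation "D \<equiv> dual_energy \<Omega> \<Gamma>\<^sub>D \<Gamma>\<^sub>C K f p\<^sub>D"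
abbreviation "primal \<equiv> primal_set \<Omega> \<Gamma>\<^sub>D p\<^sub>D"
abbreviation "dual \<equiv> dual_set \<Omega> \<Gamma>\<^sub>C f \<alpha> \<beta>"

lemmas sqrt_K = norm_matrix_sqrt[OF K_sym k0 K_bounds]
  and inv_sqrt_K_le = norm_matrix_inv_sqrt_le[OF K_sym k0 K_bounds]
  and inv_sqrt_K = norm_matrix_inv_sqrt[OF K_sym k0 K_bounds]
  and sqrt_K_inner = inner_matrix_sqrt_inv[OF K_sym k0 K_bounds]
  and inv_sqrt_K_mult = matrix_inv_sqrt_mult[OF K_sym k0 K_bounds]
  and K_norm_le = norm_coercive_mult_le[OF K_sym k0 K_bounds]
  and K_invertible = coercive_invertible[OF K_sym k0 K_bounds]

lemma K_mult_L2:
  assumes "G \<in> L2 M" shows "(\<lambda>x. K x *v G x) \<in> L2 M"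
proof (rule L2_bound[OF assms, of _ k\<^sub>1])
  show "(\<lambda>x. K x *v G x) \<in> borel_measurable M"
    by (rule borel_measurable_matrix_mult[OF K_meas L2_D(1)[OF assms]])
  show "AE x in M. norm (K x *v G x) \<le> k\<^sub>1 * norm (G x)"
    by (intro AE_I2) (simp add: K_norm_le)
qed

lemma integral_sqrt_K:
  "L2_norm_sq M (\<lambda>x. matrix_sqrt (K x) *v G x) = L2_inner M (\<lambda>x. K x *v G x) G"
  unfolding L2_norm_sq_def L2_inner_def
  by (intro Bochner_Integration.integral_cong) (simp_all add: sqrt_K inner_commute)

lemma integrable_sqrt_K:
  assumes "G \<in> L2 M" shows "integrable M (\<lambda>x. (norm (matrix_sqrt (K x) *v G x))\<^sup>2)"
  using L2_inner_integrable[OF K_mult_L2[OF assms] assms]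
  by (subst Bochner_Integration.integrable_cong[OF refl, of _ _ "\<lambda>x. (K x *v G x) \<bullet> G x"])
    (simp_all add: sqrt_K inner_commute)

lemma integrable_inv_sqrt_K:
  assumes "v \<in> L2 M" shows "integrable M (\<lambda>x. (norm (matrix_inv (matrix_sqrt (K x)) *v v x))\<^sup>2)"
proof (rule Bochner_Integration.integrable_bound)
  show "integrable M (\<lambda>x. (norm (v x))\<^sup>2 / k\<^sub>0)" using L2_D(2)[OF assms] by simp
  have [measurable]: "(\<lambda>x. matrix_inv (K x) *v v x) \<in> borel_measurable M"
    using K_meas L2_D(1)[OF assms] K_invertible by (intro borel_measurable_matrix_inv_mult) auto
  have [measurable]: "v \<in> borel_measurable M" by (rule L2_D(1)[OF assms])
  have "(\<lambda>x. (matrix_inv (K x) *v v x) \<bullet> v x) \<in> borel_measurable M" by measurable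
  then show "(\<lambda>x. (norm (matrix_inv (matrix_sqrt (K x)) *v v x))\<^sup>2) \<in> borel_measurable M"
    by (subst measurable_cong[where g="\<lambda>x. (matrix_inv (K x) *v v x) \<bullet> v x"]) (simp_all add: inv_sqrt_K)
  show "AE x in M. norm ((norm (matrix_inv (matrix_sqrt (K x)) *v v x))\<^sup>2) \<le> norm ((norm (v x))\<^sup>2 / k\<^sub>0)"
    using k0 by (intro AE_I2) (simp add: inv_sqrt_K_le)
qed

lemma primal_trace:
  assumes "q \<in> primal"
  shows "q \<in> H1 \<Omega>" "has_trace \<Omega> q (trace_op \<Omega> q)" "AE x in SD. trace_op \<Omega> q x = p\<^sub>D x"
proof -
  obtain g where g: "has_trace \<Omega> q g" "AE x in SD. g x = p\<^sub>D x"
    using assms by (auto simp: primal_set_def trace_equals_on_def)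
  show "q \<in> H1 \<Omega>" by (rule has_trace_D(1)[OF g(1)])
  show "has_trace \<Omega> q (trace_op \<Omega> q)" by (rule has_trace_trace_op(1)[OF g(1)])
  have "AE x in SD. trace_op \<Omega> q x = g x"
    by (rule AE_part[OF has_trace_trace_op(2)[OF g(1)] \<Gamma>D(1,2)])
  with g(2) show "AE x in SD. trace_op \<Omega> q x = p\<^sub>D x" by eventually_elim simp
qed

lemma dual_facts:
  assumes "v \<in> dual"
  shows "v \<in> L2 M" "AE x in M. weak_div \<Omega> v x = f x" "weak_div \<Omega> v \<in> L2 M"
    "has_flux \<Omega> \<Gamma>\<^sub>C v (flux \<Omega> \<Gamma>\<^sub>C v)" "flux \<Omega> \<Gamma>\<^sub>C v \<in> L2 SC"
    "AE x in SC. \<alpha> x \<le> flux \<Omega> \<Gamma>\<^sub>C v x \<and> flux \<Omega> \<Gamma>\<^sub>C v x \<le> \<beta> x"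
proof -
  have V: "v \<in> V_space \<Omega> \<Gamma>\<^sub>C" using assms by (simp add: dual_set_def)
  then show "v \<in> L2 M" by (simp add: V_space_def Hdiv_def)
  show "AE x in M. weak_div \<Omega> v x = f x" using assms by (simp add: dual_set_def)
  show "AE x in SC. \<alpha> x \<le> flux \<Omega> \<Gamma>\<^sub>C v x \<and> flux \<Omega> \<Gamma>\<^sub>C v x \<le> \<beta> x" using assms by (simp add: dual_set_def)
  show fl: "has_flux \<Omega> \<Gamma>\<^sub>C v (flux \<Omega> \<Gamma>\<^sub>C v)" by (rule has_flux_flux[OF V])
  then show "flux \<Omega> \<Gamma>\<^sub>C v \<in> L2 SC" by (simp add: has_flux_def)
  show "weak_div \<Omega> v \<in> L2 M" using V weak_div_unique(1) by (auto simp: V_space_def Hdiv_def)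
qed

lemma trace_L2_SC: "has_trace \<Omega> w g \<Longrightarrow> g \<in> L2 SC"
  by (rule L2_S_imp_SC[OF has_trace_D(2)])

lemma pos_neg_L2:
  assumes "g \<in> L2 SC"
  shows "(\<lambda>x. pos_part (g x)) \<in> L2 SC" "(\<lambda>x. neg_part (g x)) \<in> L2 SC"
proof -
  note [measurable] = L2_D(1)[OF assms]
  show "(\<lambda>x. pos_part (g x)) \<in> L2 SC" "(\<lambda>x. neg_part (g x)) \<in> L2 SC"
    unfolding pos_part_def neg_part_def by (rule L2_bound[OF assms, of _ 1]; auto)+
qed

lemma contact_integral:
  assumes g: "g \<in> L2 SC"
  shows "integrable SC (\<lambda>x. contact_density (\<alpha> x) (\<beta> x) (g x))"
    "L2_inner SC \<beta> (\<lambda>x. pos_part (g x)) - L2_inner SC \<alpha> (\<lambda>x. neg_part (g x)) =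
      (\<integral>x. contact_density (\<alpha> x) (\<beta> x) (g x) \<partial>SC)"
  using L2_mult_integrable[OF \<beta> pos_neg_L2(1)[OF g]] L2_mult_integrable[OF \<alpha> pos_neg_L2(2)[OF g]]
  by (simp_all add: contact_density_def L2_inner_def)

lemma primal_energy_eq:
  assumes t: "has_trace \<Omega> q g"
  shows "I q = (1/2) * L2_inner M (\<lambda>x. K x *v weak_grad \<Omega> q x) (weak_grad \<Omega> q) - L2_inner M f q
    + (\<integral>x. contact_density (\<alpha> x) (\<beta> x) (g x) \<partial>SC)"
proof -
  have tt: "has_trace \<Omega> q (trace_op \<Omega> q)" "AE x in SC. trace_op \<Omega> q x = g x"
    by (rule has_trace_trace_op(1)[OF t], rule trace_AE_SC[OF has_trace_trace_op(2)[OF t]])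
  have [measurable]: "\<alpha> \<in> borel_measurable SC" "\<beta> \<in> borel_measurable SC" "g \<in> borel_measurable SC" "trace_op \<Omega> q \<in> borel_measurable SC"
    using \<alpha> \<beta> trace_L2_SC[OF t] trace_L2_SC[OF tt(1)] by (simp_all add: L2_D(1))
  have "(\<integral>x. contact_density (\<alpha> x) (\<beta> x) (trace_op \<Omega> q x) \<partial>SC) = (\<integral>x. contact_density (\<alpha> x) (\<beta> x) (g x) \<partial>SC)"
    using tt(2) by (intro integral_cong_AE) (auto elim!: eventually_mono)
  then show ?thesis
    using contact_integral(2)[OF trace_L2_SC[OF tt(1)]] by (simp add: primal_energy_def integral_sqrt_K)
qed

lemma weak_grad_lincomb_inner:
  assumes G: "G \<in> L2 M" and w: "w \<in> H1 \<Omega>" "w' \<in> H1 \<Omega>"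
  shows "L2_inner M G (weak_grad \<Omega> (\<lambda>x. w x + c * w' x)) =
    L2_inner M G (weak_grad \<Omega> w) + c * L2_inner M G (weak_grad \<Omega> w')"
proof -
  have "L2_inner M G (weak_grad \<Omega> (\<lambda>x. w x + c * w' x)) = L2_inner M G (\<lambda>x. weak_grad \<Omega> w x + c *\<^sub>R weak_grad \<Omega> w' x)"
    by (rule L2_inner_AE_cong[OF _ weak_grad_lincomb[OF w]])
      (auto intro!: L2_D(1)[OF G] L2_D(1)[OF L2_lincomb[OF weak_grad_L2 weak_grad_L2]] L2_D(1)[OF weak_grad_L2] H1_lincomb w)
  then show ?thesis using L2_inner_lincomb_right[OF G weak_grad_L2[OF w(1)] weak_grad_L2[OF w(2)]] by simp
qed

text \<open>
  The gap is a sum of a squared residual of the constitutive law and of the complementarity residual on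
  the contact boundary. It follows by testing the divergence equation with \<open>q - P\<close> for a lifting \<open>P\<close>
  of the Dirichlet datum.
\<close>

lemma gap_identity:
  assumes q: "q \<in> primal" and v: "v \<in> dual"
  shows "I q - D v =
    (1/2) * (\<integral>x. (norm (matrix_sqrt (K x) *v weak_grad \<Omega> q x + matrix_inv (matrix_sqrt (K x)) *v v x))\<^sup>2 \<partial>M)
    + (\<integral>x. contact_density (\<alpha> x) (\<beta> x) (trace_op \<Omega> q x) - flux \<Omega> \<Gamma>\<^sub>C v x * trace_op \<Omega> q x \<partial>SC)"
proof -
  note Q = primal_trace[OF q] and V = dual_facts[OF v]
  define P where "P = (SOME P. P \<in> H1 \<Omega> \<and> trace_equals_on \<Omega> \<Gamma>\<^sub>D P p\<^sub>D)"
  have "\<exists>P. P \<in> H1 \<Omega> \<and> trace_equals_on \<Omega> \<Gamma>\<^sub>D P p\<^sub>D" using p\<^sub>D by (auto simp: H_half_def)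
  then have "P \<in> primal" unfolding P_def primal_set_def by (rule someI2_ex) simp
  note P = primal_trace[OF this]
  define g gP h where "g = trace_op \<Omega> q" and "gP = trace_op \<Omega> P" and "h = flux \<Omega> \<Gamma>\<^sub>C v"
  have G: "weak_grad \<Omega> q \<in> L2 M" "weak_grad \<Omega> P \<in> L2 M" using Q P by (simp_all add: weak_grad_L2)
  have L: "q \<in> L2 M" "P \<in> L2 M" using Q P by (simp_all add: H1_L2)
  have gL: "g \<in> L2 SC" "gP \<in> L2 SC" using Q P by (simp_all add: g_def gP_def trace_L2_SC)
  have hL: "h \<in> L2 SC" using V by (simp add: h_def)
  have t: "has_trace \<Omega> (\<lambda>x. q x + (-1) * P x) (\<lambda>x. g x + (-1) * gP x)"
    unfolding g_def gP_def by (rule has_trace_lincomb[OF Q(2) P(2)])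
  have g0: "AE x in SD. g x + (-1) * gP x = 0"
    using Q(3) P(3) unfolding g_def gP_def by eventually_elim simp
  have "L2_inner M v (weak_grad \<Omega> (\<lambda>x. q x + (-1) * P x)) + L2_inner M (weak_div \<Omega> v) (\<lambda>x. q x + (-1) * P x)
      = L2_inner SC h (\<lambda>x. g x + (-1) * gP x)"
    unfolding h_def by (rule green_on_contact[OF V(4) t g0])
  moreover have "L2_inner M v (weak_grad \<Omega> (\<lambda>x. q x + (-1) * P x)) =
      L2_inner M v (weak_grad \<Omega> q) + (-1) * L2_inner M v (weak_grad \<Omega> P)"
    by (rule weak_grad_lincomb_inner[OF V(1) Q(1) P(1)])
  moreover have "L2_inner M (weak_div \<Omega> v) (\<lambda>x. q x + (-1) * P x) = L2_inner M f q + (-1) * L2_inner M f P"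
  proof -
    have "L2_inner M (weak_div \<Omega> v) (\<lambda>x. q x + (-1) * P x) = L2_inner M f (\<lambda>x. q x + (-1) * P x)"
      by (rule L2_inner_AE_cong[OF V(2)]) (auto intro!: L2_D(1)[OF V(3)] L2_D(1)[OF f] L2_D(1)[OF L2_diff[OF L]])
    then show ?thesis using L2_inner_lincomb_right_real[OF f L, of "-1"] by simp
  qed
  moreover have "L2_inner SC h (\<lambda>x. g x + (-1) * gP x) = L2_inner SC h g + (-1) * L2_inner SC h gP"
    by (rule L2_inner_lincomb_right_real[OF hL gL])
  moreover have "dirichlet_pairing \<Omega> \<Gamma>\<^sub>D \<Gamma>\<^sub>C f p\<^sub>D v = L2_inner M v (weak_grad \<Omega> P) + L2_inner M f P - L2_inner SC h gP"
    by (simp add: dirichlet_pairing_def Let_def P_def[symmetric] h_def gP_def)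
  ultimately have pair: "dirichlet_pairing \<Omega> \<Gamma>\<^sub>D \<Gamma>\<^sub>C f p\<^sub>D v =
      L2_inner M v (weak_grad \<Omega> q) + L2_inner M f q - L2_inner SC h g" by simp
  have "(\<integral>x. (norm (matrix_sqrt (K x) *v weak_grad \<Omega> q x + matrix_inv (matrix_sqrt (K x)) *v v x))\<^sup>2 \<partial>M) =
      (\<integral>x. (norm (matrix_sqrt (K x) *v weak_grad \<Omega> q x))\<^sup>2 + (norm (matrix_inv (matrix_sqrt (K x)) *v v x))\<^sup>2
        + 2 * (v x \<bullet> weak_grad \<Omega> q x) \<partial>M)"
  proof (intro Bochner_Integration.integral_cong refl)
    fix x assume "x \<in> space M"
    then have x: "x \<in> \<Omega>" by simp
    have "(norm (a + b))\<^sup>2 = (norm a)\<^sup>2 + (norm b)\<^sup>2 + 2 * (a \<bullet> b)" for a b :: "real^'n"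
      by (simp add: power2_norm_eq_inner inner_simps inner_commute)
    then show "(norm (matrix_sqrt (K x) *v weak_grad \<Omega> q x + matrix_inv (matrix_sqrt (K x)) *v v x))\<^sup>2 =
      (norm (matrix_sqrt (K x) *v weak_grad \<Omega> q x))\<^sup>2 + (norm (matrix_inv (matrix_sqrt (K x)) *v v x))\<^sup>2
        + 2 * (v x \<bullet> weak_grad \<Omega> q x)"
      using sqrt_K_inner[OF x x] by (simp add: inner_commute[of "v x"])
  qed
  also have "\<dots> = L2_norm_sq M (\<lambda>x. matrix_sqrt (K x) *v weak_grad \<Omega> q x)
      + L2_norm_sq M (\<lambda>x. matrix_inv (matrix_sqrt (K x)) *v v x) + 2 * L2_inner M v (weak_grad \<Omega> q)"
    using integrable_sqrt_K[OF G(1)] integrable_inv_sqrt_K[OF V(1)] L2_inner_integrable[OF V(1) G(1)]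
    by (simp add: L2_norm_sq_def L2_inner_def)
  finally have sq: "(\<integral>x. (norm (matrix_sqrt (K x) *v weak_grad \<Omega> q x + matrix_inv (matrix_sqrt (K x)) *v v x))\<^sup>2 \<partial>M) =
      L2_norm_sq M (\<lambda>x. matrix_sqrt (K x) *v weak_grad \<Omega> q x)
      + L2_norm_sq M (\<lambda>x. matrix_inv (matrix_sqrt (K x)) *v v x) + 2 * L2_inner M v (weak_grad \<Omega> q)" .
  have con: "(\<integral>x. contact_density (\<alpha> x) (\<beta> x) (g x) - h x * g x \<partial>SC) =
      L2_inner SC \<beta> (\<lambda>x. pos_part (g x)) - L2_inner SC \<alpha> (\<lambda>x. neg_part (g x)) - L2_inner SC h g"
    using contact_integral[OF gL(1)] L2_mult_integrable[OF hL gL(1)] by (simp add: L2_inner_def)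
  show ?thesis
    unfolding sq con[unfolded g_def h_def]
    using pair by (simp add: primal_energy_def dual_energy_def g_def h_def algebra_simps)
qed

text \<open>
  The contact integrand equals \<open>(\<beta> - v \<cdot> n) q\<^sup>+ + (v \<cdot> n - \<alpha>) q\<^sup>-\<close>.
\<close>

lemma weak_duality:
  assumes q: "q \<in> primal" and v: "v \<in> dual"
  shows "D v \<le> I q"
proof -
  have "0 \<le> (\<integral>x. contact_density (\<alpha> x) (\<beta> x) (trace_op \<Omega> q x) - flux \<Omega> \<Gamma>\<^sub>C v x * trace_op \<Omega> q x \<partial>SC)"
  proof (rule integral_nonneg_AE)
    show "AE x in SC. 0 \<le> contact_density (\<alpha> x) (\<beta> x) (trace_op \<Omega> q x) - flux \<Omega> \<Gamma>\<^sub>C v x * trace_op \<Omega> q x"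
      using dual_facts(6)[OF v]
    proof eventually_elim
      case (elim x)
      show ?case
      proof (cases "0 \<le> trace_op \<Omega> q x")
        case True
        then show ?thesis using elim mult_right_mono[of "flux \<Omega> \<Gamma>\<^sub>C v x" "\<beta> x" "trace_op \<Omega> q x"]
          by (simp add: contact_density_def pos_part_def neg_part_def)
      next
        case False
        then show ?thesis using elim mult_right_mono_neg[of "\<alpha> x" "flux \<Omega> \<Gamma>\<^sub>C v x" "trace_op \<Omega> q x"]
          by (simp add: contact_density_def pos_part_def neg_part_def)
      qed
    qed
  qed
  moreover have "0 \<le> (\<integral>x. (norm (matrix_sqrt (K x) *v weak_grad \<Omega> q x + matrix_inv (matrix_sqrt (K x)) *v v x))\<^sup>2 \<partial>M)" by simp
  ultimately show ?thesis using gap_identity[OF q v] by linarith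
qed

section \<open>Strong duality\<close>

definition variation :: "(real^'n \<Rightarrow> real) \<Rightarrow> (real^'n \<Rightarrow> real) \<Rightarrow> bool" where
  "variation w g \<longleftrightarrow> has_trace \<Omega> w g \<and> (AE x in SD. g x = 0)"

text \<open>
  Formally, the normal flux of \<open>- K \<nabla>p\<close> tested with \<open>w\<close>, once the divergence of this field is known to be \<open>f\<close>.
\<close>

definition residual :: "(real^'n \<Rightarrow> real) \<Rightarrow> (real^'n \<Rightarrow> real) \<Rightarrow> real" where
  "residual p w = L2_inner M f w - L2_inner M (\<lambda>x. K x *v weak_grad \<Omega> p x) (weak_grad \<Omega> w)"

definition slope_integral :: "(real^'n \<Rightarrow> real) \<Rightarrow> (real^'n \<Rightarrow> real) \<Rightarrow> real" where
  "slope_integral p \<eta> = (\<integral>x. contact_slope (\<alpha> x) (\<beta> x) (trace_op \<Omega> p x) (\<eta> x) \<partial>SC)"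

lemma variation_lincomb:
  assumes "variation w g" "variation w' g'"
  shows "variation (\<lambda>x. w x + c * w' x) (\<lambda>x. g x + c * g' x)"
proof -
  have "AE x in SD. g x = 0" "AE x in SD. g' x = 0" using assms by (simp_all add: variation_def)
  then have "AE x in SD. g x + c * g' x = 0" by eventually_elim simp
  then show ?thesis using assms by (auto simp: variation_def intro: has_trace_lincomb)
qed

lemma residual_lincomb:
  assumes p: "p \<in> H1 \<Omega>" and w: "w \<in> H1 \<Omega>" "w' \<in> H1 \<Omega>"
  shows "residual p (\<lambda>x. w x + c * w' x) = residual p w + c * residual p w'"
  unfolding residual_def weak_grad_lincomb_inner[OF K_mult_L2[OF weak_grad_L2[OF p]] w]
    L2_inner_lincomb_right_real[OF f H1_L2[OF w(1)] H1_L2[OF w(2)]]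
  by (simp add: algebra_simps)

lemma energy_form_expand:
  assumes p: "p \<in> H1 \<Omega>" and w: "w \<in> H1 \<Omega>"
  shows "L2_inner M (\<lambda>x. K x *v weak_grad \<Omega> (\<lambda>x. p x + c * w x) x) (weak_grad \<Omega> (\<lambda>x. p x + c * w x)) =
    L2_inner M (\<lambda>x. K x *v weak_grad \<Omega> p x) (weak_grad \<Omega> p)
    + 2 * c * L2_inner M (\<lambda>x. K x *v weak_grad \<Omega> p x) (weak_grad \<Omega> w)
    + c\<^sup>2 * L2_inner M (\<lambda>x. K x *v weak_grad \<Omega> w x) (weak_grad \<Omega> w)"
proof -
  define a b z where "a = weak_grad \<Omega> p" and "b = weak_grad \<Omega> w" and "z = weak_grad \<Omega> (\<lambda>x. p x + c * w x)"
  have L: "a \<in> L2 M" "b \<in> L2 M" "z \<in> L2 M" unfolding a_def b_def z_def by (intro weak_grad_L2 H1_lincomb p w)+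
  have z: "AE x in M. z x = a x + c *\<^sub>R b x" unfolding a_def b_def z_def by (rule weak_grad_lincomb[OF p w])
  have i: "integrable M (\<lambda>x. (K x *v a x) \<bullet> a x)" "integrable M (\<lambda>x. (K x *v a x) \<bullet> b x)" "integrable M (\<lambda>x. (K x *v b x) \<bullet> b x)"
    by (intro L2_inner_integrable K_mult_L2 L)+
  have "L2_inner M (\<lambda>x. K x *v z x) z = (\<integral>x. (K x *v a x) \<bullet> a x + 2 * c * ((K x *v a x) \<bullet> b x) + c\<^sup>2 * ((K x *v b x) \<bullet> b x) \<partial>M)"
    unfolding L2_inner_def
  proof (rule integral_cong_AE)
    show "(\<lambda>x. (K x *v z x) \<bullet> z x) \<in> borel_measurable M"
      using L2_inner_integrable[OF K_mult_L2[OF L(3)] L(3)] by simp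
    show "(\<lambda>x. (K x *v a x) \<bullet> a x + 2 * c * ((K x *v a x) \<bullet> b x) + c\<^sup>2 * ((K x *v b x) \<bullet> b x)) \<in> borel_measurable M"
      using i[THEN borel_measurable_integrable] by measurable
    have "AE x in M. x \<in> \<Omega>" by (intro AE_I2) simp
    with z show "AE x in M. (K x *v z x) \<bullet> z x = (K x *v a x) \<bullet> a x + 2 * c * ((K x *v a x) \<bullet> b x) + c\<^sup>2 * ((K x *v b x) \<bullet> b x)"
    proof eventually_elim
      case (elim x)
      have "(K x *v b x) \<bullet> a x = (K x *v a x) \<bullet> b x"
        using symmetric_matrix_inner[OF K_sym[OF elim(2)], of "a x" "b x"] by (simp add: inner_commute)
      then show ?case
        using elim(1) by (simp add: matrix_vector_right_distrib matrix_vector_mult_scaleR inner_simps power2_eq_square algebra_simps)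
    qed
  qed
  then show ?thesis using i by (simp add: a_def b_def z_def L2_inner_def)
qed

text \<open>
  The difference quotients of the energy at the minimizer \<open>p\<close> along \<open>w\<close> are nonnegative. In the limit the quadratic
  part contributes minus the residual, and the contact part converges by dominated convergence.
\<close>

lemma residual_le_slope:
  assumes p: "is_arg_min I (\<lambda>r. r \<in> primal) p" and w: "variation w g"
  shows "residual p w \<le> slope_integral p g"
proof -
  have pp: "p \<in> primal" using p by (simp add: is_arg_min_def)
  note P = primal_trace[OF pp]
  define gp where "gp = trace_op \<Omega> p"
  have t: "has_trace \<Omega> w g" and g0: "AE x in SD. g x = 0" using w by (simp_all add: variation_def)
  note W = has_trace_D(1)[OF t]
  define A where "A = L2_inner M (\<lambda>x. K x *v weak_grad \<Omega> w x) (weak_grad \<Omega> w)"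
  define \<tau> where "\<tau> n = inverse (real (Suc n))" for n
  have \<tau>: "0 < \<tau> n" for n by (simp add: \<tau>_def)
  have \<tau>lim: "\<tau> \<longlonglongrightarrow> 0" unfolding \<tau>_def by (rule LIMSEQ_inverse_real_of_nat)
  define Q where "Q n x = (contact_density (\<alpha> x) (\<beta> x) (gp x + \<tau> n * g x) - contact_density (\<alpha> x) (\<beta> x) (gp x)) / \<tau> n" for n x
  have L: "gp \<in> L2 SC" "g \<in> L2 SC" using trace_L2_SC[OF P(2)] trace_L2_SC[OF t] by (simp_all add: gp_def)
  have ti: "has_trace \<Omega> (\<lambda>x. p x + \<tau> n * w x) (\<lambda>x. gp x + \<tau> n * g x)" for n
    unfolding gp_def by (rule has_trace_lincomb[OF P(2) t])
  have step: "residual p w \<le> \<tau> n / 2 * A + (\<integral>x. Q n x \<partial>SC)" for n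
  proof -
    have "AE x in SD. gp x + \<tau> n * g x = p\<^sub>D x"
      using P(3) g0 unfolding gp_def by eventually_elim simp
    then have "(\<lambda>x. p x + \<tau> n * w x) \<in> primal"
      using ti[of n] has_trace_D(1)[OF ti[of n]] by (auto simp: primal_set_def trace_equals_on_def)
    then have "I p \<le> I (\<lambda>x. p x + \<tau> n * w x)" using p by (auto simp: is_arg_min_def not_less)
    then have "0 \<le> \<tau> n * L2_inner M (\<lambda>x. K x *v weak_grad \<Omega> p x) (weak_grad \<Omega> w) + (\<tau> n)\<^sup>2 / 2 * A - \<tau> n * L2_inner M f w
      + ((\<integral>x. contact_density (\<alpha> x) (\<beta> x) (gp x + \<tau> n * g x) \<partial>SC) - (\<integral>x. contact_density (\<alpha> x) (\<beta> x) (gp x) \<partial>SC))"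
      unfolding primal_energy_eq[OF ti] primal_energy_eq[OF P(2)] energy_form_expand[OF P(1) W]
        L2_inner_lincomb_right_real[OF f H1_L2[OF P(1)] H1_L2[OF W]]
      by (simp add: A_def gp_def algebra_simps)
    also have "(\<integral>x. contact_density (\<alpha> x) (\<beta> x) (gp x + \<tau> n * g x) \<partial>SC) - (\<integral>x. contact_density (\<alpha> x) (\<beta> x) (gp x) \<partial>SC)
        = \<tau> n * (\<integral>x. Q n x \<partial>SC)"
      using contact_integral(1)[OF L(1)] contact_integral(1)[OF L2_lincomb_real[OF L], of "\<tau> n"] \<tau>[of n]
      by (simp add: Q_def)
    finally have "0 \<le> \<tau> n * (- residual p w + \<tau> n / 2 * A + (\<integral>x. Q n x \<partial>SC))"
      by (simp add: residual_def power2_eq_square algebra_simps)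
    then have "0 \<le> - residual p w + \<tau> n / 2 * A + (\<integral>x. Q n x \<partial>SC)" using \<tau>[of n] by (simp add: zero_le_mult_iff)
    then show ?thesis by simp
  qed
  have [measurable]: "\<alpha> \<in> borel_measurable SC" "\<beta> \<in> borel_measurable SC" "g \<in> borel_measurable SC" "gp \<in> borel_measurable SC"
    using \<alpha> \<beta> L by (simp_all add: L2_D(1))
  have "(\<lambda>n. \<integral>x. Q n x \<partial>SC) \<longlonglongrightarrow> slope_integral p g"
    unfolding slope_integral_def gp_def[symmetric]
  proof (rule integral_dominated_convergence[where w="\<lambda>x. \<bar>\<alpha> x * g x\<bar> + \<bar>\<beta> x * g x\<bar>"])
    show "integrable SC (\<lambda>x. \<bar>\<alpha> x * g x\<bar> + \<bar>\<beta> x * g x\<bar>)"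
      using L2_mult_integrable[OF \<alpha> L(2)] L2_mult_integrable[OF \<beta> L(2)] by simp
    show "AE x in SC. (\<lambda>n. Q n x) \<longlonglongrightarrow> contact_slope (\<alpha> x) (\<beta> x) (gp x) (g x)"
      unfolding Q_def by (intro AE_I2 contact_density_difference_quotient \<tau> \<tau>lim)
    show "AE x in SC. norm (Q n x) \<le> \<bar>\<alpha> x * g x\<bar> + \<bar>\<beta> x * g x\<bar>" for n
    proof (rule AE_I2)
      fix x
      have "\<bar>contact_density (\<alpha> x) (\<beta> x) (gp x + \<tau> n * g x) - contact_density (\<alpha> x) (\<beta> x) (gp x)\<bar> \<le> (\<bar>\<alpha> x\<bar> + \<bar>\<beta> x\<bar>) * \<bar>\<tau> n * g x\<bar>"
        by (rule contact_density_bound)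
      also have "\<dots> = \<tau> n * (\<bar>\<alpha> x * g x\<bar> + \<bar>\<beta> x * g x\<bar>)"
        using \<tau>[of n] by (simp add: abs_mult algebra_simps)
      finally show "norm (Q n x) \<le> \<bar>\<alpha> x * g x\<bar> + \<bar>\<beta> x * g x\<bar>"
        using \<tau>[of n] by (simp add: Q_def abs_divide pos_divide_le_eq mult.commute)
    qed
  qed (unfold Q_def, measurable)
  moreover have "(\<lambda>n. \<tau> n / 2 * A) \<longlonglongrightarrow> 0 / 2 * A" by (intro tendsto_intros \<tau>lim) simp
  ultimately have "(\<lambda>n. \<tau> n / 2 * A + (\<integral>x. Q n x \<partial>SC)) \<longlonglongrightarrow> 0 / 2 * A + slope_integral p g"
    by (intro tendsto_add)
  then show ?thesis using step by (intro LIMSEQ_le_const) auto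
qed

lemma slope_integrable:
  assumes p: "p \<in> primal" and \<eta>: "\<eta> \<in> L2 SC"
  shows "integrable SC (\<lambda>x. contact_slope (\<alpha> x) (\<beta> x) (trace_op \<Omega> p x) (\<eta> x))"
proof (rule Bochner_Integration.integrable_bound)
  show "integrable SC (\<lambda>x. \<bar>\<alpha> x * \<eta> x\<bar> + \<bar>\<beta> x * \<eta> x\<bar>)"
    using L2_mult_integrable[OF \<alpha> \<eta>] L2_mult_integrable[OF \<beta> \<eta>] by simp
  have [measurable]: "\<alpha> \<in> borel_measurable SC" "\<beta> \<in> borel_measurable SC" "\<eta> \<in> borel_measurable SC" "trace_op \<Omega> p \<in> borel_measurable SC"
    using \<alpha> \<beta> \<eta> trace_L2_SC[OF primal_trace(2)[OF p]] by (simp_all add: L2_D(1))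
  show "(\<lambda>x. contact_slope (\<alpha> x) (\<beta> x) (trace_op \<Omega> p x) (\<eta> x)) \<in> borel_measurable SC" by measurable
  show "AE x in SC. norm (contact_slope (\<alpha> x) (\<beta> x) (trace_op \<Omega> p x) (\<eta> x)) \<le> norm (\<bar>\<alpha> x * \<eta> x\<bar> + \<bar>\<beta> x * \<eta> x\<bar>)"
    using contact_slope_bound by (intro AE_I2) (simp add: abs_mult distrib_right)
qed

text \<open>
  The residual only depends on the trace of the variation: on a difference of two variations with equal trace, the
  slope vanishes. Hahn-Banach extends it to a functional below the slope, which on nonnegative \<open>\<eta>\<close> lies between
  \<open>\<integral> \<alpha> \<eta>\<close> and \<open>\<integral> \<beta> \<eta>\<close>. At \<open>p\<close> itself the slopes in the directions of plus and minus its trace are plus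
  and minus the contact energy, which fixes the value of the functional there.
\<close>

lemma ex_contact_flux:
  assumes p: "is_arg_min I (\<lambda>r. r \<in> primal) p"
  obtains h where "h \<in> L2 SC" "AE x in SC. \<alpha> x \<le> h x \<and> h x \<le> \<beta> x"
    "\<And>w g. variation w g \<Longrightarrow> residual p w = L2_inner SC h g"
    "L2_inner SC h (trace_op \<Omega> p) = (\<integral>x. contact_density (\<alpha> x) (\<beta> x) (trace_op \<Omega> p x) \<partial>SC)"
proof -
  have pp: "p \<in> primal" using p by (simp add: is_arg_min_def)
  note P = primal_trace[OF pp]
  define gp where "gp = trace_op \<Omega> p"
  have gpL: "gp \<in> L2 SC" unfolding gp_def by (rule trace_L2_SC[OF P(2)])
  note slope_int = slope_integrable[OF pp, folded gp_def]
  note sl = slope_integral_def[of p, folded gp_def]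
  define Y where "Y = {g. \<exists>w. variation w g}"
  have YX: "Y \<subseteq> L2 SC" unfolding Y_def variation_def using trace_L2_SC by blast
  have wd: "residual p w = residual p w'" if v: "variation w g" "variation w' g" for w w' g
  proof -
    have "residual p w - residual p w' \<le> 0" if v: "variation w g" "variation w' g" for w w'
    proof -
      have "variation (\<lambda>x. w x + (-1) * w' x) (\<lambda>x. g x + (-1) * g x)" by (rule variation_lincomb[OF v])
      then have "residual p (\<lambda>x. w x + (-1) * w' x) \<le> slope_integral p (\<lambda>x. g x + (-1) * g x)"
        by (rule residual_le_slope[OF p])
      moreover have "slope_integral p (\<lambda>x. g x + (-1) * g x) = 0"
        by (simp add: slope_integral_def contact_slope_0)
      moreover have "w \<in> H1 \<Omega>" "w' \<in> H1 \<Omega>" using v has_trace_D(1) by (auto simp: variation_def)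
      ultimately show ?thesis using residual_lincomb[OF P(1), of w w' "-1"] by simp
    qed
    from this[OF v] this[OF v(2,1)] show ?thesis by linarith
  qed
  define l where "l g = residual p (SOME w. variation w g)" for g
  have l: "l g = residual p w" if "variation w g" for w g
    unfolding l_def by (rule wd[OF someI[where P="\<lambda>w. variation w g", OF that] that])
  interpret X: function_space "L2 SC" by (rule L2_function_space)
  have sub: "X.sublinear (slope_integral p)"
    unfolding X.sublinear_def
  proof (intro conjI ballI allI impI)
    fix x y :: "real^'n \<Rightarrow> real" assume xy: "x \<in> L2 SC" "y \<in> L2 SC"
    have "slope_integral p (\<lambda>s. x s + y s) \<le> (\<integral>s. contact_slope (\<alpha> s) (\<beta> s) (gp s) (x s) + contact_slope (\<alpha> s) (\<beta> s) (gp s) (y s) \<partial>SC)"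
      unfolding sl
    proof (rule integral_mono_AE)
      show "AE s in SC. contact_slope (\<alpha> s) (\<beta> s) (gp s) (x s + y s) \<le> contact_slope (\<alpha> s) (\<beta> s) (gp s) (x s) + contact_slope (\<alpha> s) (\<beta> s) (gp s) (y s)"
        using \<alpha>_le_\<beta> by eventually_elim (rule contact_slope_subadditive)
    qed (use slope_int[OF X.add_mem[OF xy]] slope_int[OF xy(1)] slope_int[OF xy(2)] in auto)
    then show "slope_integral p (\<lambda>s. x s + y s) \<le> slope_integral p x + slope_integral p y"
      using slope_int[OF xy(1)] slope_int[OF xy(2)] by (simp add: sl)
  next
    fix x :: "real^'n \<Rightarrow> real" and c :: real assume x: "x \<in> L2 SC" and c: "0 < c"
    show "slope_integral p (\<lambda>s. c * x s) \<le> c * slope_integral p x"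
      by (simp add: slope_integral_def contact_slope_scale[OF c])
  qed
  have zt: "variation (\<lambda>x. 0) (\<lambda>x. 0)"
    using has_trace_smooth[OF smooth_const, of 0] by (simp add: variation_def)
  have Yf: "function_space Y"
  proof
    show "(\<lambda>s. 0) \<in> Y" using zt by (auto simp: Y_def)
    show "(\<lambda>s. x s + c * y s) \<in> Y" if "x \<in> Y" "y \<in> Y" for x y c
      using that variation_lincomb unfolding Y_def by blast
  qed
  have lin: "l (\<lambda>s. x s + c * y s) = l x + c * l y" if xy: "x \<in> Y" "y \<in> Y" for x y c
  proof -
    obtain w w' where v: "variation w x" "variation w' y" using xy by (auto simp: Y_def)
    have "w \<in> H1 \<Omega>" "w' \<in> H1 \<Omega>" using v has_trace_D(1) by (auto simp: variation_def)
    then show ?thesis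
      unfolding l[OF v(1)] l[OF v(2)] l[OF variation_lincomb[OF v]] by (rule residual_lincomb[OF P(1)])
  qed
  have le: "l y \<le> slope_integral p y" if "y \<in> Y" for y
    using that l residual_le_slope[OF p] by (auto simp: Y_def)
  obtain L where L: "\<And>x y c. x \<in> L2 SC \<Longrightarrow> y \<in> L2 SC \<Longrightarrow> L (\<lambda>s. x s + c * y s) = L x + c * L y"
    "\<And>x. x \<in> L2 SC \<Longrightarrow> L x \<le> slope_integral p x" "\<And>y. y \<in> Y \<Longrightarrow> L y = l y"
    by (rule X.hahn_banach[OF sub Yf YX lin le]) blast+
  have Lminus: "L (\<lambda>s. - x s) = - L x" if "x \<in> L2 SC" for x
    using L(1)[OF L2_zero that, of "-1"] L(1)[OF L2_zero L2_zero, of "-1"] by simp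
  have "\<exists>h\<in>L2 SC. (AE s in SC. \<alpha> s \<le> h s \<and> h s \<le> \<beta> s) \<and> (\<forall>\<eta>\<in>L2 SC. L \<eta> = (\<integral>s. h s * \<eta> s \<partial>SC))"
  proof (rule L2_bounded_functional_density[OF finite_SC \<alpha> \<beta> L(1)])
    fix \<eta> :: "real^'n \<Rightarrow> real" assume \<eta>: "\<eta> \<in> L2 SC" and pos: "\<And>s. 0 \<le> \<eta> s"
    have "L (\<lambda>s. - \<eta> s) \<le> slope_integral p (\<lambda>s. - \<eta> s)" by (rule L(2)[OF X.minus_mem[OF \<eta>]])
    also have "\<dots> \<le> (\<integral>s. - (\<alpha> s * \<eta> s) \<partial>SC)"
      unfolding sl
    proof (rule integral_mono_AE)
      show "AE s in SC. contact_slope (\<alpha> s) (\<beta> s) (gp s) (- \<eta> s) \<le> - (\<alpha> s * \<eta> s)"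
        using \<alpha>_le_\<beta> by eventually_elim (rule contact_slope_le_neg[OF _ pos])
    qed (use slope_int[OF X.minus_mem[OF \<eta>]] L2_mult_integrable[OF \<alpha> \<eta>] in auto)
    finally show "(\<integral>s. \<alpha> s * \<eta> s \<partial>SC) \<le> L \<eta>" using Lminus[OF \<eta>] by simp
    have "L \<eta> \<le> slope_integral p \<eta>" by (rule L(2)[OF \<eta>])
    also have "\<dots> \<le> (\<integral>s. \<beta> s * \<eta> s \<partial>SC)"
      unfolding sl
    proof (rule integral_mono_AE)
      show "AE s in SC. contact_slope (\<alpha> s) (\<beta> s) (gp s) (\<eta> s) \<le> \<beta> s * \<eta> s"
        using \<alpha>_le_\<beta> by eventually_elim (rule contact_slope_le[OF _ pos])
    qed (use slope_int[OF \<eta>] L2_mult_integrable[OF \<beta> \<eta>] in auto)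
    finally show "L \<eta> \<le> (\<integral>s. \<beta> s * \<eta> s \<partial>SC)" .
  qed
  then obtain h where h: "h \<in> L2 SC" "AE s in SC. \<alpha> s \<le> h s \<and> h s \<le> \<beta> s"
    "\<And>\<eta>. \<eta> \<in> L2 SC \<Longrightarrow> L \<eta> = (\<integral>s. h s * \<eta> s \<partial>SC)" by blast
  show thesis
  proof (rule that[OF h(1,2)])
    fix w g assume v: "variation w g"
    then have "g \<in> Y" by (auto simp: Y_def)
    then have "L g = residual p w" "g \<in> L2 SC" using L(3) l[OF v] YX by auto
    then show "residual p w = L2_inner SC h g" using h(3)[of g] by (simp add: L2_inner_def)
  next
    have "L gp \<le> (\<integral>x. contact_density (\<alpha> x) (\<beta> x) (gp x) \<partial>SC)"
      using L(2)[OF gpL] by (simp add: sl contact_slope_self)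
    moreover have "- L gp \<le> - (\<integral>x. contact_density (\<alpha> x) (\<beta> x) (gp x) \<partial>SC)"
      using L(2)[OF X.minus_mem[OF gpL]] Lminus[OF gpL] by (simp add: sl contact_slope_self)
    ultimately have "L gp = (\<integral>x. contact_density (\<alpha> x) (\<beta> x) (gp x) \<partial>SC)" by linarith
    then show "L2_inner SC h (trace_op \<Omega> p) = (\<integral>x. contact_density (\<alpha> x) (\<beta> x) (trace_op \<Omega> p x) \<partial>SC)"
      using h(3)[OF gpL] by (simp add: L2_inner_def gp_def)
  qed
qed

lemma variation_test_function:
  assumes \<psi>: "test_function \<Omega> \<psi>"
  shows "variation \<psi> \<psi>" "AE x in SC. \<psi> x = 0"
proof -
  note sup = test_function_support[OF \<psi>]
  have z: "\<psi> x = 0" if "x \<in> frontier \<Omega>" for x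
    using that open_\<Omega> by (intro sup(3)) (simp add: frontier_def interior_open)
  have "AE x in S. \<psi> x = 0"
    by (intro AE_I2 z) (simp add: surface_on_def space_restrict_space)
  then have "AE x in SD. \<psi> x = 0" "AE x in SC. \<psi> x = 0"
    using AE_part \<Gamma>D(1,2) \<Gamma>C(1,2) by blast+
  then show "variation \<psi> \<psi>" "AE x in SC. \<psi> x = 0"
    using has_trace_smooth[OF sup(1)] by (simp_all add: variation_def)
qed

text \<open>
  The field \<open>v = - K \<nabla>p\<close> has divergence \<open>f\<close>, because test functions are variations with zero trace, and contact flux
  \<open>h\<close>. Both residuals in the gap identity vanish for it.
\<close>

lemma strong_duality_witness:
  assumes p: "is_arg_min I (\<lambda>r. r \<in> primal) p"
  obtains v where "v \<in> dual" "I p = D v"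
proof -
  have pp: "p \<in> primal" using p by (simp add: is_arg_min_def)
  note P = primal_trace[OF pp]
  have GL: "weak_grad \<Omega> p \<in> L2 M" by (rule weak_grad_L2[OF P(1)])
  obtain h where h: "h \<in> L2 SC" "AE x in SC. \<alpha> x \<le> h x \<and> h x \<le> \<beta> x"
    "\<And>w g. variation w g \<Longrightarrow> residual p w = L2_inner SC h g"
    "L2_inner SC h (trace_op \<Omega> p) = (\<integral>x. contact_density (\<alpha> x) (\<beta> x) (trace_op \<Omega> p x) \<partial>SC)"
    by (rule ex_contact_flux[OF p]) blast
  define v where "v x = - (K x *v weak_grad \<Omega> p x)" for x
  have vL: "v \<in> L2 M" using L2_scale[OF K_mult_L2[OF GL], of "-1"] by (simp add: v_def[abs_def])
  have res: "residual p w = L2_inner M v (weak_grad \<Omega> w) + L2_inner M f w" for w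
    by (simp add: residual_def v_def L2_inner_def)
  have div: "has_weak_div \<Omega> v f"
    unfolding has_weak_div_def
  proof (intro allI impI)
    fix \<psi> assume \<psi>: "test_function \<Omega> \<psi>"
    note sm = test_function_support(1)[OF \<psi>]
    note V = variation_test_function[OF \<psi>]
    have "\<psi> \<in> borel_measurable SC"
      using V(1) trace_L2_SC L2_D(1) by (auto simp: variation_def)
    then have "L2_inner SC h \<psi> = L2_inner SC h (\<lambda>x. 0)"
      using V(2) L2_D(1)[OF h(1)] by (intro L2_inner_AE_cong) auto
    then have "residual p \<psi> = 0" using h(3)[OF V(1)] by (simp add: L2_inner_def)
    moreover have "L2_inner M v (weak_grad \<Omega> \<psi>) = L2_inner M v (grad \<psi>)"
      using smooth_H1[OF sm] L2_D(1)[OF vL] L2_D(1)[OF weak_grad_L2[OF smooth_H1(1)[OF sm]]]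
        L2_D(1)[OF test_function_L2(2)[OF \<psi>]]
      by (intro L2_inner_AE_cong) auto
    ultimately show "(\<integral>x. v x \<bullet> grad \<psi> x \<partial>M) = - (\<integral>x. f x * \<psi> x \<partial>M)"
      using res[of \<psi>] by (simp add: L2_inner_def)
  qed
  note wdiv = weak_div_unique[OF f div]
  have wres: "L2_inner M v (weak_grad \<Omega> w) + L2_inner M (weak_div \<Omega> v) w = residual p w" if w: "w \<in> H1 \<Omega>" for w
  proof -
    have "L2_inner M (weak_div \<Omega> v) w = L2_inner M f w"
      using wdiv L2_D(1)[OF wdiv(1)] L2_D(1)[OF f] L2_D(1)[OF H1_L2[OF w]] by (intro L2_inner_AE_cong) auto
    then show ?thesis by (simp add: res)
  qed
  \<comment> \<open>A functional of the trace: two functions with the same trace differ by a variation with trace zero.\<close>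
  have well: "residual p w = residual p w'" if t: "has_trace \<Omega> w g" "has_trace \<Omega> w' g" for w w' g
  proof -
    have "has_trace \<Omega> (\<lambda>x. w x + (-1) * w' x) (\<lambda>x. 0)" using has_trace_lincomb[OF t, of "-1"] by simp
    then have "residual p (\<lambda>x. w x + (-1) * w' x) = L2_inner SC h (\<lambda>x. 0)"
      by (intro h(3)) (simp add: variation_def)
    then show ?thesis
      using residual_lincomb[OF P(1) has_trace_D(1)[OF t(1)] has_trace_D(1)[OF t(2)], of "-1"]
      by (simp add: L2_inner_def)
  qed
  define T where "T g = residual p (SOME w. has_trace \<Omega> w g)" for g
  have T: "T g = residual p w" if "has_trace \<Omega> w g" for w g
    unfolding T_def by (rule well[OF someI[where P="\<lambda>w. has_trace \<Omega> w g", OF that] that])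
  have nt: "has_normal_trace \<Omega> v T"
    unfolding has_normal_trace_def using T wres by simp
  have "T (zero_ext \<Gamma>\<^sub>C \<eta>) = L2_inner SC h \<eta>" if \<eta>: "\<eta> \<in> H_half_00 \<Omega> \<Gamma>\<^sub>C" for \<eta>
  proof -
    obtain w g where g: "has_trace \<Omega> w g" "AE x in S. g x = zero_ext \<Gamma>\<^sub>C \<eta> x" "zero_ext \<Gamma>\<^sub>C \<eta> \<in> borel_measurable S"
      using \<eta> by (auto simp: H_half_00_def H_half_def trace_equals_on_def)
    have t: "has_trace \<Omega> w (zero_ext \<Gamma>\<^sub>C \<eta>)" by (rule has_trace_cong[OF g(1,3,2)])
    have "AE x in SD. zero_ext \<Gamma>\<^sub>C \<eta> x = 0"
      using disj by (intro AE_I2) (auto simp: surface_on_def space_restrict_space zero_ext_def)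
    then have "T (zero_ext \<Gamma>\<^sub>C \<eta>) = L2_inner SC h (zero_ext \<Gamma>\<^sub>C \<eta>)"
      using T[OF t] h(3)[of w "zero_ext \<Gamma>\<^sub>C \<eta>"] t by (simp add: variation_def)
    also have "\<dots> = L2_inner SC h \<eta>"
      unfolding L2_inner_def
      by (intro Bochner_Integration.integral_cong refl) (simp add: surface_on_def space_restrict_space zero_ext_def)
    finally show ?thesis .
  qed
  then have fl: "has_flux \<Omega> \<Gamma>\<^sub>C v h" unfolding has_flux_def using h(1) nt by blast
  have V: "v \<in> V_space \<Omega> \<Gamma>\<^sub>C" using vL f div fl by (auto simp: V_space_def Hdiv_def)
  have fh: "AE x in SC. flux \<Omega> \<Gamma>\<^sub>C v x = h x" by (rule flux_unique[OF has_flux_flux[OF V] fl])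
  have "AE x in SC. \<alpha> x \<le> flux \<Omega> \<Gamma>\<^sub>C v x \<and> flux \<Omega> \<Gamma>\<^sub>C v x \<le> \<beta> x"
    using fh h(2) by eventually_elim simp
  then have vd: "v \<in> dual" using V wdiv(2) by (simp add: dual_set_def)
  have gpL: "trace_op \<Omega> p \<in> L2 SC" by (rule trace_L2_SC[OF P(2)])
  have fL: "flux \<Omega> \<Gamma>\<^sub>C v \<in> L2 SC" by (rule dual_facts(5)[OF vd])
  have "L2_inner SC (flux \<Omega> \<Gamma>\<^sub>C v) (trace_op \<Omega> p) = L2_inner SC h (trace_op \<Omega> p)"
    using fh L2_D(1)[OF fL] L2_D(1)[OF h(1)] L2_D(1)[OF gpL] by (intro L2_inner_AE_cong) auto
  then have "(\<integral>x. contact_density (\<alpha> x) (\<beta> x) (trace_op \<Omega> p x) - flux \<Omega> \<Gamma>\<^sub>C v x * trace_op \<Omega> p x \<partial>SC) = 0"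
    using h(4) contact_integral(1)[OF gpL] L2_mult_integrable[OF fL gpL] by (simp add: L2_inner_def)
  moreover have "(\<integral>x. (norm (matrix_sqrt (K x) *v weak_grad \<Omega> p x + matrix_inv (matrix_sqrt (K x)) *v v x))\<^sup>2 \<partial>M) = (\<integral>x. 0 \<partial>M)"
  proof (rule Bochner_Integration.integral_cong[OF refl])
    fix x assume "x \<in> space M"
    then have x: "x \<in> \<Omega>" by simp
    have "matrix_inv (matrix_sqrt (K x)) *v v x = - (matrix_inv (matrix_sqrt (K x)) *v (K x *v weak_grad \<Omega> p x))"
      unfolding v_def by (metis linear_neg matrix_vector_mul_linear)
    then show "(norm (matrix_sqrt (K x) *v weak_grad \<Omega> p x + matrix_inv (matrix_sqrt (K x)) *v v x))\<^sup>2 = 0"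
      using inv_sqrt_K_mult[OF x x] by simp
  qed
  ultimately have "I p = D v" using gap_identity[OF pp vd] by simp
  then show thesis using vd that by blast
qed

theorem strong_duality:
  assumes p: "is_arg_min I (\<lambda>r. r \<in> primal) p" and u: "is_arg_max D (\<lambda>v. v \<in> dual) u"
  shows "I p = D u"
proof (rule antisym)
  obtain v where v: "v \<in> dual" "I p = D v" by (rule strong_duality_witness[OF p])
  then show "I p \<le> D u" using u by (auto simp: is_arg_max_def not_less)
  show "D u \<le> I p" using p u by (intro weak_duality) (auto simp: is_arg_min_def is_arg_max_def)
qed

end

theorem theorem4p3:
  fixes \<Omega> \<Gamma>\<^sub>D \<Gamma>\<^sub>C :: "(real^'n) set"
    and f p\<^sub>D \<alpha> \<beta> :: "real^'n \<Rightarrow> real"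
    and K :: "real^'n \<Rightarrow> real^'n^'n"
    and k\<^sub>0 k\<^sub>1 :: real
    and p q :: "real^'n \<Rightarrow> real"
    and u v :: "real^'n \<Rightarrow> real^'n"
  assumes dim: "CARD('n) = 2 \<or> CARD('n) = 3"
    and dom: "polyhedral_lipschitz_domain \<Omega>"
    and open_D: "openin (top_of_set (frontier \<Omega>)) \<Gamma>\<^sub>D"
    and open_C: "openin (top_of_set (frontier \<Omega>)) \<Gamma>\<^sub>C"
    and disj: "\<Gamma>\<^sub>D \<inter> \<Gamma>\<^sub>C = {}"
    and cover: "frontier \<Omega> = closure \<Gamma>\<^sub>D \<union> closure \<Gamma>\<^sub>C"
    and interface_null: "AE x in surface_on (frontier \<Omega>). x \<in> \<Gamma>\<^sub>D \<union> \<Gamma>\<^sub>C"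
    and f: "f \<in> L2 (lebesgue_on \<Omega>)"
    and p\<^sub>D: "p\<^sub>D \<in> H_half \<Omega> \<Gamma>\<^sub>D"
    and K_meas: "K \<in> borel_measurable (lebesgue_on \<Omega>)"
    and K_sym: "\<And>x. x \<in> \<Omega> \<Longrightarrow> transpose (K x) = K x"
    and k: "0 < k\<^sub>0" "k\<^sub>0 < k\<^sub>1"
    and K_bounds: "\<And>x \<xi>. x \<in> \<Omega> \<Longrightarrow>
          k\<^sub>0 * (norm \<xi>)\<^sup>2 \<le> \<xi> \<bullet> (K x *v \<xi>) \<and> \<xi> \<bullet> (K x *v \<xi>) \<le> k\<^sub>1 * (norm \<xi>)\<^sup>2"
    and \<alpha>: "\<alpha> \<in> L2 (surface_on \<Gamma>\<^sub>C)"
    and \<beta>: "\<beta> \<in> L2 (surface_on \<Gamma>\<^sub>C)"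
    and \<alpha>_le_\<beta>: "AE x in surface_on \<Gamma>\<^sub>C. \<alpha> x \<le> \<beta> x"
    and compat: "\<Gamma>\<^sub>D = {} \<Longrightarrow>
          (\<integral>x. \<alpha> x \<partial>surface_on \<Gamma>\<^sub>C) \<le> (\<integral>x. f x \<partial>lebesgue_on \<Omega>) \<and>
          (\<integral>x. f x \<partial>lebesgue_on \<Omega>) \<le> (\<integral>x. \<beta> x \<partial>surface_on \<Gamma>\<^sub>C)"
    and p: "is_arg_min (primal_energy \<Omega> \<Gamma>\<^sub>C K f \<alpha> \<beta>) (\<lambda>r. r \<in> primal_set \<Omega> \<Gamma>\<^sub>D p\<^sub>D) p"
    and u: "is_arg_max (dual_energy \<Omega> \<Gamma>\<^sub>D \<Gamma>\<^sub>C K f p\<^sub>D) (\<lambda>w. w \<in> dual_set \<Omega> \<Gamma>\<^sub>C f \<alpha> \<beta>) u"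
    and q: "q \<in> primal_set \<Omega> \<Gamma>\<^sub>D p\<^sub>D"
    and v: "v \<in> dual_set \<Omega> \<Gamma>\<^sub>C f \<alpha> \<beta>"
  shows "total_error_sq (primal_energy \<Omega> \<Gamma>\<^sub>C K f \<alpha> \<beta>) (dual_energy \<Omega> \<Gamma>\<^sub>D \<Gamma>\<^sub>C K f p\<^sub>D) p u q v
       = gap_estimator_sq (primal_energy \<Omega> \<Gamma>\<^sub>C K f \<alpha> \<beta>) (dual_energy \<Omega> \<Gamma>\<^sub>D \<Gamma>\<^sub>C K f p\<^sub>D) q v"
proof -
  interpret mixed_problem \<Omega> \<Gamma>\<^sub>D \<Gamma>\<^sub>C f p\<^sub>D \<alpha> \<beta> K k\<^sub>0 k\<^sub>1
  proof unfold_locales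
    show "open \<Omega>" "bounded \<Omega>" "lipschitz_boundary \<Omega>" using dom by (simp_all add: polyhedral_lipschitz_domain_def)
    show "2 \<le> CARD('n)" using dim by auto
  qed (fact assms)+
  show ?thesis using strong_duality[OF p u] by (simp add: total_error_sq_def gap_estimator_sq_def)
qed

end
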